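(* Let $K$ be a local field of characteristic $p>0$ with residue field $k$ and valuation $v$. Let $L$ and $M$ be distinct totally ramified Artin–Schrier extensions of $K$ corresponding to $f$ and $g$ respectively, where $f,g\in K$ are reduced. Let $i$ be the upper jump of $L/K$ and $j$ the upper jump of $M/K$. The ramification filtration on the Galois group $G=\mathrm{Gal}(LM/K)$ is given as follows: \begin{enumerate} \item If $i<j$, then the upper jumps are $i$ and $j$, with $G^i=G=(\mathbb{Z}/p\mathbb{Z})^2$ and $G^j=\mathbb{Z}/p\mathbb{Z}$. \item $LM/K$ is not totally ramified if and only if $f+ag+x^p-x\in k$ for some $a\in\mathbb{F}_p$ and $x\in K$. In this case $i=j$, the inertia group is $\mathbb{Z}/p\mathbb{Z}$, and the only upper jump is at $i$. \item If $i=j$ and $LM/K$ is totally ramified, then there are two cases. If $l=-v(f+ag+x^p-x)<i$ for some $a\in\mathbb{F}_p$ and $x\in K$, then $l\ge 1$ and the upper jumps are $l$ and $i$, with $G^l=G=(\mathbb{Z}/p\mathbb{Z})^2$ and $G^i=\mathbb{Z}/p\mathbb{Z}$. Otherwise there is only one upper jump, at $i$, and $G^i=G=(\mathbb{Z}/p\mathbb{Z})^2$. \end{enumerate}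
   Context: A local field is a complete discretely valued field; valuations have value group $\mathbb{Z}$. The residue field $k$ is regarded as a subfield (coefficient field) of $K$. All extensions lie in a fixed algebraic closure $\bar K$. The Artin–Schrier extension of $K$ corresponding to $f\in K$ is $K(\alpha)$ where $\alpha^p-\alpha=f$ and $\alpha\notin K$ (it is cyclic of degree $p$). An element $f\in K$ defining a totally ramified Artin–Schrier extension in this way is called reduced if $v(f)$ is coprime to $p$. For a finite Galois extension $N/K$ of local fields with group $G$, valuation $v_N$ and valuation ring $S$ of $N$: $G_i=\{\sigma\in G: v_N(\sigma x-x)\ge i+1\ \forall x\in S\}$ for integers $i\ge -1$ (so $G_0$ is the inertia group), and $G_u=G_m$ for real $u\ge -1$, where $m$ is the smallest integer with $m\ge u$. The upper numbering filtration is $G^v=G_{\psi(v)}$, where $\psi$ is the inverse of the Herbrand function $\phi(v)=\int_0^v\frac{du}{[G_0:G_u]}$. A number $u\ge 0$ is an upper jump of $G$ (or of $N/K$) if $G^u\ne G^{u+}$, where $G^{u+}=\bigcup_{\epsilon>0}G^{u+\epsilon}$. A totally ramified $p$-cyclic extension has exactly one upper jump.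
   Formalization: The residue field extension of LM/K is assumed separable (automatic for perfect k), and in item 3 the jumps l and i are asserted only when f+ag+x^p-x is reduced (such a choice is shown to exist); the statement is false otherwise. *)

theory Defs
  imports
    "HOL-Analysis.Analysis"
    "HOL-Algebra.Algebraic_Closure_Type"
    "HOL-Algebra.Generated_Fields"
    "HOL-Algebra.Finite_Extensions"
    "HOL-Algebra.Elementary_Groups"
    "HOL-Algebra.Bij"
begin

text \<open>
  The elements of the fixed algebraic closure of \<open>K\<close> form a type \<open>'a :: field\<close>; the field \<open>K\<close>, its
  residue field and all its extensions are subsets of that type.  The ring structure
  \<open>ring_of_type_algebra\<close> makes the notions of the algebra library (subfields, generated
  fields, degrees, ring homomorphisms) available for them.
\<close>

abbreviation ambient :: "'a::field ring" (\<open>\<Omega>\<close>)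
  where "\<Omega> \<equiv> ring_of_type_algebra"

definition compositum :: "'a::field set \<Rightarrow> 'a set \<Rightarrow> 'a set"
  where "compositum L M = generate_field \<Omega> (L \<union> M)"

definition extension_degree :: "'a::field set \<Rightarrow> 'a set \<Rightarrow> nat"
  where "extension_degree K N = ring.dim \<Omega> K N"


section \<open>Local fields\<close>

text \<open>
  A valuation on a field \<open>F\<close> is an integer-valued function, of which only the values on
  \<open>F - {0}\<close> matter.  The convention \<open>v(0) = \<infinity>\<close> is implemented by
  \<open>val_ge\<close>, which expresses \<open>v(x) \<ge> n\<close>.
\<close>

definition val_ge :: "('a::field \<Rightarrow> int) \<Rightarrow> 'a \<Rightarrow> int \<Rightarrow> bool"
  where "val_ge v x n \<longleftrightarrow> x = 0 \<or> n \<le> v x"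

definition discrete_valuation :: "'a::field set \<Rightarrow> ('a \<Rightarrow> int) \<Rightarrow> bool"
  where "discrete_valuation F v \<longleftrightarrow>
    subfield F \<Omega> \<and>
    (\<forall>x\<in>F - {0}. \<forall>y\<in>F - {0}. v (x * y) = v x + v y) \<and>
    (\<forall>x\<in>F - {0}. \<forall>y\<in>F - {0}. val_ge v (x + y) (min (v x) (v y))) \<and>
    v ` (F - {0}) = UNIV"

definition valuation_ring :: "'a::field set \<Rightarrow> ('a \<Rightarrow> int) \<Rightarrow> 'a set"
  where "valuation_ring F v = {x \<in> F. val_ge v x 0}"

definition val_tendsto :: "('a::field \<Rightarrow> int) \<Rightarrow> (nat \<Rightarrow> 'a) \<Rightarrow> 'a \<Rightarrow> bool"
  where "val_tendsto v s x \<longleftrightarrow> (\<forall>c. \<exists>n0. \<forall>n\<ge>n0. val_ge v (s n - x) c)"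

definition val_Cauchy :: "('a::field \<Rightarrow> int) \<Rightarrow> (nat \<Rightarrow> 'a) \<Rightarrow> bool"
  where "val_Cauchy v s \<longleftrightarrow> (\<forall>c. \<exists>n0. \<forall>m\<ge>n0. \<forall>n\<ge>n0. val_ge v (s m - s n) c)"

definition local_field :: "'a::field set \<Rightarrow> ('a \<Rightarrow> int) \<Rightarrow> bool"
  where "local_field F v \<longleftrightarrow>
    discrete_valuation F v \<and>
    (\<forall>s. range s \<subseteq> F \<and> val_Cauchy v s \<longrightarrow> (\<exists>x\<in>F. val_tendsto v s x))"

text \<open>
  A subfield \<open>k\<close> of \<open>F\<close> that the reduction map sends bijectively onto the residue field.
\<close>

definition coefficient_field :: "'a::field set \<Rightarrow> ('a \<Rightarrow> int) \<Rightarrow> 'a set \<Rightarrow> bool"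
  where "coefficient_field F v k \<longleftrightarrow>
    subfield k \<Omega> \<and> k \<subseteq> valuation_ring F v \<and>
    (\<forall>x\<in>valuation_ring F v. \<exists>!c. c \<in> k \<and> val_ge v (x - c) 1)"


section \<open>Extensions of local fields\<close>

text \<open>
  The valuation of a finite extension \<open>N\<close> of the local field \<open>(K, v)\<close>, normalised to have
  value group \<open>\<int>\<close>.  By completeness it exists, and it is unique on \<open>N - {0}\<close>; the values
  elsewhere, which the choice operator leaves open, are never used.
\<close>

definition val_ext :: "'a::field set \<Rightarrow> ('a \<Rightarrow> int) \<Rightarrow> 'a set \<Rightarrow> 'a \<Rightarrow> int"
  where "val_ext K v N = (SOME w. discrete_valuation N w \<and>
    (\<exists>e>0. \<forall>x\<in>K - {0}. w x = int e * v x))"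

definition ramification_index :: "'a::field set \<Rightarrow> ('a \<Rightarrow> int) \<Rightarrow> 'a set \<Rightarrow> nat"
  where "ramification_index K v N =
    (THE e. \<forall>x\<in>K - {0}. val_ext K v N x = int e * v x)"

definition totally_ramified :: "'a::field set \<Rightarrow> ('a \<Rightarrow> int) \<Rightarrow> 'a set \<Rightarrow> bool"
  where "totally_ramified K v N \<longleftrightarrow> ramification_index K v N = extension_degree K N"

text \<open>
  The residue field extension of \<open>N/K\<close> is separable: every residue class \<open>\<xi>\<close> of \<open>N\<close> is a root of
  a separable polynomial over the residue field of \<open>K\<close>, which is represented by its
  coefficient field \<open>k\<close>.  The predicate \<open>rsquarefree\<close> says that a polynomial has only simple
  roots in the type \<open>'a\<close>, which will be algebraically closed.  This standing assumption of the
  theory of ramification groups with upper numbering is automatic when \<open>k\<close> is perfect.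
\<close>

definition residue_separable :: "'a::field set \<Rightarrow> ('a \<Rightarrow> int) \<Rightarrow> 'a set \<Rightarrow> 'a set \<Rightarrow> bool"
  where "residue_separable K v k N \<longleftrightarrow>
    (\<forall>x\<in>valuation_ring N (val_ext K v N). \<exists>P. range (Polynomial.coeff P) \<subseteq> k \<and> rsquarefree P \<and>
       val_ge (val_ext K v N) (poly P x) 1)"

definition artin_schrier_extension :: "nat \<Rightarrow> 'a::field set \<Rightarrow> 'a \<Rightarrow> 'a set \<Rightarrow> bool"
  where "artin_schrier_extension p K f L \<longleftrightarrow>
    (\<exists>\<alpha>. \<alpha> ^ p - \<alpha> = f \<and> \<alpha> \<notin> K \<and> L = generate_field \<Omega> (insert \<alpha> K))"

text \<open>The condition \<open>f \<noteq> 0\<close> reflects that \<open>v(0) = \<infinity>\<close> is not an integer coprime to \<open>p\<close>.\<close>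

definition reduced_element :: "nat \<Rightarrow> ('a::field \<Rightarrow> int) \<Rightarrow> 'a \<Rightarrow> bool"
  where "reduced_element p v f \<longleftrightarrow> f \<noteq> 0 \<and> coprime (v f) (int p)"

text \<open>In characteristic \<open>p > 0\<close> the image of the integers is \<open>\<F>\<^sub>p\<close>.\<close>

abbreviation prime_field :: "'a::field set"
  where "prime_field \<equiv> range of_int"


section \<open>Ramification groups\<close>

definition Gal :: "'a::field set \<Rightarrow> 'a set \<Rightarrow> ('a \<Rightarrow> 'a) monoid"
  where "Gal K N = BijGroup N \<lparr>carrier :=
    {\<sigma> \<in> Bij N. \<sigma> \<in> ring_hom (\<Omega>\<lparr>carrier := N\<rparr>) (\<Omega>\<lparr>carrier := N\<rparr>) \<and> (\<forall>x\<in>K. \<sigma> x = x)}\<rparr>"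

definition lower_group :: "'a::field set \<Rightarrow> ('a \<Rightarrow> int) \<Rightarrow> 'a set \<Rightarrow> int \<Rightarrow> ('a \<Rightarrow> 'a) set"
  where "lower_group K v N m =
    {\<sigma> \<in> carrier (Gal K N). \<forall>x\<in>valuation_ring N (val_ext K v N).
        val_ge (val_ext K v N) (\<sigma> x - x) (m + 1)}"

definition lower_group_real :: "'a::field set \<Rightarrow> ('a \<Rightarrow> int) \<Rightarrow> 'a set \<Rightarrow> real \<Rightarrow> ('a \<Rightarrow> 'a) set"
  where "lower_group_real K v N u = lower_group K v N \<lceil>u\<rceil>"

text \<open>
  The integrand is \<open>1 / [G\<^sub>0 : G\<^sub>u]\<close>.  For \<open>t < 0\<close> the integral is oriented, and then the value of
  the integrand at the single point \<open>-1\<close>, where \<open>G\<^sub>u\<close> need not lie in \<open>G\<^sub>0\<close>, is immaterial.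
\<close>

definition herbrand_phi :: "'a::field set \<Rightarrow> ('a \<Rightarrow> int) \<Rightarrow> 'a set \<Rightarrow> real \<Rightarrow> real"
  where "herbrand_phi K v N t =
    (LBINT u=0..ereal t. card (lower_group_real K v N u) / card (lower_group K v N 0))"

definition herbrand_psi :: "'a::field set \<Rightarrow> ('a \<Rightarrow> int) \<Rightarrow> 'a set \<Rightarrow> real \<Rightarrow> real"
  where "herbrand_psi K v N = the_inv_into {-1..} (herbrand_phi K v N)"

definition upper_group :: "'a::field set \<Rightarrow> ('a \<Rightarrow> int) \<Rightarrow> 'a set \<Rightarrow> real \<Rightarrow> ('a \<Rightarrow> 'a) set"
  where "upper_group K v N u = lower_group_real K v N (herbrand_psi K v N u)"

definition upper_jumps :: "'a::field set \<Rightarrow> ('a \<Rightarrow> int) \<Rightarrow> 'a set \<Rightarrow> real set"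
  where "upper_jumps K v N =
    {u. 0 \<le> u \<and> upper_group K v N u \<noteq> (\<Union>\<epsilon>\<in>{0<..}. upper_group K v N (u + \<epsilon>))}"

text \<open>Only used for extensions with exactly one upper jump.\<close>

definition upper_jump :: "'a::field set \<Rightarrow> ('a \<Rightarrow> int) \<Rightarrow> 'a set \<Rightarrow> real"
  where "upper_jump K v N = the_elem (upper_jumps K v N)"

end

theory Submission
  imports Defs "HOL-Number_Theory.Cong"
begin

text \<open>
  Write \<open>\<wp>(x) = x\<^sup>p - x\<close>, an additive map whose kernel is the prime field \<open>\<F>\<^sub>p\<close>.  Roots \<open>\<alpha>\<close> and
  \<open>\<gamma>\<close> of \<open>\<wp>(\<alpha>) = f\<close> and \<open>\<wp>(\<gamma>) = g\<close> generate \<open>N = LM\<close>, and an automorphism of \<open>N/K\<close> is determined by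
  \<open>\<alpha> \<mapsto> \<alpha> + s\<close>, \<open>\<gamma> \<mapsto> \<gamma> + t\<close> with \<open>s, t \<in> \<F>\<^sub>p\<close>.  Replacing \<open>\<alpha>\<close> by \<open>\<alpha> + a\<gamma> + x\<close> with \<open>a \<in> \<F>\<^sub>p\<close> and \<open>x \<in> K\<close>
  does not change \<open>N\<close> but replaces \<open>f\<close> by \<open>h = f + ag + \<wp>(x)\<close>.  This is why these elements
  control the ramification of \<open>N/K\<close>.

  Let \<open>\<wp>(\<theta>) \<in> K\<close> have value \<open>-n < 0\<close> with \<open>n\<close> prime to \<open>p\<close>.  Then \<open>\<theta>\<close> has value \<open>-n\<close> with
  respect to a valuation that takes values in \<open>p\<int>\<close> on \<open>K\<close>, so that the terms of
  \<open>c\<^sub>0 + c\<^sub>1\<theta> + \<dots>\<close>, up to exponent \<open>p - 1\<close>, have distinct values and an element is integral if and only if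
  all its terms are.  Since \<open>\<theta> + b = \<theta>(1 + b/\<theta>)\<close>, an automorphism \<open>\<theta> \<mapsto> \<theta> + b\<close> moves integral
  elements by at least \<open>n + 1\<close> in value (\<open>val_hom_diff\<close>), and a suitable uniformizer by exactly \<open>n + 1\<close>
  (\<open>uniformizer_hom_diff\<close>).  So the jump is \<open>n\<close>.

  Modulo \<open>\<wp>\<close>, every element of a complete field is equivalent to an element of the
  coefficient field, to a reduced element of negative value, or to an element whose leading
  coefficient has no \<open>p\<close>-th root in the residue field (\<open>artin_schrier_reduction\<close>).  The last
  case produces an inseparable residue field extension and is excluded by separability
  (\<open>not_fierce\<close>).  The field \<open>K(\<theta>\<^sub>1)\<close> is again complete with coefficient field \<open>k\<close>; applied to
  the second class over this field, the trichotomy says that either \<open>N\<close> is totally ramified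
  over it, or the class becomes residual, and descent of Artin--Schrier classes then gives some
  \<open>h \<in> k\<close> (\<open>ramified_or_residual\<close>).  Conversely, if \<open>h \<in> k\<close>, then a root of \<open>\<wp>(\<theta>) = h\<close> generates a
  subextension without ramification, the automorphisms fixing it form the inertia group, and the
  jump is that of the ramified step from there to \<open>N\<close> (\<open>residual_filtration\<close>).

  Now let \<open>N/K\<close> be totally ramified, generated by \<open>\<theta>\<^sub>1, \<theta>\<^sub>2\<close> such that \<open>\<wp>(\<theta>\<^sub>1)\<close> has value \<open>-l\<close>
  and \<open>\<wp>(\<theta>\<^sub>2 + a\<theta>\<^sub>1)\<close> has value \<open>-i\<close> for all \<open>a \<in> \<F>\<^sub>p\<close>, where \<open>l \<le> i\<close> are prime to \<open>p\<close>.  For a uniformizer \<open>x\<close> of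
  \<open>N\<close> the lower ramification groups are given by the function \<open>D(\<sigma>) = w(\<sigma>x - x)\<close>.  If \<open>K(\<theta>)\<close> is one
  of the \<open>p + 1\<close> subextensions of degree \<open>p\<close>, with jump \<open>n\<close>, then \<open>D\<close> sums to \<open>p(n + 1)\<close> over each
  set of automorphisms with a common nontrivial effect on \<open>\<theta>\<close> (\<open>coset_sum\<close>).  These linear equations
  give \<open>D = l + p(i - l) + 1\<close> on the nontrivial automorphisms fixing \<open>\<theta>\<^sub>1\<close> (\<open>D_fixing_theta1\<close>), and
  \<open>D = l + 1\<close> on those moving \<open>\<theta>\<^sub>1\<close> (\<open>D_moving_theta1\<close>).  The lower breaks are
  therefore \<open>l\<close> and \<open>l + p(i - l)\<close>; between them the Herbrand function has slope \<open>1/p\<close>, so that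
  the upper jumps are \<open>l\<close> and \<open>i\<close> (\<open>two_jumps\<close>, \<open>one_jump\<close>).  The cases of the theorem arise for
  \<open>(\<theta>\<^sub>1, \<theta>\<^sub>2)\<close> equal to \<open>(\<alpha>, \<gamma>)\<close>, to \<open>(\<alpha> + a\<gamma> + x, \<gamma>)\<close> and to \<open>(\<gamma>, \<alpha>)\<close>.
\<close>

section \<open>Subfields of the ambient field\<close>

lemma ambient_simps [simp]:
  "carrier (\<Omega> :: 'a::field ring) = UNIV"
  "(x :: 'a) \<otimes>\<^bsub>\<Omega>\<^esub> y = x * y" "x \<oplus>\<^bsub>\<Omega>\<^esub> y = x + y" "\<one>\<^bsub>\<Omega>\<^esub> = (1 :: 'a)" "\<zero>\<^bsub>\<Omega>\<^esub> = (0 :: 'a)"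
  by (simp_all add: ring_of_type_algebra_def)

interpretation amb: Ring.ring "\<Omega> :: 'a::field ring"
  by (rule ring_from_type_algebra)

lemma ambient_uminus [simp]: "\<ominus>\<^bsub>\<Omega>\<^esub> (x :: 'a::field) = - x"
  by (rule amb.minus_equality) auto

lemma ambient_inverse [simp]: "x \<noteq> 0 \<Longrightarrow> inv\<^bsub>\<Omega>\<^esub> (x :: 'a::field) = inverse x"
  by (metis ambient_simps(1,2,4) UNIV_I amb.inv_unique' right_inverse left_inverse)

lemma subfield_ambientI:
  fixes F :: "'a::field set"
  assumes "1 \<in> F" "\<And>x y. x \<in> F \<Longrightarrow> y \<in> F \<Longrightarrow> x + y \<in> F" "\<And>x. x \<in> F \<Longrightarrow> - x \<in> F"
    "\<And>x y. x \<in> F \<Longrightarrow> y \<in> F \<Longrightarrow> x * y \<in> F" "\<And>x. x \<in> F \<Longrightarrow> x \<noteq> 0 \<Longrightarrow> inverse x \<in> F"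
  shows "subfield F \<Omega>"
proof (rule field.subfieldI'[OF field_from_type_algebra])
  show "subring F \<Omega>" by (rule amb.subringI) (use assms in auto)
qed (use assms in auto)

context
  fixes F :: "'a::field set"
  assumes F: "subfield F \<Omega>"
begin

lemma subfield_zero [simp]: "0 \<in> F"
  using subringE(2)[OF subfieldE(1)[OF F]] by simp
lemma subfield_one [simp]: "1 \<in> F"
  using subringE(3)[OF subfieldE(1)[OF F]] by simp
lemma subfield_add [simp]: "x \<in> F \<Longrightarrow> y \<in> F \<Longrightarrow> x + y \<in> F"
  using subringE(7)[OF subfieldE(1)[OF F]] by simp
lemma subfield_mult [simp]: "x \<in> F \<Longrightarrow> y \<in> F \<Longrightarrow> x * y \<in> F"
  using subringE(6)[OF subfieldE(1)[OF F]] by simp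
lemma subfield_uminus: "x \<in> F \<Longrightarrow> - x \<in> F"
  using subringE(5)[OF subfieldE(1)[OF F], of x] by simp
lemma subfield_uminus_iff [simp]: "- x \<in> F \<longleftrightarrow> x \<in> F"
  using subfield_uminus[of x] subfield_uminus[of "- x"] by auto
lemma subfield_diff [simp]: "x \<in> F \<Longrightarrow> y \<in> F \<Longrightarrow> x - y \<in> F"
  using subfield_add[of x "- y"] by simp
lemma subfield_inverse [simp]: "x \<in> F \<Longrightarrow> inverse x \<in> F"
  using amb.subfield_m_inv(1)[OF F, of x] by (cases "x = 0") auto
lemma subfield_divide [simp]: "x \<in> F \<Longrightarrow> y \<in> F \<Longrightarrow> x / y \<in> F"
  by (simp add: field_class.field_divide_inverse)
lemma subfield_power [simp]: "x \<in> F \<Longrightarrow> x ^ n \<in> F"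
  by (induction n) auto
lemma subfield_sum [simp]: "(\<And>i. i \<in> A \<Longrightarrow> c i \<in> F) \<Longrightarrow> sum c A \<in> F"
  by (induction A rule: infinite_finite_induct) auto
lemma subfield_of_nat [simp]: "of_nat n \<in> F"
  by (induction n) auto
lemma subfield_of_int [simp]: "of_int n \<in> F"
  by (cases n) auto
lemma subfield_power_int [simp]: "x \<in> F \<Longrightarrow> x powi n \<in> F"
  by (simp add: power_int_def)

lemma subfield_mult_cancel: "x * y \<in> F \<Longrightarrow> x \<in> F \<Longrightarrow> x \<noteq> 0 \<Longrightarrow> y \<in> F"
  using subfield_divide[of "x * y" x] by simp

end

lemma generate_field_ambient:
  fixes H :: "'a::field set"
  shows "subfield (generate_field \<Omega> H) \<Omega>" "H \<subseteq> generate_field \<Omega> H"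
    "subfield E \<Omega> \<Longrightarrow> H \<subseteq> E \<Longrightarrow> generate_field \<Omega> H \<subseteq> E"
  using field.generate_field_is_subfield[OF field_from_type_algebra, of H]
      field.generate_field_min_subfield1[OF field_from_type_algebra, of H E]
  by (auto intro: generate_field.incl)

section \<open>Linear algebra over a subfield\<close>

lemma combine_ambient:
  "amb.combine Ks Us =
    (\<Sum>m<length Us. (if m < length Ks then Ks ! m else 0) * (Us ! m :: 'a::field))"
proof (induction Ks Us rule: amb.combine.induct)
  case (1 k Ks u Us)
  then show ?case by (auto simp: sum.lessThan_Suc_shift simp del: sum.lessThan_Suc intro!: sum.cong)
qed auto

lemma combine_ambient_map:
  "amb.combine Ks (map x [0..<n]) =
    (\<Sum>m<n. (if m < length Ks then Ks ! m else 0) * (x m :: 'a::field))"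
  by (auto simp: combine_ambient intro!: sum.cong)

text \<open>
  Families indexed by \<open>{..<n}\<close> turn linear combinations into ordinary sums; \<open>independent_ambient\<close> and
  \<open>dimension_ambientI\<close> translate to and from families given as lists.
\<close>

definition lin_indep :: "'a::field set \<Rightarrow> nat \<Rightarrow> (nat \<Rightarrow> 'a) \<Rightarrow> bool"
  where "lin_indep F n x \<longleftrightarrow>
    (\<forall>c. (\<forall>m<n. c m \<in> F) \<longrightarrow> (\<Sum>m<n. c m * x m) = 0 \<longrightarrow> (\<forall>m<n. c m = 0))"

definition lin_span :: "'a::field set \<Rightarrow> nat \<Rightarrow> (nat \<Rightarrow> 'a) \<Rightarrow> 'a set"
  where "lin_span F n x = {\<Sum>m<n. c m * x m | c. \<forall>m<n. c m \<in> F}"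

lemma lin_indepD: "lin_indep F n x \<Longrightarrow> (\<And>m. m < n \<Longrightarrow> c m \<in> F) \<Longrightarrow> (\<Sum>m<n. c m * x m) = 0
    \<Longrightarrow> m < n \<Longrightarrow> c m = 0"
  by (auto simp: lin_indep_def)

lemma independent_ambient:
  fixes F :: "'a::field set"
  assumes F: "subfield F \<Omega>"
  shows "amb.independent F (map x [0..<n]) \<longleftrightarrow> lin_indep F n x"
proof
  assume ind: "amb.independent F (map x [0..<n])"
  show "lin_indep F n x" unfolding lin_indep_def
  proof (intro allI impI)
    fix c m assume c: "\<forall>m<n. c m \<in> F" and z: "(\<Sum>m<n. c m * x m) = 0" and m: "m < n"
    have "amb.combine (map c [0..<n]) (map x [0..<n]) = 0"
      using z by (simp add: combine_ambient_map)
    hence "set (take (length (map x [0..<n])) (map c [0..<n])) \<subseteq> {0}"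
      using amb.independent_imp_trivial_combine[OF F ind, of "map c [0..<n]"] c
      by (auto simp: image_subset_iff)
    thus "c m = 0" using m by (auto simp: image_subset_iff)
  qed
next
  assume ind: "lin_indep F n x"
  show "amb.independent F (map x [0..<n])"
  proof (rule amb.trivial_combine_imp_independent[OF F])
    fix Ks assume Ks: "set Ks \<subseteq> F" and z: "amb.combine Ks (map x [0..<n]) = \<zero>\<^bsub>\<Omega>\<^esub>"
    define c where "c m = (if m < length Ks then Ks ! m else 0)" for m
    have cF: "\<forall>m<n. c m \<in> F" using Ks F by (auto simp: c_def dest: nth_mem)
    have "(\<Sum>m<n. c m * x m) = 0"
      using z by (simp add: combine_ambient_map c_def)
    hence "\<forall>m<n. c m = 0" using ind cF by (auto simp: lin_indep_def)
    thus "set (take (length (map x [0..<n])) Ks) \<subseteq> {\<zero>\<^bsub>\<Omega>\<^esub>}"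
      by (auto simp: in_set_conv_nth c_def) (metis)
  qed auto
qed

lemma dimension_ambientI:
  fixes F :: "'a::field set"
  assumes F: "subfield F \<Omega>" and ind: "lin_indep F n x"
  shows "amb.dimension n F (lin_span F n x)"
proof -
  have "amb.dimension (length (map x [0..<n])) F (amb.Span F (map x [0..<n]))"
    by (rule amb.dimension_independent) (simp add: independent_ambient F ind)
  moreover have "amb.Span F (map x [0..<n]) = lin_span F n x"
  proof -
    have "amb.Span F (map x [0..<n]) = {amb.combine Ks (map x [0..<n]) | Ks. length Ks = length (map x [0..<n]) \<and> set Ks \<subseteq> F}"
      by (rule amb.Span_eq_combine_set_length_version[OF F]) auto
    also have "\<dots> = lin_span F n x"
    proof (intro equalityI subsetI)
      fix z assume "z \<in> {amb.combine Ks (map x [0..<n]) | Ks. length Ks = length (map x [0..<n]) \<and> set Ks \<subseteq> F}"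
      then obtain Ks where Ks: "length Ks = n" "set Ks \<subseteq> F" "z = amb.combine Ks (map x [0..<n])" by auto
      have "z = (\<Sum>m<n. Ks ! m * x m)" using Ks by (simp add: combine_ambient_map)
      moreover have "\<forall>m<n. Ks ! m \<in> F" using Ks by (auto dest: nth_mem)
      ultimately show "z \<in> lin_span F n x" by (auto simp: lin_span_def)
    next
      fix z assume "z \<in> lin_span F n x"
      then obtain c where c: "\<forall>m<n. c m \<in> F" "z = (\<Sum>m<n. c m * x m)" by (auto simp: lin_span_def)
      have "z = amb.combine (map c [0..<n]) (map x [0..<n])"
        using c by (simp add: combine_ambient_map)
      thus "z \<in> {amb.combine Ks (map x [0..<n]) | Ks. length Ks = length (map x [0..<n]) \<and> set Ks \<subseteq> F}"
        using c(1) by (intro CollectI exI[of _ "map c [0..<n]"]) auto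
    qed
    finally show ?thesis .
  qed
  ultimately show ?thesis by simp
qed

lemma lin_dependent:
  fixes F :: "'a::field set"
  assumes F: "subfield F \<Omega>" and dim: "amb.dimension n F E" and x: "\<And>m. m \<le> n \<Longrightarrow> x m \<in> E"
  shows "\<exists>c m. (\<forall>m\<le>n. c m \<in> F) \<and> (\<Sum>m\<le>n. c m * x m) = 0 \<and> m \<le> n \<and> c m \<noteq> 0"
proof -
  have "\<not> lin_indep F (Suc n) x"
  proof
    assume "lin_indep F (Suc n) x"
    hence "amb.independent F (map x [0..<Suc n])" by (simp only: independent_ambient[OF F])
    from amb.independent_length_le_dimension[OF F dim this] x show False by (auto simp: image_subset_iff less_Suc_eq_le simp del: upt_Suc)
  qed
  thus ?thesis unfolding lin_indep_def by (auto simp: lessThan_Suc_atMost less_Suc_eq_le)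
qed

lemma lin_indep_spans:
  fixes F :: "'a::field set"
  assumes F: "subfield F \<Omega>" and dim: "amb.dimension n F E" and x: "\<And>m. m < n \<Longrightarrow> x m \<in> E"
    and ind: "lin_indep F n x" and z: "z \<in> E"
  obtains c where "\<And>m. m < n \<Longrightarrow> c m \<in> F" "z = (\<Sum>m<n. c m * x m)"
proof -
  obtain c m where c: "\<And>m. m \<le> n \<Longrightarrow> c m \<in> F"
     "(\<Sum>m\<le>n. c m * (if m < n then x m else z)) = 0" "m \<le> n" "c m \<noteq> 0"
  proof -
    have "(if m < n then x m else z) \<in> E" if "m \<le> n" for m using x z by simp
    hence "\<exists>c m. (\<forall>m\<le>n. c m \<in> F) \<and> (\<Sum>m\<le>n. c m * (if m < n then x m else z)) = 0 \<and> m \<le> n \<and> c m \<noteq> 0"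
      by (rule lin_dependent[OF F dim])
    thus thesis using that by blast
  qed
  have eq: "(\<Sum>m<n. c m * x m) + c n * z = 0"
    using c(2) by (simp add: lessThan_Suc_atMost[symmetric])
  have cn: "c n \<noteq> 0"
  proof
    assume 0: "c n = 0"
    hence "c m = 0 \<and> m < n" if "m < n" for m
      using lin_indepD[OF ind, of c m] c eq that by auto
    thus False using c(3,4) 0 by (metis le_neq_implies_less)
  qed
  have "c n * z = - (\<Sum>m<n. c m * x m)" using eq by (simp add: eq_neg_iff_add_eq_0 add.commute)
  hence "z = (\<Sum>m<n. (- c m / c n) * x m)"
    using cn by (simp add: sum_negf sum_divide_distrib[symmetric] field_simps)
  thus thesis using c(1) F by (intro that[of "\<lambda>m. - c m / c n"]) auto
qed

section \<open>Polynomials over a subfield\<close>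

definition poly_over :: "'a::field set \<Rightarrow> 'a poly \<Rightarrow> bool"
  where "poly_over F q \<longleftrightarrow> (\<forall>i. Polynomial.coeff q i \<in> F)"

context
  fixes F :: "'a::field set"
  assumes F: "subfield F \<Omega>"
begin

lemma poly_over_pCons [simp]: "poly_over F (pCons a q) \<longleftrightarrow> a \<in> F \<and> poly_over F q"
  by (auto simp: poly_over_def coeff_pCons split: nat.splits)
lemma poly_over_0 [simp]: "poly_over F 0"
  using F by (auto simp: poly_over_def)
lemma poly_over_1 [simp]: "poly_over F 1"
  using F by (auto simp: poly_over_def Polynomial.coeff_1)
lemma poly_over_add [simp]: "poly_over F P \<Longrightarrow> poly_over F q \<Longrightarrow> poly_over F (P + q)"
  using F by (auto simp: poly_over_def)
lemma poly_over_diff [simp]: "poly_over F P \<Longrightarrow> poly_over F q \<Longrightarrow> poly_over F (P - q)"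
  using F by (auto simp: poly_over_def)
lemma poly_over_uminus [simp]: "poly_over F P \<Longrightarrow> poly_over F (- P)"
  using F by (auto simp: poly_over_def)
lemma poly_over_mult [simp]: "poly_over F P \<Longrightarrow> poly_over F q \<Longrightarrow> poly_over F (P * q)"
  using F by (auto simp: poly_over_def Polynomial.coeff_mult)
lemma poly_over_monom [simp]: "a \<in> F \<Longrightarrow> poly_over F (Polynomial.monom a n)"
  using F by (auto simp: poly_over_def)
lemma poly_over_smult [simp]: "a \<in> F \<Longrightarrow> poly_over F q \<Longrightarrow> poly_over F (Polynomial.smult a q)"
  using F by (auto simp: poly_over_def)
lemma poly_over_sum [simp]: "(\<And>i. i \<in> A \<Longrightarrow> poly_over F (c i)) \<Longrightarrow> poly_over F (sum c A)"
  by (induction A rule: infinite_finite_induct) auto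
lemma poly_over_in [simp]: "poly_over F q \<Longrightarrow> z \<in> F \<Longrightarrow> poly q z \<in> F"
  by (induction q) (use F in auto)
lemma poly_over_pcompose [simp]: "poly_over F P \<Longrightarrow> poly_over F q \<Longrightarrow> poly_over F (pcompose P q)"
  by (induction P) (auto simp: pcompose_pCons)
lemma poly_over_coeff: "poly_over F q \<Longrightarrow> Polynomial.coeff q i \<in> F"
  by (simp add: poly_over_def)

text \<open>
  The division algorithm keeps the coefficients in \<open>F\<close>, because it divides only by the leading
  coefficient of \<open>q\<close>.
\<close>

lemma poly_over_division:
  assumes q: "poly_over F q" "q \<noteq> 0" and P: "poly_over F P"
  obtains S R where "poly_over F S" "poly_over F R" "P = S * q + R"
    "R = 0 \<or> Polynomial.degree R < Polynomial.degree q"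
  using P
proof (induction "Polynomial.degree P" arbitrary: P thesis rule: less_induct)
  case less
  let ?d = "Polynomial.degree P" and ?e = "Polynomial.degree q"
  show ?case
  proof (cases "P = 0 \<or> ?d < ?e")
    case True thus ?thesis using less.prems by (intro less.prems(1)[of 0 P]) auto
  next
    case False
    define a where "a = Polynomial.lead_coeff P / Polynomial.lead_coeff q"
    define T where "T = Polynomial.monom a (?d - ?e)"
    define P' where "P' = P - T * q"
    have a: "a \<in> F" "a \<noteq> 0" using less.prems(2) q F False
      by (auto simp: a_def intro!: subfield_divide poly_over_coeff)
    have T: "poly_over F T" using a by (simp add: T_def)
    have deg: "Polynomial.degree (T * q) = ?d"
      using a q False by (simp add: T_def degree_mult_eq degree_monom_eq monom_eq_0_iff)
    have lc: "Polynomial.coeff (T * q) ?d = Polynomial.lead_coeff P"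
    proof -
      have "Polynomial.lead_coeff (T * q) = Polynomial.lead_coeff P"
        using q a by (simp add: T_def Polynomial.lead_coeff_mult degree_monom_eq) (simp add: a_def)
      thus ?thesis using deg by simp
    qed
    have P'F: "poly_over F P'" using less.prems T q by (simp add: P'_def)
    show ?thesis
    proof (cases "?d = 0")
      case True
      have "Polynomial.degree P' = 0" using deg True unfolding P'_def
        by (metis degree_diff_le le_zero_eq max.idem)
      moreover have "Polynomial.coeff P' 0 = 0" using lc True by (simp add: P'_def)
      ultimately have "P' = 0" by (metis leading_coeff_0_iff)
      thus ?thesis using T by (intro less.prems(1)[of T 0]) (auto simp: P'_def)
    next
      case False
      have "Polynomial.degree P' < ?d"
      proof -
        have "Polynomial.degree P' \<le> ?d" unfolding P'_def using deg
          by (metis degree_diff_le order_refl)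
        moreover have "Polynomial.coeff P' ?d = 0" using lc by (simp add: P'_def)
        ultimately show ?thesis using False
          by (metis le_neq_implies_less leading_coeff_0_iff Polynomial.degree_0)
      qed
      then obtain S R where "poly_over F S" "poly_over F R" "P' = S * q + R"
        "R = 0 \<or> Polynomial.degree R < Polynomial.degree q"
        using less.hyps[OF _ _ P'F] by blast
      thus ?thesis using T by (intro less.prems(1)[of "S + T" R]) (auto simp: P'_def algebra_simps)
    qed
  qed
qed

end

text \<open>
  Up to sign, the second highest coefficient of a monic polynomial is the sum of its roots.  Here the
  roots are \<open>m + 1\<close> of the elements \<open>\<theta> + s\<^sub>i\<close>.
\<close>

lemma monic_divisor_of_shifted_linear_factors:
  fixes F :: "'a::field set" and n m :: nat
  assumes F: "subfield F \<Omega>" and s: "\<And>i. i < n \<Longrightarrow> s i \<in> F"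
    and q: "q dvd (\<Prod>i<n. [:- (\<theta> + s i), 1:])" "Polynomial.lead_coeff q = 1"
    and "Polynomial.degree q = Suc m"
  shows "Polynomial.coeff q m + of_nat (Suc m) * \<theta> \<in> F"
  using assms(2-)
proof (induction n arbitrary: q m)
  case 0
  hence "q \<noteq> 0" "is_unit q" by auto
  thus ?case using 0 by (simp add: is_unit_iff_degree)
next
  case (Suc n)
  let ?l = "[:- (\<theta> + s n), 1:]"
  show ?case
  proof (cases "?l dvd q")
    case False
    obtain T where T: "(\<Prod>i<n. [:- (\<theta> + s i), 1:]) * ?l = q * T" using Suc.prems(2) by (auto simp: dvd_def)
    have "poly (q * T) (\<theta> + s n) = 0" unfolding T[symmetric] by (simp add: algebra_simps)
    moreover have "poly q (\<theta> + s n) \<noteq> 0" using False by (simp add: poly_eq_0_iff_dvd)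
    ultimately have "?l dvd T" by (simp add: poly_eq_0_iff_dvd)
    then obtain T' where "T = ?l * T'" by (auto simp: dvd_def)
    hence "?l * (\<Prod>i<n. [:- (\<theta> + s i), 1:]) = ?l * (q * T')" using T by (simp only: ac_simps)
    hence "q dvd (\<Prod>i<n. [:- (\<theta> + s i), 1:])" by (subst (asm) mult_cancel_left) auto
    thus ?thesis using Suc by simp
  next
    case True
    then obtain q' where q': "q = ?l * q'" by (auto simp: dvd_def)
    have q0: "q' \<noteq> 0" using Suc.prems(4) q' by auto
    have lc: "Polynomial.lead_coeff q' = 1" using Suc.prems(3) unfolding q' Polynomial.lead_coeff_mult by simp
    have deg: "Polynomial.degree q' = m"
      using Suc.prems(4) q0 unfolding q' by (subst (asm) degree_mult_eq) auto
    have dvd: "q' dvd (\<Prod>i<n. [:- (\<theta> + s i), 1:])"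
      using Suc.prems(2) unfolding q' prod.lessThan_Suc mult.commute[of _ ?l] by (subst (asm) dvd_mult_cancel_left) auto
    have c: "Polynomial.coeff q m = (case m of 0 \<Rightarrow> 0 | Suc j \<Rightarrow> Polynomial.coeff q' j) - (\<theta> + s n)"
      using lc deg by (simp add: q' coeff_pCons split: nat.splits)
    show ?thesis
    proof (cases m)
      case 0
      thus ?thesis using c Suc.prems(1)[of n] F by simp
    next
      case (Suc j)
      have "Polynomial.coeff q' j + of_nat (Suc j) * \<theta> \<in> F"
        by (rule Suc.IH) (use Suc.prems deg dvd lc Suc in auto)
      moreover have "Polynomial.coeff q m + of_nat (Suc m) * \<theta> = (Polynomial.coeff q' j + of_nat (Suc j) * \<theta>) - s n"
        using c Suc by (simp add: algebra_simps)
      ultimately show ?thesis using Suc.prems(1)[of n] F by simp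
    qed
  qed
qed

lemma of_nat_neq_0_less_CHAR:
  assumes "CHAR('a) = p" "0 < m" "m < p" shows "of_nat m \<noteq> (0::'a::field)"
  using assms by (auto simp: of_nat_eq_0_iff_char_dvd dest: dvd_imp_le)

text \<open>
  A nonzero annihilator of least degree \<open>n < p\<close> divides the product of the linear factors.  The preceding
  lemma then gives \<open>n \<theta> \<in> F\<close>, hence \<open>\<theta> \<in> F\<close>.  With \<open>s\<^sub>i = i\<close> the product is an Artin--Schrier
  polynomial; with \<open>s\<^sub>i = 0\<close> it is the purely inseparable polynomial \<open>X\<^sup>p - \<theta>\<^sup>p\<close>.
\<close>

lemma no_small_annihilator:
  fixes F :: "'a::field set" and p :: nat and s :: "nat \<Rightarrow> 'a"
  assumes F: "subfield F \<Omega>" and ch: "CHAR('a) = p" and s: "\<And>i. i < p \<Longrightarrow> s i \<in> F"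
    and P: "poly_over F (\<Prod>i<p. [:- (\<theta> + s i), 1:])" and r: "j < p" "s j = 0" and th: "\<theta> \<notin> F"
    and q: "poly_over F q" "poly q \<theta> = 0" "Polynomial.degree q < p"
  shows "q = 0"
proof (rule ccontr)
  let ?P = "(\<Prod>i<p. [:- (\<theta> + s i), 1:])"
  assume "q \<noteq> 0"
  define B where "B n \<longleftrightarrow> (\<exists>q. poly_over F q \<and> q \<noteq> 0 \<and> poly q \<theta> = 0 \<and> Polynomial.degree q = n)" for n
  have B: "B (Polynomial.degree q)" using q \<open>q \<noteq> 0\<close> by (auto simp: B_def)
  define n where "n = (LEAST n. B n)"
  have Bn: "B n" unfolding n_def by (rule LeastI[of B, OF B])
  have np: "n < p" using Least_le[of B, OF B] q(3) by (simp add: n_def)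
  have nmin: "\<not> B m" if "m < n" for m using that not_less_Least unfolding n_def by blast
  obtain q1 where q1: "poly_over F q1" "q1 \<noteq> 0" "poly q1 \<theta> = 0" "Polynomial.degree q1 = n"
    using Bn by (auto simp: B_def)
  define q2 where "q2 = Polynomial.smult (inverse (Polynomial.lead_coeff q1)) q1"
  have q2: "poly_over F q2" "poly q2 \<theta> = 0" "Polynomial.degree q2 = n" "Polynomial.lead_coeff q2 = 1"
    using q1 F poly_over_smult[OF F subfield_inverse[OF F poly_over_coeff[OF F q1(1)]] q1(1)]
    by (auto simp: q2_def)
  obtain S R where SR: "poly_over F S" "poly_over F R" "?P = S * q2 + R" "R = 0 \<or> Polynomial.degree R < Polynomial.degree q2"
    by (rule poly_over_division[OF F q2(1) _ P]) (use q2 in auto)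
  have "poly ?P \<theta> = 0" using r by (auto simp: poly_prod)
  hence "poly R \<theta> = 0" using SR(3) q2 by simp
  hence "R = 0" using SR(2,4) q2(3) nmin by (auto simp: B_def)
  hence dvd: "q2 dvd ?P" using SR(3) by simp
  have "n \<noteq> 0"
  proof
    assume "n = 0"
    then obtain a where "q2 = [:a:]" using q2(3) degree_eq_zeroE by metis
    thus False using q2 by auto
  qed
  then obtain m where m: "n = Suc m" by (cases n) auto
  have "Polynomial.coeff q2 m + of_nat (Suc m) * \<theta> \<in> F"
    by (rule monic_divisor_of_shifted_linear_factors[OF F s dvd q2(4)]) (use q2 m in auto)
  moreover have "Polynomial.coeff q2 m \<in> F" using q2(1) F by (simp add: poly_over_def)
  ultimately have "of_nat (Suc m) * \<theta> \<in> F"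
    using subfield_diff[OF F, of "Polynomial.coeff q2 m + of_nat (Suc m) * \<theta>" "Polynomial.coeff q2 m"] by simp
  moreover have "of_nat (Suc m) \<noteq> (0::'a)"
    using m np by (intro of_nat_neq_0_less_CHAR[OF ch]) auto
  ultimately have "\<theta> \<in> F" by (metis subfield_mult_cancel[OF F] subfield_of_nat[OF F])
  with th show False by simp
qed

section \<open>Artin--Schrier extensions\<close>

lemma prime_field_eq_of_nat:
  assumes "CHAR('a::field) = p" "Factorial_Ring.prime p"
  shows "(prime_field :: 'a set) = of_nat ` {..<p}" "inj_on (of_nat :: nat \<Rightarrow> 'a) {..<p}"
    "finite (prime_field :: 'a set)" "card (prime_field :: 'a set) = p"
proof -
  show inj: "inj_on (of_nat :: nat \<Rightarrow> 'a) {..<p}"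
    using assms by (auto simp: inj_on_def of_nat_eq_iff_cong_CHAR cong_less_modulus_unique_nat)
  show eq: "(prime_field :: 'a set) = of_nat ` {..<p}"
  proof (intro equalityI subsetI)
    fix x :: 'a assume "x \<in> prime_field"
    then obtain z where z: "x = of_int z" by auto
    have "x = of_int (z mod int p)"
      using assms by (simp add: z of_int_eq_iff_cong_CHAR)
    also have "\<dots> = of_nat (nat (z mod int p))"
      using prime_gt_0_nat[OF assms(2)] by (simp add: nat_of_bool)
    finally show "x \<in> of_nat ` {..<p}"
      by (rule image_eqI) (use prime_gt_0_nat[OF assms(2)] in \<open>auto simp: nat_less_iff\<close>)
  qed (auto intro: range_eqI[of _ _ "int _"])
  show "finite (prime_field :: 'a set)" "card (prime_field :: 'a set) = p"
    unfolding eq using inj by (auto simp: card_image)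
qed

text \<open>
  The \<open>p\<close> elements of the prime field exhaust the roots of \<open>X\<^sup>p - X\<close>.
\<close>

lemma prime_field_iff:
  fixes b :: "'a::field"
  assumes "CHAR('a) = p" "Factorial_Ring.prime p"
  shows "b \<in> prime_field \<longleftrightarrow> b ^ p = b"
proof -
  have p2: "p \<ge> 2" using assms(2) by (rule prime_ge_2_nat)
  have nat_pow: "(of_nat n :: 'a) ^ p = of_nat n" for n
    by (induction n) (use assms p2 in \<open>auto simp: freshmans_dream\<close>)
  have neg: "(- x :: 'a) ^ p = - (x ^ p)" for x
    using minus_power_prime_CHAR[of p x] assms by simp
  have sub: "prime_field \<subseteq> {x::'a. x ^ p = x}"
  proof
    fix x :: 'a assume "x \<in> prime_field"
    then obtain z where z: "x = of_int z" by auto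
    show "x \<in> {x. x ^ p = x}" using nat_pow neg by (cases z) (auto simp: z simp del: of_nat_Suc)
  qed
  let ?P = "Polynomial.monom 1 p - [:0, 1::'a:]"
  have cP: "Polynomial.coeff ?P p = 1" using p2 by (auto simp: coeff_pCons split: nat.splits)
  hence P0: "?P \<noteq> 0" by (metis Polynomial.coeff_0 zero_neq_one)
  have deg: "Polynomial.degree ?P \<le> p"
    by (rule degree_diff_le) (use p2 in \<open>auto simp: degree_monom_eq\<close>)
  have roots: "{x::'a. x ^ p = x} = {x. poly ?P x = 0}" by (auto simp: poly_monom)
  have fin: "finite {x::'a. x ^ p = x}" unfolding roots by (rule poly_roots_finite[OF P0])
  have "card {x::'a. x ^ p = x} \<le> p"
    unfolding roots using card_poly_roots_bound[OF P0] deg by linarith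
  hence "prime_field = {x::'a. x ^ p = x}"
    using prime_field_eq_of_nat(4)[OF assms] by (intro card_seteq[OF fin sub]) simp
  thus ?thesis by blast
qed

lemma subfield_prime_field:
  assumes "CHAR('a::field) = p" "Factorial_Ring.prime p"
  shows "subfield (prime_field :: 'a set) \<Omega>"
proof (rule subfield_ambientI)
  fix x y :: 'a assume "x \<in> prime_field" "y \<in> prime_field"
  then obtain m n where "x = of_int m" "y = of_int n" by auto
  thus "x + y \<in> prime_field" "x * y \<in> prime_field" "- x \<in> prime_field"
    by (metis of_int_add rangeI, metis of_int_mult rangeI, metis of_int_minus rangeI)
qed (auto simp: prime_field_iff[OF assms] power_inverse intro: range_eqI[of _ _ 1])

lemma prime_field_subset: "subfield F \<Omega> \<Longrightarrow> prime_field \<subseteq> F"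
  by auto

lemma artin_schrier_add:
  fixes x y :: "'a::field"
  assumes "CHAR('a) = p" "Factorial_Ring.prime p"
  shows "(x + y) ^ p - (x + y) = (x ^ p - x) + (y ^ p - y)"
  using assms by (simp add: freshmans_dream)

lemma artin_schrier_diff:
  fixes x y :: "'a::field"
  assumes "CHAR('a) = p" "Factorial_Ring.prime p"
  shows "(x - y) ^ p - (x - y) = (x ^ p - x) - (y ^ p - y)"
  using artin_schrier_add[OF assms, of "x - y" y] by simp

lemma artin_schrier_scale:
  fixes a x :: "'a::field"
  assumes "CHAR('a) = p" "Factorial_Ring.prime p" "a \<in> prime_field"
  shows "(a * x) ^ p - a * x = a * (x ^ p - x)"
  using assms prime_field_iff[OF assms(1,2), of a] by (simp add: power_mult_distrib algebra_simps)

locale artin_schrier =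
  fixes F :: "'a::field set" and \<theta> :: 'a and p :: nat
  assumes F: "subfield F \<Omega>" and CHAR: "CHAR('a) = p" and prime: "Factorial_Ring.prime p"
    and wp: "\<theta> ^ p - \<theta> \<in> F" and notin: "\<theta> \<notin> F"
begin

definition E :: "'a set" where "E = generate_field \<Omega> (insert \<theta> F)"

definition min_pol :: "'a poly" where "min_pol = (\<Prod>i<p. [:- (\<theta> + of_nat i), 1:])"

lemma p2: "p \<ge> 2" using prime by (rule prime_ge_2_nat)

lemma E_subfield: "subfield E \<Omega>" and F_subset: "F \<subseteq> E" and gen_in: "\<theta> \<in> E"
  using generate_field_ambient[of "insert \<theta> F"] by (auto simp: E_def)

lemma E_least: "subfield H \<Omega> \<Longrightarrow> F \<subseteq> H \<Longrightarrow> \<theta> \<in> H \<Longrightarrow> E \<subseteq> H"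
  unfolding E_def by (rule generate_field_ambient) auto

text \<open>
  Both sides are monic of degree \<open>p\<close> and vanish at the \<open>p\<close> elements \<open>\<theta> + i\<close>.
\<close>

lemma min_pol_eq: "min_pol = Polynomial.monom 1 p - [:\<theta> ^ p - \<theta>, 1:]" (is "_ = ?Q")
proof (rule poly_eqI_degree_lead_coeff[of min_pol p ?Q "(\<lambda>i. \<theta> + of_nat i) ` {..<p}"])
  have deg: "Polynomial.degree min_pol = p"
    unfolding min_pol_def by (subst degree_prod_eq_sum_degree) auto
  have lc: "Polynomial.lead_coeff min_pol = 1"
    unfolding min_pol_def by (simp add: Polynomial.lead_coeff_prod)
  have Qp: "Polynomial.coeff ?Q p = 1" using p2 by (auto simp: coeff_pCons split: nat.splits)
  show "Polynomial.coeff min_pol p = Polynomial.coeff ?Q p" using deg lc Qp by simp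
  show "Polynomial.degree min_pol \<le> p" using deg by simp
  show "Polynomial.degree ?Q \<le> p" by (rule degree_diff_le) (use p2 in \<open>auto simp: degree_monom_eq\<close>)
  have "inj_on (\<lambda>i. \<theta> + (of_nat i :: 'a)) {..<p}"
    using prime_field_eq_of_nat(2)[OF CHAR prime] by (auto simp: inj_on_def)
  thus "p \<le> card ((\<lambda>i. \<theta> + (of_nat i :: 'a)) ` {..<p})" by (simp add: card_image)
next
  fix z assume "z \<in> (\<lambda>i. \<theta> + of_nat i) ` {..<p}"
  then obtain i where i: "z = \<theta> + of_nat i" "i < p" by auto
  have "poly min_pol z = 0" unfolding min_pol_def using i by (auto simp: poly_prod)
  moreover have "(of_nat i :: 'a) ^ p = of_nat i"
    using prime_field_iff[OF CHAR prime, of "of_nat i"] by (auto intro: range_eqI[of _ _ "int i"])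
  hence "poly ?Q z = 0" using CHAR prime by (simp add: poly_monom i freshmans_dream)
  ultimately show "poly min_pol z = poly ?Q z" by simp
qed

lemma min_pol_over: "poly_over F min_pol" and poly_min_pol: "poly min_pol z = z ^ p - z - (\<theta> ^ p - \<theta>)"
  and degree_min_pol: "Polynomial.degree min_pol = p"
proof -
  show "poly_over F min_pol"
    unfolding min_pol_eq using F wp by (intro poly_over_diff poly_over_monom) (auto simp del: subfield_diff)
  show "poly min_pol z = z ^ p - z - (\<theta> ^ p - \<theta>)"
    unfolding min_pol_eq by (simp add: poly_monom)
  show "Polynomial.degree min_pol = p"
    unfolding min_pol_def by (subst degree_prod_eq_sum_degree) auto
qed

lemma annihilator_small: "poly_over F q \<Longrightarrow> poly q \<theta> = 0 \<Longrightarrow> Polynomial.degree q < p \<Longrightarrow> q = 0"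
  by (rule no_small_annihilator[OF F CHAR _ min_pol_over[unfolded min_pol_def], of 0 q])
     (use F notin p2 in auto)

lemma poly_reduce:
  assumes "poly_over F q"
  obtains S R where "poly_over F S" "poly_over F R" "q = S * min_pol + R" "Polynomial.degree R < p"
proof -
  have m0: "min_pol \<noteq> 0" using degree_min_pol p2 by auto
  obtain S R where "poly_over F S" "poly_over F R" "q = S * min_pol + R"
    "R = 0 \<or> Polynomial.degree R < Polynomial.degree min_pol"
    by (rule poly_over_division[OF F min_pol_over m0 assms])
  thus thesis using p2 degree_min_pol by (intro that[of S R]) auto
qed

lemma annihilator_shift:
  assumes "poly_over F q" "poly q \<theta> = 0" "b \<in> prime_field" shows "poly q (\<theta> + b) = 0"
proof -
  obtain S R where SR: "poly_over F S" "poly_over F R" "q = S * min_pol + R" "Polynomial.degree R < p"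
    by (rule poly_reduce[OF assms(1)])
  have "poly R \<theta> = 0" using assms(2) SR(3) by (simp add: poly_min_pol)
  hence "R = 0" using annihilator_small SR by blast
  moreover have "b ^ p = b" using prime_field_iff[OF CHAR prime] assms(3) by simp
  hence "poly min_pol (\<theta> + b) = 0" using CHAR prime by (simp add: poly_min_pol freshmans_dream)
  ultimately show ?thesis using SR(3) by simp
qed

text \<open>
  Euclid's algorithm: division of the minimal polynomial by \<open>q\<close> expresses the value of \<open>q\<close> at
  \<open>\<theta>\<close> through that of a remainder of smaller degree.
\<close>

lemma inverse_poly:
  assumes "poly_over F q" "poly q \<theta> \<noteq> 0"
  obtains u where "poly_over F u" "poly u \<theta> * poly q \<theta> = 1"
proof -
  have *: "\<exists>u. poly_over F u \<and> poly u \<theta> * poly q \<theta> = 1"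
    if "poly_over F q" "poly q \<theta> \<noteq> 0" "Polynomial.degree q < p" for q
    using that
  proof (induction "Polynomial.degree q" arbitrary: q rule: less_induct)
    case less
    show ?case
    proof (cases "Polynomial.degree q = 0")
      case True
      then obtain a where a: "q = [:a:]" by (auto elim: degree_eq_zeroE)
      thus ?thesis using less.prems F by (intro exI[of _ "[:inverse a:]"]) auto
    next
      case False
      have q0: "q \<noteq> 0" using less.prems by auto
      obtain S R where SR: "poly_over F S" "poly_over F R" "min_pol = S * q + R"
        "R = 0 \<or> Polynomial.degree R < Polynomial.degree q"
        by (rule poly_over_division[OF F less.prems(1) q0 min_pol_over])
      have rel: "poly S \<theta> * poly q \<theta> = - poly R \<theta>"
        using arg_cong[OF SR(3), of "\<lambda>P. poly P \<theta>"] by (simp add: poly_min_pol eq_neg_iff_add_eq_0)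
      have "poly R \<theta> \<noteq> 0"
      proof
        assume R: "poly R \<theta> = 0"
        have "R = 0" using annihilator_small[OF SR(2) R] SR(4) less.prems by auto
        hence S0: "S \<noteq> 0" and eq: "min_pol = S * q" using SR(3) degree_min_pol p2 by auto
        have "Polynomial.degree S < p"
          using arg_cong[OF eq, of Polynomial.degree] degree_min_pol False S0 q0 by (simp add: degree_mult_eq)
        moreover have "poly S \<theta> = 0" using rel R less.prems by simp
        ultimately show False using annihilator_small[OF SR(1)] S0 by auto
      qed
      moreover have "R \<noteq> 0" using calculation by auto
      ultimately obtain u where u: "poly_over F u" "poly u \<theta> * poly R \<theta> = 1"
        using less.hyps[of R] SR less.prems by auto
      show ?thesis using u rel SR(1) F
        by (intro exI[of _ "- u * S"]) (simp add: mult.assoc)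
    qed
  qed
  obtain S R where SR: "poly_over F S" "poly_over F R" "q = S * min_pol + R" "Polynomial.degree R < p"
    by (rule poly_reduce[OF assms(1)])
  have "poly q \<theta> = poly R \<theta>" using SR(3) by (simp add: poly_min_pol)
  thus thesis using *[OF SR(2) _ SR(4)] assms that by auto
qed

lemma E_eq_poly: "E = {poly q \<theta> | q. poly_over F q}" (is "E = ?S")
proof
  have "subfield ?S \<Omega>"
  proof (rule subfield_ambientI)
    show "1 \<in> ?S" using F by (intro CollectI exI[of _ 1]) auto
  next
    fix x y assume "x \<in> ?S" "y \<in> ?S"
    then obtain q r where "x = poly q \<theta>" "y = poly r \<theta>" "poly_over F q" "poly_over F r" by auto
    thus "x + y \<in> ?S" "x * y \<in> ?S" "- x \<in> ?S"
      using F by (intro CollectI exI[of _ "q + r"], simp, intro CollectI exI[of _ "q * r"], simp,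
          intro CollectI exI[of _ "- q"], simp)
  next
    fix x assume "x \<in> ?S" "x \<noteq> 0"
    then obtain q where q: "x = poly q \<theta>" "poly_over F q" by auto
    then obtain u where "poly_over F u" "poly u \<theta> * x = 1" using inverse_poly \<open>x \<noteq> 0\<close> by metis
    thus "inverse x \<in> ?S" by (intro CollectI exI[of _ u]) (metis \<open>x \<noteq> 0\<close> field_class.field_inverse nonzero_eq_divide_eq inverse_eq_divide)
  qed
  moreover have "F \<subseteq> ?S"
  proof
    fix x assume "x \<in> F" thus "x \<in> ?S" using F by (intro CollectI exI[of _ "[:x:]"]) auto
  qed
  moreover have "\<theta> \<in> ?S" using F by (intro CollectI exI[of _ "[:0,1:]"]) auto
  ultimately show "E \<subseteq> ?S" by (rule E_least)
  have "poly q \<theta> \<in> E" if "poly_over F q" for q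
  proof -
    have "poly_over E q" using that F_subset by (auto simp: poly_over_def)
    thus ?thesis using gen_in E_subfield by simp
  qed
  thus "?S \<subseteq> E" by auto
qed

lemma E_poly:
  assumes "z \<in> E" obtains q where "poly_over F q" "z = poly q \<theta>" "Polynomial.degree q < p"
proof -
  obtain q where q: "poly_over F q" "z = poly q \<theta>" using assms E_eq_poly by auto
  obtain S R where SR: "poly_over F S" "poly_over F R" "q = S * min_pol + R" "Polynomial.degree R < p"
    by (rule poly_reduce[OF q(1)])
  have "poly q \<theta> = poly R \<theta>" using SR(3) by (simp add: poly_min_pol)
  thus thesis using that SR q by auto
qed

lemma poly_sum_lessThan:
  fixes q :: "'b::comm_ring_1 poly"
  assumes "Polynomial.degree q < n" shows "poly q z = (\<Sum>m<n. Polynomial.coeff q m * z ^ m)"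
proof -
  have "poly q z = (\<Sum>m\<le>Polynomial.degree q. Polynomial.coeff q m * z ^ m)" by (rule poly_altdef)
  also have "\<dots> = (\<Sum>m<n. Polynomial.coeff q m * z ^ m)"
    by (rule sum.mono_neutral_left) (use assms in \<open>auto simp: coeff_eq_0\<close>)
  finally show ?thesis .
qed

lemma power_basis:
  assumes "z \<in> E" shows "\<exists>c. (\<forall>m. c m \<in> F) \<and> z = (\<Sum>m<p. c m * \<theta> ^ m)"
proof -
  obtain q where q: "poly_over F q" "z = poly q \<theta>" "Polynomial.degree q < p" by (rule E_poly[OF assms])
  thus ?thesis by (intro exI[of _ "Polynomial.coeff q"]) (auto simp: poly_sum_lessThan poly_over_def)
qed

lemma power_indep: "lin_indep F p (\<lambda>m. \<theta> ^ m)"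
  unfolding lin_indep_def
proof (intro allI impI)
  fix c m assume c: "\<forall>m<p. c m \<in> F" and z: "(\<Sum>m<p. c m * \<theta> ^ m) = 0" and m: "m < p"
  define q where "q = (\<Sum>m<p. Polynomial.monom (c m) m)"
  have "poly_over F q" using c F unfolding q_def by (intro poly_over_sum) auto
  moreover have "poly q \<theta> = 0" using z by (simp add: q_def poly_sum poly_monom)
  moreover have cq: "Polynomial.coeff q i = (if i < p then c i else 0)" for i
    by (auto simp: q_def Polynomial.coeff_sum sum.If_cases if_distrib cong: if_cong)
  have "Polynomial.degree q < p" using p2 by (intro degree_lessI) (auto simp: cq)
  ultimately have "q = 0" by (rule annihilator_small)
  thus "c m = 0" using cq[of m] m by simp
qed

lemma E_eq_span: "E = lin_span F p (\<lambda>m. \<theta> ^ m)"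
proof (intro equalityI subsetI)
  fix z assume "z \<in> E" then show "z \<in> lin_span F p (\<lambda>m. \<theta> ^ m)"
    using power_basis unfolding lin_span_def by blast
next
  fix z assume "z \<in> lin_span F p (\<lambda>m. \<theta> ^ m)"
  thus "z \<in> E" using E_subfield F_subset gen_in
    by (auto simp: lin_span_def intro!: subfield_sum subfield_mult subfield_power)
qed

lemma dimension_E: "amb.dimension p F E"
  unfolding E_eq_span by (rule dimension_ambientI[OF F power_indep])

text \<open>
  The automorphism \<open>\<theta> \<mapsto> \<theta> + b\<close>.  An element of \<open>E\<close> is the value at \<open>\<theta>\<close> of some polynomial over \<open>F\<close>;
  by \<open>annihilator_shift\<close> the value of this polynomial at \<open>\<theta> + b\<close> does not depend on its choice.
\<close>

definition shift :: "'a \<Rightarrow> 'a \<Rightarrow> 'a"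
  where "shift b z = poly (SOME q. poly_over F q \<and> poly q \<theta> = z) (\<theta> + b)"

lemma shift_poly:
  assumes "poly_over F q" "b \<in> prime_field" shows "shift b (poly q \<theta>) = poly q (\<theta> + b)"
proof -
  define r where "r = (SOME r. poly_over F r \<and> poly r \<theta> = poly q \<theta>)"
  have r: "poly_over F r \<and> poly r \<theta> = poly q \<theta>" unfolding r_def by (rule someI[of _ q]) (use assms in auto)
  have "poly (q - r) (\<theta> + b) = 0" by (rule annihilator_shift) (use assms r F in auto)
  thus ?thesis by (simp add: shift_def r_def)
qed

context
  fixes b :: 'a assumes b: "b \<in> prime_field"
begin

lemma shift_base: "z \<in> F \<Longrightarrow> shift b z = z"
  using shift_poly[of "[:z:]" b] b F by simp
lemma shift_gen: "shift b \<theta> = \<theta> + b"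
  using shift_poly[of "[:0,1:]" b] b F by simp
lemma shift_in: assumes "z \<in> E" shows "shift b z \<in> E"
proof -
  obtain q where q: "poly_over F q" "z = poly q \<theta>" using assms E_eq_poly by auto
  have "poly_over E q" using q F_subset by (auto simp: poly_over_def)
  moreover have "b \<in> E" using b E_subfield by auto
  ultimately show ?thesis using q b shift_poly E_subfield gen_in by simp
qed
lemma shift_add: assumes "z \<in> E" "y \<in> E" shows "shift b (z + y) = shift b z + shift b y"
proof -
  obtain q r where q: "poly_over F q" "z = poly q \<theta>" "poly_over F r" "y = poly r \<theta>" using assms E_eq_poly by auto
  show ?thesis using shift_poly[of "q + r" b] shift_poly[of q b] shift_poly[of r b] q b F by simp
qed
lemma shift_mult: assumes "z \<in> E" "y \<in> E" shows "shift b (z * y) = shift b z * shift b y"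
proof -
  obtain q r where q: "poly_over F q" "z = poly q \<theta>" "poly_over F r" "y = poly r \<theta>" using assms E_eq_poly by auto
  show ?thesis using shift_poly[of "q * r" b] shift_poly[of q b] shift_poly[of r b] q b F by simp
qed
lemma shift_surj: assumes "z \<in> E" obtains y where "y \<in> E" "shift b y = z"
proof -
  obtain q where q: "poly_over F q" "z = poly q \<theta>" using assms E_eq_poly by auto
  have bF: "b \<in> F" using b F by auto
  have "shift b (poly (pcompose q [:-b, 1:]) \<theta>) = z"
    using q b bF F by (subst shift_poly) (auto simp: poly_pcompose)
  moreover have "poly (pcompose q [:-b, 1:]) \<theta> \<in> E"
    unfolding E_eq_poly using q bF F by (intro CollectI exI[of _ "pcompose q [:-b, 1:]"]) auto
  ultimately show thesis using that by blast
qed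

end

text \<open>
  If \<open>q(\<theta> + 1) = q(\<theta>)\<close> with \<open>deg q < p\<close>, then \<open>q(X + 1) = q(X)\<close>, so \<open>q\<close> takes the same value at the
  \<open>p\<close> elements of the prime field and is constant.
\<close>

lemma shift_fixed:
  assumes z: "z \<in> E" and fx: "shift 1 z = z" shows "z \<in> F"
proof -
  have one: "(1::'a) \<in> prime_field" by (rule range_eqI[of _ _ 1]) auto
  obtain q where q: "poly_over F q" "z = poly q \<theta>" "Polynomial.degree q < p" by (rule E_poly[OF z])
  define r where "r = pcompose q [:1, 1:] - q"
  have "poly_over F r" using q F by (simp add: r_def)
  moreover have "poly r \<theta> = 0"
    using fx shift_poly[OF q(1) one] q(2) by (simp add: r_def poly_pcompose add.commute)
  moreover have "Polynomial.degree r < p"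
    unfolding r_def by (rule le_less_trans[OF degree_diff_le q(3)]) (auto simp: degree_pcompose)
  ultimately have "r = 0" by (rule annihilator_small)
  hence step: "poly q (y + 1) = poly q y" for y
  proof -
    have "poly r y = 0" using \<open>r = 0\<close> by simp
    thus ?thesis by (simp add: r_def poly_pcompose add.commute)
  qed
  have per: "poly q (of_nat n) = poly q 0" for n
  proof (induction n)
    case (Suc n)
    thus ?case using step[of "of_nat n"] by (simp add: add.commute)
  qed simp
  have "q = [:poly q 0:]"
  proof (rule poly_eqI_degree[of "prime_field"])
    fix y :: 'a assume "y \<in> prime_field"
    thus "poly q y = poly [:poly q 0:] y" using per prime_field_eq_of_nat[OF CHAR prime] by auto
  qed (use prime_field_eq_of_nat[OF CHAR prime] q p2 in auto)
  hence "z = poly q 0" using q by (metis poly_pCons poly_0 mult_zero_right add.right_neutral)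
  thus ?thesis using q F by simp
qed

text \<open>
  The automorphism \<open>\<theta> \<mapsto> \<theta> + 1\<close> moves \<open>\<eta>\<close> to another root of the same Artin--Schrier equation,
  that is, to \<open>\<eta> + b\<close> with \<open>b\<close> in the prime field.  So it fixes \<open>\<eta> - b \<theta>\<close>.
\<close>

lemma descent:
  assumes "\<eta> \<in> E" "\<eta> ^ p - \<eta> \<in> F"
  obtains b x where "b \<in> prime_field" "x \<in> F" "\<eta> = b * \<theta> + x"
proof -
  have one: "(1::'a) \<in> prime_field" by (rule range_eqI[of _ _ 1]) auto
  have pow: "shift 1 (\<eta> ^ n) = shift 1 \<eta> ^ n" for n
    by (induction n) (use assms E_subfield one shift_base F in \<open>auto simp: shift_mult\<close>)
  define b where "b = shift 1 \<eta> - \<eta>"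
  have "shift 1 \<eta> ^ p - shift 1 \<eta> = \<eta> ^ p - \<eta>"
  proof -
    have "shift 1 ((\<eta> ^ p - \<eta>) + \<eta>) = (\<eta> ^ p - \<eta>) + shift 1 \<eta>"
      using shift_add[OF one, of "\<eta> ^ p - \<eta>" \<eta>] shift_base[OF one assms(2)] assms F_subset by auto
    thus ?thesis using pow[of p] by simp
  qed
  hence "b ^ p = b" using artin_schrier_diff[OF CHAR prime, of "shift 1 \<eta>" \<eta>] by (simp add: b_def)
  hence b: "b \<in> prime_field" by (simp add: prime_field_iff[OF CHAR prime])
  have bE: "b \<in> E" "b \<in> F" "- b \<in> F" "- b \<in> E" using b E_subfield F by auto
  have "shift 1 (\<eta> + - b * \<theta>) = \<eta> + - b * \<theta>"
  proof -
    have "shift 1 (\<eta> + - b * \<theta>) = shift 1 \<eta> + shift 1 (- b) * shift 1 \<theta>"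
      using one assms bE E_subfield gen_in shift_mult[OF one bE(4) gen_in] shift_add[OF one, of \<eta> "- b * \<theta>"]
      by (simp del: mult_minus_left)
    also have "\<dots> = \<eta> + - b * \<theta>"
    proof -
      have "shift 1 \<eta> = \<eta> + b" by (simp add: b_def)
      thus ?thesis by (simp only: shift_base[OF one bE(3)] shift_gen[OF one]) (simp add: algebra_simps)
    qed
    finally show ?thesis .
  qed
  hence "\<eta> + - b * \<theta> \<in> F" by (rule shift_fixed[rotated]) (use assms bE E_subfield gen_in in auto)
  thus thesis using b by (intro that[of b "\<eta> + - b * \<theta>"]) auto
qed

end

section \<open>Valuations\<close>

lemma dvd_diff_small:
  assumes "int n dvd int m - int m'" "m < n" "m' < n" shows "m = m'"
  using dvd_imp_le_int[of "int m - int m'" "int n"] assms by force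

text \<open>
  The value group may be smaller than \<open>\<int>\<close>, which allows the restriction of a valuation to a subfield.
\<close>

locale valued_field =
  fixes N :: "'a::field set" and w :: "'a \<Rightarrow> int"
  assumes N: "subfield N \<Omega>"
    and val_mult: "x \<in> N \<Longrightarrow> y \<in> N \<Longrightarrow> x \<noteq> 0 \<Longrightarrow> y \<noteq> 0 \<Longrightarrow> w (x * y) = w x + w y"
    and val_add: "x \<in> N \<Longrightarrow> y \<in> N \<Longrightarrow> x \<noteq> 0 \<Longrightarrow> y \<noteq> 0 \<Longrightarrow> val_ge w (x + y) (min (w x) (w y))"

lemma val_ge_mono: "val_ge w x a \<Longrightarrow> b \<le> a \<Longrightarrow> val_ge w x b"
  by (auto simp: val_ge_def)
lemma val_ge_zero [simp]: "val_ge w 0 a" by (simp add: val_ge_def)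
lemma discrete_valuation_iff:
  "discrete_valuation N w \<longleftrightarrow> valued_field N w \<and> w ` (N - {0}) = UNIV"
  unfolding discrete_valuation_def valued_field_def by auto

lemma discrete_valuation_uniformizer:
  assumes "discrete_valuation K v" obtains \<pi> where "\<pi> \<in> K" "\<pi> \<noteq> 0" "v \<pi> = 1"
proof -
  have "1 \<in> v ` (K - {0})" using assms by (simp add: discrete_valuation_iff)
  thus thesis using that by force
qed

text \<open>
  The algebraic part of membership in \<open>Gal F N\<close>.  Values outside \<open>N\<close> are left open, so that this
  class of maps is closed under ordinary composition of functions.
\<close>

definition fixing_hom :: "'a::field set \<Rightarrow> 'a set \<Rightarrow> ('a \<Rightarrow> 'a) \<Rightarrow> bool"
  where "fixing_hom F N \<sigma> \<longleftrightarrow> (\<forall>x\<in>N. \<sigma> x \<in> N) \<and>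
    (\<forall>x\<in>N. \<forall>y\<in>N. \<sigma> (x + y) = \<sigma> x + \<sigma> y \<and> \<sigma> (x * y) = \<sigma> x * \<sigma> y) \<and> (\<forall>x\<in>F. \<sigma> x = x)"

context
  fixes F N :: "'a::field set" and \<sigma>
  assumes \<sigma>: "fixing_hom F N \<sigma>" and F: "subfield F \<Omega>" and N: "subfield N \<Omega>" and FN: "F \<subseteq> N"
begin

lemma fixing_hom_in: "x \<in> N \<Longrightarrow> \<sigma> x \<in> N" using \<sigma> by (auto simp: fixing_hom_def)
lemma fixing_hom_fix: "x \<in> F \<Longrightarrow> \<sigma> x = x" using \<sigma> by (auto simp: fixing_hom_def)
lemma fixing_hom_add: "x \<in> N \<Longrightarrow> y \<in> N \<Longrightarrow> \<sigma> (x + y) = \<sigma> x + \<sigma> y" using \<sigma> by (auto simp: fixing_hom_def)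
lemma fixing_hom_mult: "x \<in> N \<Longrightarrow> y \<in> N \<Longrightarrow> \<sigma> (x * y) = \<sigma> x * \<sigma> y" using \<sigma> by (auto simp: fixing_hom_def)
lemma fixing_hom_diff: "x \<in> N \<Longrightarrow> y \<in> N \<Longrightarrow> \<sigma> (x - y) = \<sigma> x - \<sigma> y"
  using fixing_hom_add[of "x - y" y] N by simp
lemma fixing_hom_power: "x \<in> N \<Longrightarrow> \<sigma> (x ^ n) = \<sigma> x ^ n"
  by (induction n) (use fixing_hom_mult fixing_hom_fix F N in auto)
lemma fixing_hom_sum: "(\<And>i. i \<in> A \<Longrightarrow> c i \<in> N) \<Longrightarrow> \<sigma> (sum c A) = (\<Sum>i\<in>A. \<sigma> (c i))"
  by (induction A rule: infinite_finite_induct) (use fixing_hom_add fixing_hom_fix F N in auto)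
lemma fixing_hom_nonzero: "x \<in> N \<Longrightarrow> x \<noteq> 0 \<Longrightarrow> \<sigma> x \<noteq> 0"
  using fixing_hom_mult[of x "inverse x"] fixing_hom_fix[of 1] F N by auto
lemma fixing_hom_poly: "poly_over F q \<Longrightarrow> x \<in> N \<Longrightarrow> \<sigma> (poly q x) = poly q (\<sigma> x)"
proof (induction q)
  case 0 thus ?case using fixing_hom_fix[of 0] F by simp
next
  case (pCons a q)
  have "a \<in> F" "poly_over F q" using pCons F by simp_all
  moreover have "poly_over N q" using calculation FN by (auto simp: poly_over_def)
  ultimately have "a \<in> N" "poly q x \<in> N" using pCons.prems FN N by auto
  thus ?case using pCons F N by (auto simp: fixing_hom_add fixing_hom_mult fixing_hom_fix)
qed
lemma fixing_hom_inj: "x \<in> N \<Longrightarrow> y \<in> N \<Longrightarrow> \<sigma> x = \<sigma> y \<Longrightarrow> x = y"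
  using fixing_hom_nonzero[of "x - y"] fixing_hom_diff[of x y] N by auto

end

lemma fixing_hom_subset: "fixing_hom F N \<sigma> \<Longrightarrow> F' \<subseteq> F \<Longrightarrow> fixing_hom F' N \<sigma>"
  by (auto simp: fixing_hom_def)

context valued_field
begin

lemma val_one [simp]: "w 1 = 0"
  using val_mult[of 1 1] N by simp

lemma val_uminus [simp]: assumes "x \<in> N" shows "w (- x) = w x"
proof (cases "x = 0")
  case False
  have "w (- 1) = 0" using val_mult[of "- 1" "- 1"] N by simp
  thus ?thesis using val_mult[of "- 1" x] assms False N by simp
qed simp

lemma val_power: "x \<in> N \<Longrightarrow> x \<noteq> 0 \<Longrightarrow> w (x ^ n) = int n * w x"
  by (induction n) (use N in \<open>auto simp: val_mult algebra_simps\<close>)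

lemma val_inverse: "x \<in> N \<Longrightarrow> x \<noteq> 0 \<Longrightarrow> w (inverse x) = - w x"
  using val_mult[of x "inverse x"] N by simp

lemma val_divide: "x \<in> N \<Longrightarrow> y \<in> N \<Longrightarrow> x \<noteq> 0 \<Longrightarrow> y \<noteq> 0 \<Longrightarrow> w (x / y) = w x - w y"
  using N by (simp add: field_class.field_divide_inverse val_mult val_inverse)

lemma val_power_int: "x \<in> N \<Longrightarrow> x \<noteq> 0 \<Longrightarrow> w (x powi n) = n * w x"
  using N by (auto simp: power_int_def val_power val_inverse)

lemma val_ge_add: "x \<in> N \<Longrightarrow> y \<in> N \<Longrightarrow> val_ge w x a \<Longrightarrow> val_ge w y a \<Longrightarrow> val_ge w (x + y) a"
  using val_add[of x y] by (cases "x = 0"; cases "y = 0") (auto simp: val_ge_def)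

lemma val_ge_uminus [simp]: "x \<in> N \<Longrightarrow> val_ge w (- x) a \<longleftrightarrow> val_ge w x a"
  by (auto simp: val_ge_def)

lemma val_ge_diff: "x \<in> N \<Longrightarrow> y \<in> N \<Longrightarrow> val_ge w x a \<Longrightarrow> val_ge w y a \<Longrightarrow> val_ge w (x - y) a"
  using val_ge_add[of x "- y" a] N by simp

lemma val_ge_diff_swap: "x \<in> N \<Longrightarrow> y \<in> N \<Longrightarrow> val_ge w (x - y) a \<longleftrightarrow> val_ge w (y - x) a"
  using val_ge_uminus[of "x - y" a] N by simp

lemma val_ge_sum: "(\<And>i. i \<in> A \<Longrightarrow> c i \<in> N) \<Longrightarrow> (\<And>i. i \<in> A \<Longrightarrow> val_ge w (c i) a) \<Longrightarrow> val_ge w (sum c A) a"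
  by (induction A rule: infinite_finite_induct) (use N in \<open>auto intro: val_ge_add\<close>)

lemma val_ge_mult: "x \<in> N \<Longrightarrow> y \<in> N \<Longrightarrow> val_ge w x a \<Longrightarrow> val_ge w y b \<Longrightarrow> val_ge w (x * y) (a + b)"
  by (cases "x = 0"; cases "y = 0") (auto simp: val_ge_def val_mult)

lemma val_ge_mult0: "x \<in> N \<Longrightarrow> y \<in> N \<Longrightarrow> val_ge w x 0 \<Longrightarrow> val_ge w y a \<Longrightarrow> val_ge w (x * y) a"
  using val_ge_mult[of x y 0 a] by simp

lemma val_ge_power: "x \<in> N \<Longrightarrow> val_ge w x a \<Longrightarrow> val_ge w (x ^ n) (int n * a)"
proof (induction n)
  case (Suc n)
  thus ?case using val_ge_mult[of x "x ^ n" a "int n * a"] N by (simp add: algebra_simps)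
qed (simp add: val_ge_def)

lemma val_add_eq:
  assumes "x \<in> N" "y \<in> N" "x \<noteq> 0" "val_ge w y (w x + 1)"
  shows "x + y \<noteq> 0" "w (x + y) = w x"
proof -
  have *: "x + y \<noteq> 0 \<and> w (x + y) \<le> w x"
  proof (rule ccontr)
    assume "\<not> ?thesis"
    hence "val_ge w (x + y) (w x + 1)" by (auto simp: val_ge_def)
    hence "val_ge w ((x + y) - y) (w x + 1)" by (intro val_ge_diff) (use assms N in auto)
    thus False using assms(3) by (simp add: val_ge_def)
  qed
  have "val_ge w (x + y) (w x)"
    by (rule val_ge_add) (use assms in \<open>auto simp: val_ge_def\<close>)
  thus "x + y \<noteq> 0" "w (x + y) = w x" using * by (auto simp: val_ge_def)
qed

lemma restrict: "subfield F \<Omega> \<Longrightarrow> F \<subseteq> N \<Longrightarrow> valued_field F w"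
  by (rule valued_field.intro) (auto intro: val_mult val_add)

lemma val_eqI:
  assumes "x \<noteq> 0" "y \<noteq> 0" "\<And>a. val_ge w x a \<longleftrightarrow> val_ge w y a" shows "w x = w y"
  using assms(3)[of "w x"] assms(3)[of "w y"] assms(1,2) by (simp add: val_ge_def)

lemma val_prime_field:
  assumes "CHAR('a) = p" "Factorial_Ring.prime p" "b \<in> prime_field" "b \<noteq> 0"
  shows "w b = 0"
proof -
  have b: "b \<in> N" using assms(3) N by auto
  have "b ^ p = b" using assms prime_field_iff by blast
  hence "int p * w b = w b" using val_power[OF b assms(4), of p] by simp
  thus ?thesis using prime_ge_2_nat[OF assms(2)] by auto
qed

lemma val_ge_prime_field:
  assumes "CHAR('a) = p" "Factorial_Ring.prime p" "b \<in> prime_field" shows "val_ge w b 0"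
  using val_prime_field[OF assms] by (cases "b = 0") (auto simp: val_ge_def)

lemma val_sum_distinct:
  assumes "finite A" "A \<noteq> {}" "\<And>m. m \<in> A \<Longrightarrow> y m \<in> N \<and> y m \<noteq> 0" "inj_on (\<lambda>m. w (y m)) A"
  obtains m where "m \<in> A" "sum y A \<noteq> 0" "w (sum y A) = w (y m)" "\<And>m'. m' \<in> A \<Longrightarrow> w (y m) \<le> w (y m')"
proof -
  define v where "v = Min ((\<lambda>m. w (y m)) ` A)"
  obtain m where m: "m \<in> A" "w (y m) = v"
    using Min_in[of "(\<lambda>m. w (y m)) ` A"] assms(1,2) unfolding v_def by fastforce
  have le: "w (y m) \<le> w (y m')" if "m' \<in> A" for m' using m(2) that assms(1) by (simp add: v_def)
  have lt: "w (y m) < w (y m')" if "m' \<in> A - {m}" for m'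
    using le[of m'] that inj_onD[OF assms(4), of m m'] m(1) by fastforce
  have s: "sum y A = y m + sum y (A - {m})" using assms(1) m(1) by (rule sum.remove)
  have "val_ge w (sum y (A - {m})) (w (y m) + 1)"
    by (rule val_ge_sum) (use assms lt in \<open>force simp: val_ge_def\<close>)+
  moreover have "sum y (A - {m}) \<in> N" by (rule subfield_sum[OF N]) (use assms(3) in auto)
  ultimately have "sum y A \<noteq> 0" "w (sum y A) = w (y m)" unfolding s
    using val_add_eq[of "y m"] assms(3) m(1) by auto
  thus thesis using that m le by blast
qed

text \<open>
  The nonzero terms of a linear combination over \<open>F\<close> have pairwise different values whatever the
  coefficients are, so that they cannot cancel.
\<close>

definition val_indep :: "'a set \<Rightarrow> nat \<Rightarrow> (nat \<Rightarrow> 'a) \<Rightarrow> bool"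
  where "val_indep F n x \<longleftrightarrow> (\<forall>m<n. x m \<in> N \<and> x m \<noteq> 0) \<and>
    (\<forall>m<n. \<forall>m'<n. m \<noteq> m' \<longrightarrow> (\<forall>c\<in>F - {0}. \<forall>c'\<in>F - {0}. w c + w (x m) \<noteq> w c' + w (x m')))"

lemma val_indep_sum:
  assumes "F \<subseteq> N" and ind: "val_indep F n x" and c: "\<And>m. m < n \<Longrightarrow> c m \<in> F"
    and nz: "i < n" "c i \<noteq> 0"
  shows "\<exists>m<n. c m \<noteq> 0 \<and> (\<Sum>m<n. c m * x m) \<noteq> 0 \<and>
    w (\<Sum>m<n. c m * x m) = w (c m) + w (x m) \<and>
    (\<forall>m'<n. c m' \<noteq> 0 \<longrightarrow> w (c m) + w (x m) \<le> w (c m') + w (x m'))"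
proof -
  define A where "A = {m. m < n \<and> c m \<noteq> 0}"
  have x: "x m \<in> N" "x m \<noteq> 0" if "m < n" for m using ind that by (auto simp: val_indep_def)
  have s: "(\<Sum>m<n. c m * x m) = (\<Sum>m\<in>A. c m * x m)"
    by (rule sum.mono_neutral_right) (auto simp: A_def)
  have v: "w (c m * x m) = w (c m) + w (x m)" if "m \<in> A" for m
    using that x c assms(1) by (intro val_mult) (auto simp: A_def)
  have "inj_on (\<lambda>m. w (c m * x m)) A"
  proof (rule inj_onI, rule ccontr)
    fix m m' assume "m \<in> A" "m' \<in> A" "w (c m * x m) = w (c m' * x m')" "m \<noteq> m'"
    thus False using v c ind unfolding val_indep_def A_def by auto
  qed
  moreover have "finite A" "A \<noteq> {}" using nz by (auto simp: A_def)
  moreover have "c m * x m \<in> N \<and> c m * x m \<noteq> 0" if "m \<in> A" for m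
    using that x[of m] c[of m] assms(1) N by (auto simp: A_def)
  ultimately obtain m where "m \<in> A" "(\<Sum>m\<in>A. c m * x m) \<noteq> 0" "w (\<Sum>m\<in>A. c m * x m) = w (c m * x m)"
     "\<And>m'. m' \<in> A \<Longrightarrow> w (c m * x m) \<le> w (c m' * x m')"
    using val_sum_distinct[of A "\<lambda>m. c m * x m"] by blast
  thus ?thesis using v s by (intro exI[of _ m]) (auto simp: A_def)
qed

lemma val_indep_lin_indep:
  assumes "F \<subseteq> N" "val_indep F n x" shows "lin_indep F n x"
  unfolding lin_indep_def using val_indep_sum[OF assms] by blast

lemma val_indep_ge_iff:
  assumes "F \<subseteq> N" "val_indep F n x" "\<And>m. m < n \<Longrightarrow> c m \<in> F"
  shows "val_ge w (\<Sum>m<n. c m * x m) a \<longleftrightarrow> (\<forall>m<n. val_ge w (c m * x m) a)"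
proof
  assume ge: "val_ge w (\<Sum>m<n. c m * x m) a"
  show "\<forall>m<n. val_ge w (c m * x m) a"
  proof (intro allI impI)
    fix m0 assume m0: "m0 < n"
    show "val_ge w (c m0 * x m0) a"
    proof (cases "c m0 = 0")
      case False
      obtain m where "m < n" "c m \<noteq> 0" "(\<Sum>m<n. c m * x m) \<noteq> 0"
        "w (\<Sum>m<n. c m * x m) = w (c m) + w (x m)"
        "\<And>m'. m' < n \<Longrightarrow> c m' \<noteq> 0 \<Longrightarrow> w (c m) + w (x m) \<le> w (c m') + w (x m')"
        using val_indep_sum[OF assms(1,2), of c m0] assms(3) m0 False by blast
      moreover have "w (c m0 * x m0) = w (c m0) + w (x m0)"
        using assms m0 False by (intro val_mult) (auto simp: val_indep_def)
      ultimately show ?thesis using ge m0 False by (fastforce simp: val_ge_def)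
    qed simp
  qed
next
  assume "\<forall>m<n. val_ge w (c m * x m) a"
  thus "val_ge w (\<Sum>m<n. c m * x m) a"
    using assms(2) assms(3) N unfolding val_indep_def
    by (intro val_ge_sum) (auto intro!: subfield_mult[OF N] dest: subsetD[OF assms(1)])
qed

text \<open>
  Since \<open>n\<close> divides the values of \<open>F\<close>, the terms \<open>c x\<^sup>m\<close> with \<open>m < n\<close> have values in different
  classes modulo \<open>n\<close>.
\<close>

lemma val_indep_uniformizer:
  assumes F: "F \<subseteq> N" and dv: "\<And>c. c \<in> F \<Longrightarrow> c \<noteq> 0 \<Longrightarrow> int n dvd w c"
    and x: "x \<in> N" "x \<noteq> 0" "w x = 1"
  shows "val_indep F n (\<lambda>m. x ^ m)"
  unfolding val_indep_def
proof (intro conjI allI impI ballI)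
  fix m m' c c' assume m: "m < n" "m' < n" "m \<noteq> m'" and c: "c \<in> F - {0}" "c' \<in> F - {0}"
  show "w c + w (x ^ m) \<noteq> w c' + w (x ^ m')"
  proof
    assume "w c + w (x ^ m) = w c' + w (x ^ m')"
    hence "int m - int m' = w c' - w c" using x by (simp add: val_power)
    hence "int n dvd int m - int m'" using dv c by (simp add: dvd_diff)
    thus False using m dvd_diff_small by blast
  qed
qed (use x N in auto)

lemma uniformizer_basis:
  assumes F: "subfield F \<Omega>" "F \<subseteq> N" and dim: "amb.dimension n F N"
    and dv: "\<And>c. c \<in> F \<Longrightarrow> c \<noteq> 0 \<Longrightarrow> int n dvd w c"
    and x: "x \<in> N" "x \<noteq> 0" "w x = 1" and z: "z \<in> N"
  shows "\<exists>c. (\<forall>m<n. c m \<in> F) \<and> z = (\<Sum>m<n. c m * x ^ m) \<and>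
    (\<forall>a. val_ge w z a \<longleftrightarrow> (\<forall>m<n. val_ge w (c m * x ^ m) a))"
proof -
  have ind: "val_indep F n (\<lambda>m. x ^ m)" by (rule val_indep_uniformizer) (use assms in auto)
  obtain c where c: "\<And>m. m < n \<Longrightarrow> c m \<in> F" "z = (\<Sum>m<n. c m * x ^ m)"
    by (rule lin_indep_spans[OF F(1) dim _ val_indep_lin_indep[OF F(2) ind] z]) (use x N in auto)
  show ?thesis using val_indep_ge_iff[OF F(2) ind c(1)] c by (intro exI[of _ c]) simp
qed

text \<open>
  The value of \<open>c\<close> is a multiple of \<open>n\<close> and at least \<open>-m > -n\<close>.
\<close>

lemma uniformizer_coeff_integral:
  assumes dv: "c \<noteq> 0 \<Longrightarrow> int n dvd w c" and "c \<in> N"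
    and x: "x \<in> N" "x \<noteq> 0" "w x = 1" and m: "m < n" and ge: "val_ge w (c * x ^ m) 0"
  shows "val_ge w c 0"
proof (cases "c = 0")
  case False
  have "0 \<le> w c + int m" using ge False x assms N by (simp add: val_ge_def val_mult val_power)
  moreover obtain k where k: "w c = int n * k" using dv False by auto
  ultimately have "0 < int n * (k + 1)" using m by (simp add: algebra_simps)
  hence "k \<ge> 0" by (simp add: zero_less_mult_iff)
  thus ?thesis using k by (simp add: val_ge_def)
qed simp

text \<open>
  The Eisenstein equation.  Expanding \<open>x\<^sup>n\<close> in lower powers of \<open>x\<close> gives coefficients of value at
  least \<open>n\<close>, with equality for the constant one.  The image \<open>y\<close> of \<open>x\<close> satisfies the same
  equation.  If \<open>w(y) \<le> 0\<close>, the term \<open>y\<^sup>n\<close> would have smaller value than all the others; so \<open>w(y) > 0\<close>, the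
  constant term dominates, and \<open>n w(y) = n\<close>.
\<close>

lemma val_hom_uniformizer:
  assumes F: "subfield F \<Omega>" "F \<subseteq> N" and dim: "amb.dimension n F N" and n: "n > 0"
    and dv: "\<And>c. c \<in> F \<Longrightarrow> c \<noteq> 0 \<Longrightarrow> int n dvd w c"
    and x: "x \<in> N" "x \<noteq> 0" "w x = 1" and \<sigma>: "fixing_hom F N \<sigma>"
  shows "w (\<sigma> x) = 1"
proof -
  note hom = fixing_hom_in[OF \<sigma> F(1) N F(2)] fixing_hom_fix[OF \<sigma> F(1) N F(2)] fixing_hom_mult[OF \<sigma> F(1) N F(2)]
    fixing_hom_power[OF \<sigma> F(1) N F(2)] fixing_hom_sum[OF \<sigma> F(1) N F(2)] fixing_hom_nonzero[OF \<sigma> F(1) N F(2)]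
  have ind: "val_indep F n (\<lambda>m. x ^ m)" by (rule val_indep_uniformizer) (use assms in auto)
  obtain c where c: "\<And>m. m < n \<Longrightarrow> c m \<in> F" "x ^ n = (\<Sum>m<n. c m * x ^ m)"
    "\<And>a. val_ge w (x ^ n) a \<longleftrightarrow> (\<forall>m<n. val_ge w (c m * x ^ m) a)"
    using uniformizer_basis[OF F dim dv x subfield_power[OF N x(1), of n]] by blast
  have cN: "c m \<in> N" if "m < n" for m using c(1) F(2) that by auto
  have wxn: "w (x ^ n) = int n" using x by (simp add: val_power)
  have ge: "val_ge w (c m) (int n)" if m: "m < n" for m
  proof (cases "c m = 0")
    case False
    have "val_ge w (c m * x ^ m) (int n)" using c(3)[of "int n"] wxn m by (auto simp: val_ge_def)
    hence "int n \<le> w (c m) + int m" using False x cN[OF m] N by (simp add: val_ge_def val_mult val_power)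
    moreover obtain k where k: "w (c m) = int n * k" using dv[OF c(1)[OF m] False] by auto
    ultimately have "0 < int n * k" using m by simp
    hence "k \<ge> 1" by (simp add: zero_less_mult_iff)
    hence "int n * 1 \<le> int n * k" by (intro mult_left_mono) auto
    thus ?thesis using k by (simp add: val_ge_def)
  qed simp
  have c0: "c 0 \<noteq> 0" "w (c 0) = int n"
  proof -
    have "\<exists>m0<n. c m0 \<noteq> 0"
    proof (rule ccontr)
      assume "\<not> ?thesis"
      hence "x ^ n = 0" unfolding c(2) by (intro sum.neutral) auto
      thus False using x(2) by simp
    qed
    then obtain m0 where m0: "m0 < n" "c m0 \<noteq> 0" by auto
    obtain m where m: "m < n" "c m \<noteq> 0" "w (\<Sum>m<n. c m * x ^ m) = w (c m) + w (x ^ m)"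
      using val_indep_sum[OF F(2) ind, of c m0] c(1) m0 by blast
    have eq: "int n = w (c m) + int m" using m(3) wxn c(2) x by (simp add: val_power)
    have "int n \<le> w (c m)" using ge[OF m(1)] m(2) by (simp add: val_ge_def)
    hence "m = 0" using eq by simp
    thus "c 0 \<noteq> 0" "w (c 0) = int n" using eq m(2) by auto
  qed
  define y where "y = \<sigma> x"
  have y: "y \<in> N" "y \<noteq> 0" using hom x by (auto simp: y_def)
  have "\<sigma> (x ^ n) = (\<Sum>m<n. \<sigma> (c m * x ^ m))" unfolding c(2) by (rule hom(5)) (use cN x N in auto)
  also have "\<dots> = (\<Sum>m<n. c m * y ^ m)"
    by (rule sum.cong) (use cN x N c(1) hom(2,3,4) in \<open>auto simp: y_def\<close>)
  finally have eq: "y ^ n = (\<Sum>m<n. c m * y ^ m)" using hom(4)[OF x(1)] by (simp add: y_def)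
  have wy: "w (y ^ n) = int n * w y" using y by (simp add: val_power)
  have "w y > 0"
  proof (rule ccontr)
    assume "\<not> w y > 0"
    hence le: "w y \<le> 0" by simp
    have "val_ge w (y ^ n) (int n + (int n - 1) * w y)" unfolding eq
    proof (rule val_ge_sum)
      fix m assume m: "m \<in> {..<n}"
      have "val_ge w (c m * y ^ m) (int n + int m * w y)"
        by (rule val_ge_mult) (use cN ge m y N in \<open>auto simp: val_ge_def val_power\<close>)
      moreover have "(int n - 1) * w y \<le> int m * w y" using m le by (intro mult_right_mono_neg) auto
      ultimately show "val_ge w (c m * y ^ m) (int n + (int n - 1) * w y)"
        by (elim val_ge_mono) simp
    qed (use cN y N in auto)
    hence "int n + (int n - 1) * w y \<le> int n * w y" using y wy by (simp add: val_ge_def)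
    thus False using le n by (simp add: algebra_simps)
  qed
  have "y ^ n = c 0 + (\<Sum>m\<in>{..<n} - {0}. c m * y ^ m)"
    unfolding eq using n by (subst sum.remove[of _ 0]) auto
  moreover have "val_ge w (\<Sum>m\<in>{..<n} - {0}. c m * y ^ m) (w (c 0) + 1)"
  proof (rule val_ge_sum)
    fix m assume m: "m \<in> {..<n} - {0}"
    have "val_ge w (c m * y ^ m) (int n + int m * w y)"
      by (rule val_ge_mult) (use cN ge m y N in \<open>auto simp: val_ge_def val_power\<close>)
    moreover have "1 * 1 \<le> int m * w y" using m \<open>w y > 0\<close> by (intro mult_mono) auto
    ultimately show "val_ge w (c m * y ^ m) (w (c 0) + 1)" 
      by (elim val_ge_mono) (use c0 in simp)
  qed (use cN y N in auto)
  moreover have "(\<Sum>m\<in>{..<n} - {0}. c m * y ^ m) \<in> N"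
    by (rule subfield_sum[OF N]) (use cN y N in auto)
  ultimately have "w (y ^ n) = int n" using val_add_eq(2)[of "c 0"] c0 cN[OF n] by auto
  thus ?thesis using wy n by (simp add: y_def)
qed

text \<open>
  The expansion of \<open>z\<close> in powers of \<open>x\<close> and that of its image in powers of the image of \<open>x\<close> have the same
  coefficients, and both uniformizers have value \<open>1\<close>.
\<close>

lemma val_hom_invariant:
  assumes F: "subfield F \<Omega>" "F \<subseteq> N" and dim: "amb.dimension n F N" and n: "n > 0"
    and dv: "\<And>c. c \<in> F \<Longrightarrow> c \<noteq> 0 \<Longrightarrow> int n dvd w c"
    and x: "x \<in> N" "x \<noteq> 0" "w x = 1" and \<sigma>: "fixing_hom F N \<sigma>"
    and z: "z \<in> N" "z \<noteq> 0"
  shows "w (\<sigma> z) = w z"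
proof (rule val_eqI)
  note hom = fixing_hom_in[OF \<sigma> F(1) N F(2)] fixing_hom_fix[OF \<sigma> F(1) N F(2)] fixing_hom_mult[OF \<sigma> F(1) N F(2)]
    fixing_hom_power[OF \<sigma> F(1) N F(2)] fixing_hom_sum[OF \<sigma> F(1) N F(2)] fixing_hom_nonzero[OF \<sigma> F(1) N F(2)]
  have y: "\<sigma> x \<in> N" "\<sigma> x \<noteq> 0" "w (\<sigma> x) = 1"
    using hom x val_hom_uniformizer[OF F dim n dv x \<sigma>] by auto
  have ind: "val_indep F n (\<lambda>m. \<sigma> x ^ m)" by (rule val_indep_uniformizer) (use assms y in auto)
  obtain c where c: "\<And>m. m < n \<Longrightarrow> c m \<in> F" "z = (\<Sum>m<n. c m * x ^ m)"
    "\<And>a. val_ge w z a \<longleftrightarrow> (\<forall>m<n. val_ge w (c m * x ^ m) a)"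
    using uniformizer_basis[OF F dim dv x z(1)] by blast
  have cN: "c m \<in> N" if "m < n" for m using c(1) F(2) that by auto
  have "\<sigma> z = (\<Sum>m<n. \<sigma> (c m * x ^ m))" unfolding c(2) by (rule hom(5)) (use cN x N in auto)
  also have "\<dots> = (\<Sum>m<n. c m * \<sigma> x ^ m)"
    by (rule sum.cong) (use cN x N c(1) hom(2,3,4) in auto)
  finally have sz: "\<sigma> z = (\<Sum>m<n. c m * \<sigma> x ^ m)" .
  show "\<sigma> z \<noteq> 0" using hom z by auto
  show "z \<noteq> 0" by fact
  show "val_ge w (\<sigma> z) a \<longleftrightarrow> val_ge w z a" for a
  proof -
    have "val_ge w (c m * \<sigma> x ^ m) a \<longleftrightarrow> val_ge w (c m * x ^ m) a" if m: "m < n" for m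
    proof -
    have "w (c m * \<sigma> x ^ m) = w (c m * x ^ m)" if "c m \<noteq> 0"
      using that cN[OF m] x y N by (simp add: val_mult val_power)
    thus "val_ge w (c m * \<sigma> x ^ m) a \<longleftrightarrow> val_ge w (c m * x ^ m) a"
      using x y by (cases "c m = 0") (auto simp: val_ge_def)
    qed
    thus ?thesis using val_indep_ge_iff[OF F(2) ind, of c a] c(1,3) sz by auto
  qed
qed

end

section \<open>Ramified Artin--Schrier extensions\<close>

text \<open>
  Relative to \<open>d\<close>, the values of \<open>F\<close> are divisible by \<open>p\<close> while that of \<open>\<theta>\<close> is prime to \<open>p\<close>.  The factor
  \<open>d\<close> leaves room for further ramification of \<open>N\<close> over \<open>F(\<theta>)\<close>.
\<close>

locale ramified_artin_schrier = valued_field N w + artin_schrier F \<theta> p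
  for N :: "'a::field set" and w :: "'a \<Rightarrow> int" and F :: "'a set" and \<theta> :: 'a and p :: nat +
  fixes d :: int and n :: int
  assumes F_sub: "F \<subseteq> N" and theta_N: "\<theta> \<in> N"
    and d: "d > 0" and n: "n > 0" "\<not> int p dvd n"
    and dvd_F: "c \<in> F \<Longrightarrow> c \<noteq> 0 \<Longrightarrow> int p * d dvd w c"
    and val_theta: "w \<theta> = - (d * n)"
begin

lemma E_sub: "E \<subseteq> N"
  by (rule E_least) (use N F_sub theta_N in auto)

lemma theta_nz: "\<theta> \<noteq> 0" using notin F by auto

lemma p_dvd_mult_n: "int p dvd k * n \<longleftrightarrow> int p dvd k"
  using n prime by (metis prime_dvd_mult_iff prime_int_nat_transfer dvd_mult2 prime_nat_int_transfer)

lemma bezout: obtains A m where "int p * A - int m * n = 1" "m \<noteq> 0" "m < p"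
proof -
  have "coprime n (int p)" using n(2) prime
    by (metis coprime_commute prime_imp_coprime_int prime_nat_int_transfer)
  then obtain u where u: "[n * u = 1] (mod int p)" using cong_solve_coprime_int by blast
  define m where "m = nat ((- u) mod int p)"
  have mi: "int m = (- u) mod int p" using p2 by (simp add: m_def)
  have mp: "m < p" using mi p2 by (metis of_nat_less_iff pos_mod_bound of_nat_0_less_iff less_le_trans zero_less_numeral)
  have "[int m * n = - 1] (mod int p)"
  proof -
    have "[int m * n = (- u) * n] (mod int p)" unfolding mi by (intro cong_mult) (auto simp: cong_def)
    also have "[(- u) * n = - 1] (mod int p)" using u by (metis cong_minus_minus_iff mult.commute mult_minus_left)
    finally show ?thesis .
  qed
  hence "int p dvd int m * n + 1" by (simp add: cong_iff_dvd_diff)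
  then obtain A where "int m * n + 1 = int p * A" by (auto simp: dvd_def)
  hence A: "int p * A - int m * n = 1" by simp
  have m0: "m \<noteq> 0"
  proof
    assume "m = 0"
    hence "int p * A = 1" using A by simp
    hence "int p dvd 1" by (metis dvd_triv_left)
    thus False using p2 by simp
  qed
  show thesis using that A m0 mp by blast
qed

lemma val_theta_power: "w (\<theta> ^ m) = - (int m * d * n)"
  using val_power[OF theta_N theta_nz, of m] val_theta by (simp add: algebra_simps)

lemma val_indep_theta: "val_indep F p (\<lambda>m. \<theta> ^ m)"
  unfolding val_indep_def
proof (intro conjI allI impI ballI)
  fix m m' c c' assume m: "m < p" "m' < p" "m \<noteq> m'" and c: "c \<in> F - {0}" "c' \<in> F - {0}"
  show "w c + w (\<theta> ^ m) \<noteq> w c' + w (\<theta> ^ m')"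
  proof
    assume "w c + w (\<theta> ^ m) = w c' + w (\<theta> ^ m')"
    hence "d * ((int m - int m') * n) = w c - w c'" by (simp add: val_theta_power algebra_simps)
    hence "d * int p dvd d * ((int m - int m') * n)" using dvd_F c by (simp add: dvd_diff mult.commute)
    hence "int p dvd int m - int m'" using d by (simp add: p_dvd_mult_n)
    thus False using m dvd_diff_small by blast
  qed
qed (use theta_N theta_nz N in auto)

lemma theta_basis:
  assumes "z \<in> E"
  shows "\<exists>c. (\<forall>m. c m \<in> F) \<and> z = (\<Sum>m<p. c m * \<theta> ^ m) \<and>
    (\<forall>a. val_ge w z a \<longleftrightarrow> (\<forall>m<p. val_ge w (c m * \<theta> ^ m) a))"
proof -
  obtain c where c: "\<And>m. c m \<in> F" "z = (\<Sum>m<p. c m * \<theta> ^ m)" using power_basis[OF assms] by blast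
  show ?thesis using val_indep_ge_iff[OF F_sub val_indep_theta c(1)] c by (intro exI[of _ c]) simp
qed

lemma dvd_E: assumes "z \<in> E" "z \<noteq> 0" shows "d dvd w z"
proof -
  obtain c where c: "\<And>m. c m \<in> F" "z = (\<Sum>m<p. c m * \<theta> ^ m)" using power_basis[OF assms(1)] by blast
  have "\<exists>m0<p. c m0 \<noteq> 0"
  proof (rule ccontr)
    assume "\<not> ?thesis"
    hence "z = 0" unfolding c(2) by (intro sum.neutral) auto
    thus False using assms(2) by simp
  qed
  then obtain m0 where m0: "m0 < p" "c m0 \<noteq> 0" by auto
  obtain m where m: "m < p" "c m \<noteq> 0" "w (\<Sum>m<p. c m * \<theta> ^ m) = w (c m) + w (\<theta> ^ m)"
    using val_indep_sum[OF F_sub val_indep_theta, of c m0] c(1) m0 by blast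
  have "d dvd w (c m)" using dvd_F[OF c(1) m(2)] by (metis dvd_mult_right)
  thus ?thesis using m(3) c(2) by (simp add: val_theta_power)
qed

text \<open>
  The value of the term is a multiple of \<open>d\<close>, and it is nonzero because \<open>p\<close> does not divide \<open>m n\<close>.
\<close>

lemma nonconstant_term:
  assumes c: "c \<in> F" "c \<noteq> 0" and m: "0 < m" "m < p" and ge: "val_ge w (c * \<theta> ^ m) 0"
  shows "d \<le> w c - int m * d * n"
proof -
  have "0 \<le> w c - int m * d * n"
    using ge c theta_nz theta_N N F_sub by (auto simp: val_ge_def val_mult val_theta_power subset_iff)
  moreover have dv: "d dvd w c - int m * d * n" using dvd_F[OF c] by (auto dest: dvd_mult_right)
  moreover have "w c - int m * d * n \<noteq> 0"
  proof
    assume "w c - int m * d * n = 0"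
    hence "d * int p dvd d * (int m * n)" using dvd_F[OF c] by (simp add: mult.commute mult.left_commute)
    hence "int p dvd int m" using d by (simp add: p_dvd_mult_n)
    thus False using m by (auto dest: zdvd_imp_le)
  qed
  ultimately show ?thesis using zdvd_imp_le by force
qed

lemma uniformizer_E:
  assumes \<pi>: "\<pi> \<in> F" "\<pi> \<noteq> 0" "w \<pi> = int p * d"
    and A: "int p * A - int m * n = 1"
  shows "\<pi> powi A * \<theta> ^ m \<in> E" "\<pi> powi A * \<theta> ^ m \<noteq> 0" "w (\<pi> powi A * \<theta> ^ m) = d"
proof -
  have \<pi>N: "\<pi> \<in> N" using \<pi> F_sub by auto
  show "\<pi> powi A * \<theta> ^ m \<in> E" using \<pi> F_subset gen_in E_subfield by auto
  show "\<pi> powi A * \<theta> ^ m \<noteq> 0" using \<pi> theta_nz by (simp add: power_int_eq_0_iff)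
  have "w (\<pi> powi A * \<theta> ^ m) = A * (int p * d) - int m * d * n"
    using \<pi> \<pi>N theta_N theta_nz N by (simp add: val_mult val_power_int val_theta_power power_int_eq_0_iff)
  also have "\<dots> = d * (int p * A - int m * n)" by (simp add: algebra_simps)
  finally show "w (\<pi> powi A * \<theta> ^ m) = d" using A by simp
qed

context
  fixes b \<sigma> assumes b: "b \<in> prime_field" and \<sigma>: "fixing_hom F N \<sigma>" and s\<theta>: "\<sigma> \<theta> = \<theta> + b"
begin

lemma b_N: "b \<in> N" using b N by auto
lemma val_b: "val_ge w b 0" by (rule val_ge_prime_field[OF CHAR prime b])

lemma val_ratio: "val_ge w (b / \<theta>) 1"
proof (cases "b = 0")
  case False
  have "0 < d * n" using d n by simp
  thus ?thesis using val_prime_field[OF CHAR prime b False] False b_N theta_N theta_nz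
    by (simp add: val_ge_def val_divide val_theta)
qed simp

lemma shifted_power:
  "(\<theta> + b) ^ m - \<theta> ^ m = b * \<theta> powi (int m - 1) * (\<Sum>i<m. (1 + b / \<theta>) ^ i)"
proof -
  have eq: "\<theta> + b = \<theta> * (1 + b / \<theta>)" using theta_nz by (simp add: field_simps)
  have "(\<theta> + b) ^ m - \<theta> ^ m = b * (\<Sum>i<m. \<theta> ^ (m - Suc i) * (\<theta> + b) ^ i)"
    using power_diff_sumr2[of "\<theta> + b" m \<theta>] by simp
  also have "(\<Sum>i<m. \<theta> ^ (m - Suc i) * (\<theta> + b) ^ i) = (\<Sum>i<m. \<theta> powi (int m - 1) * (1 + b / \<theta>) ^ i)"
  proof (rule sum.cong[OF refl])
    fix i assume i: "i \<in> {..<m}"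
    have "\<theta> ^ (m - Suc i) * \<theta> ^ i = \<theta> ^ (m - 1)" using i by (simp flip: power_add)
    also have "\<dots> = \<theta> powi (int m - 1)" using i by (simp add: power_int_def nat_diff_distrib)
    finally show "\<theta> ^ (m - Suc i) * (\<theta> + b) ^ i = \<theta> powi (int m - 1) * (1 + b / \<theta>) ^ i"
      unfolding eq by (simp add: power_mult_distrib flip: mult.assoc)
  qed
  finally show ?thesis by (simp add: sum_distrib_left mult.assoc)
qed

lemma unit_N: "1 + b / \<theta> \<in> N" using b_N theta_N N by simp
lemma val_unit: "val_ge w ((1 + b / \<theta>) ^ i) 0"
proof -
  have "val_ge w (b / \<theta>) 0" using val_ratio by (rule val_ge_mono) simp
  hence "val_ge w (1 + b / \<theta>) 0" using b_N theta_N N by (intro val_ge_add) (auto simp: val_ge_def)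
  thus ?thesis using val_ge_power[OF unit_N, of 0 i] by simp
qed

text \<open>
  Replacing \<open>\<theta>\<close> by \<open>\<theta> + b = \<theta>(1 + b/\<theta>)\<close> changes a term \<open>c \<theta>\<^sup>m\<close> by \<open>b/\<theta>\<close>, of value at least \<open>d n\<close>, times an
  element of at least the value of the term.  By \<open>nonconstant_term\<close> the latter is at least \<open>d\<close>.
\<close>

lemma val_hom_diff:
  assumes z: "z \<in> E" and ge: "val_ge w z 0" shows "val_ge w (\<sigma> z - z) (d * (n + 1))"
proof -
  note hom = fixing_hom_in[OF \<sigma> F N F_sub] fixing_hom_fix[OF \<sigma> F N F_sub] fixing_hom_mult[OF \<sigma> F N F_sub]
    fixing_hom_power[OF \<sigma> F N F_sub] fixing_hom_sum[OF \<sigma> F N F_sub]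
  obtain c where c: "\<And>m. c m \<in> F" "z = (\<Sum>m<p. c m * \<theta> ^ m)"
    "\<And>a. val_ge w z a \<longleftrightarrow> (\<forall>m<p. val_ge w (c m * \<theta> ^ m) a)" using theta_basis[OF z] by blast
  have cN: "c m \<in> N" for m using c(1) F_sub by auto
  have "\<sigma> z = (\<Sum>m<p. \<sigma> (c m * \<theta> ^ m))" unfolding c(2) by (rule hom(5)) (use cN theta_N N in auto)
  also have "\<dots> = (\<Sum>m<p. c m * (\<theta> + b) ^ m)"
    by (rule sum.cong) (use cN theta_N N c(1) hom(2,3,4) s\<theta> in auto)
  finally have "\<sigma> z - z = (\<Sum>m<p. c m * ((\<theta> + b) ^ m - \<theta> ^ m))"
    by (simp add: c(2) sum_subtractf algebra_simps)
  also have "val_ge w \<dots> (d * (n + 1))"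
  proof (rule val_ge_sum)
    fix m assume m: "m \<in> {..<p}"
    show "c m * ((\<theta> + b) ^ m - \<theta> ^ m) \<in> N" using cN b_N theta_N N by simp
    show "val_ge w (c m * ((\<theta> + b) ^ m - \<theta> ^ m)) (d * (n + 1))"
    proof (cases "m = 0 \<or> c m = 0")
      case False
      have k: "d \<le> w (c m) - int m * d * n"
        using nonconstant_term[OF c(1), of m m] False m c(3)[of 0] ge by auto
      have "val_ge w (b * \<theta> powi (int m - 1)) (0 + (int m - 1) * w \<theta>)"
        by (intro val_ge_mult val_b) (use b_N theta_N theta_nz N in \<open>auto simp: val_ge_def val_power_int\<close>)
      moreover have "val_ge w (\<Sum>i<m. (1 + b / \<theta>) ^ i) 0"
        using unit_N val_unit N by (intro val_ge_sum) auto
      ultimately have "val_ge w (b * \<theta> powi (int m - 1) * (\<Sum>i<m. (1 + b / \<theta>) ^ i)) (0 + (int m - 1) * w \<theta> + 0)"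
        by (rule val_ge_mult[rotated 2]) (use b_N theta_N N unit_N in auto)
      hence "val_ge w ((\<theta> + b) ^ m - \<theta> ^ m) ((int m - 1) * w \<theta>)" by (simp add: shifted_power)
      hence "val_ge w (c m * ((\<theta> + b) ^ m - \<theta> ^ m)) (w (c m) + (int m - 1) * w \<theta>)"
        by (intro val_ge_mult) (use b_N theta_N N cN in \<open>auto simp: val_ge_def\<close>)
      thus ?thesis by (rule val_ge_mono) (use k in \<open>simp add: val_theta algebra_simps\<close>)
    qed auto
  qed
  finally show ?thesis .
qed

text \<open>
  The bound of \<open>val_hom_diff\<close> is attained by \<open>y = \<pi>\<^sup>A \<theta>\<^sup>m\<close> with \<open>0 < m < p\<close>: its change is a product with the
  factor \<open>S\<close>, a sum of \<open>m\<close> powers of \<open>1 + b/\<theta>\<close>, and \<open>S\<close> is a unit since it is congruent to \<open>m\<close>.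
\<close>

lemma uniformizer_hom_diff:
  assumes "b \<noteq> 0" and \<pi>: "\<pi> \<in> F" "\<pi> \<noteq> 0" "w \<pi> = int p * d"
  obtains y where "y \<in> E" "y \<noteq> 0" "w y = d" "\<sigma> y - y \<noteq> 0" "w (\<sigma> y - y) = d * (n + 1)"
proof -
  note hom = fixing_hom_in[OF \<sigma> F N F_sub] fixing_hom_fix[OF \<sigma> F N F_sub] fixing_hom_mult[OF \<sigma> F N F_sub]
    fixing_hom_power[OF \<sigma> F N F_sub] fixing_hom_sum[OF \<sigma> F N F_sub]
  obtain A m where A: "int p * A - int m * n = 1" and m0: "m \<noteq> 0" and mp: "m < p" by (rule bezout)
  have \<pi>N: "\<pi> \<in> N" using \<pi> F_sub by auto
  define y where "y = \<pi> powi A * \<theta> ^ m"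
  have yE: "y \<in> E" and y0: "y \<noteq> 0" and wy: "w y = d"
    unfolding y_def by (rule uniformizer_E[OF \<pi> A])+
  have s: "\<sigma> y = \<pi> powi A * (\<theta> + b) ^ m"
  proof -
    have piA: "\<pi> powi A \<in> F" "\<pi> powi A \<in> N" using \<pi> \<pi>N F N by simp_all
    have "\<sigma> y = \<sigma> (\<pi> powi A) * \<sigma> \<theta> ^ m"
      unfolding y_def using hom(3)[OF piA(2), of "\<theta> ^ m"] hom(4)[OF theta_N, of m] theta_N N by simp
    thus ?thesis using hom(2)[OF piA(1)] s\<theta> by simp
  qed
  define S where "S = (\<Sum>i<m. (1 + b / \<theta>) ^ i)"
  have diff: "\<sigma> y - y = \<pi> powi A * (b * \<theta> powi (int m - 1) * S)"
    unfolding s unfolding y_def S_def shifted_power[symmetric] by (simp add: algebra_simps)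
  have S: "S \<in> N" "S \<noteq> 0" "w S = 0"
  proof -
    show "S \<in> N" unfolding S_def using unit_N N by simp
    have pw: "val_ge w ((1 + b / \<theta>) ^ i - 1) 1" for i
    proof -
      have "(1 + b / \<theta>) ^ i - 1 = (b / \<theta>) * (\<Sum>j<i. (1 + b / \<theta>) ^ j)"
        using power_diff_sumr2[of "1 + b / \<theta>" i 1] by simp
      moreover have "val_ge w ((b / \<theta>) * (\<Sum>j<i. (1 + b / \<theta>) ^ j)) (1 + 0)"
        by (intro val_ge_mult val_ratio val_ge_sum val_unit) (use unit_N b_N theta_N N in auto)
      ultimately show ?thesis by simp
    qed
    have "val_ge w (\<Sum>i<m. (1 + b / \<theta>) ^ i - 1) 1"
      by (rule val_ge_sum) (use pw unit_N N in auto)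
    hence rest: "val_ge w (S - of_nat m) 1" by (simp add: S_def sum_subtractf)
    have mnz: "(of_nat m :: 'a) \<noteq> 0" using of_nat_neq_0_less_CHAR[OF CHAR] m0 mp by auto
    have wm: "w (of_nat m) = 0" by (rule val_prime_field[OF CHAR prime _ mnz]) (auto intro: range_eqI[of _ _ "int m"])
    have "of_nat m + (S - of_nat m) \<noteq> 0" "w (of_nat m + (S - of_nat m)) = w (of_nat m)"
      by (rule val_add_eq; use mnz wm rest N \<open>S \<in> N\<close> in simp)+
    thus "S \<noteq> 0" "w S = 0" using wm by auto
  qed
  have wd: "w (\<sigma> y - y) = d * (n + 1)"
  proof -
    have "w (\<sigma> y - y) = A * (int p * d) + (0 + (int m - 1) * (- (d * n)))"
      unfolding diff using assms(1) val_prime_field[OF CHAR prime b assms(1)] \<pi> \<pi>N theta_N theta_nz N b_N S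
      by (simp add: val_mult val_power_int val_theta power_int_eq_0_iff)
    also have "\<dots> = d * (int p * A - int m * n) + d * n" by (simp add: algebra_simps)
    finally show ?thesis unfolding A by (simp add: algebra_simps)
  qed
  have "\<sigma> y - y \<noteq> 0" unfolding diff using assms(1) \<pi> theta_nz S by (simp add: power_int_eq_0_iff)
  thus thesis using that yE y0 wy wd by blast
qed

end

end

section \<open>Roots of Artin--Schrier equations\<close>

context valued_field
begin

text \<open>
  For \<open>w(\<theta>) < 0\<close> the term \<open>\<theta>\<^sup>p\<close> dominates.
\<close>

lemma val_root_dominant:
  assumes "2 \<le> p" "\<theta> \<in> N" "\<theta> \<noteq> 0" "w \<theta> < 0"
  shows "\<theta> ^ p - \<theta> \<noteq> 0" "w (\<theta> ^ p - \<theta>) = int p * w \<theta>"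
proof -
  have "int p * w \<theta> \<le> 2 * w \<theta>" using assms by (intro mult_right_mono_neg) auto
  hence le: "int p * w \<theta> + 1 \<le> w \<theta>" using assms(4) by linarith
  have "\<theta> ^ p + - \<theta> \<noteq> 0" "w (\<theta> ^ p + - \<theta>) = w (\<theta> ^ p)"
    by (rule val_add_eq; use assms le N in \<open>simp add: val_ge_def val_power\<close>)+
  thus "\<theta> ^ p - \<theta> \<noteq> 0" "w (\<theta> ^ p - \<theta>) = int p * w \<theta>" using assms by (simp_all add: val_power)
qed

lemma val_root_nonneg:
  assumes "2 \<le> p" "\<theta> \<in> N" "val_ge w (\<theta> ^ p - \<theta>) 0" shows "val_ge w \<theta> 0"
proof (rule ccontr)
  assume "\<not> val_ge w \<theta> 0"
  hence neg: "\<theta> \<noteq> 0" "w \<theta> < 0" by (auto simp: val_ge_def)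
  have "int p * w \<theta> < 0" using neg(2) assms(1) by (simp add: mult_less_0_iff)
  thus False using val_root_dominant[OF assms(1,2) neg] assms(3) by (simp add: val_ge_def)
qed

lemma val_root_neg:
  assumes "2 \<le> p" "\<theta> \<in> N" "\<theta> ^ p - \<theta> \<noteq> 0" "w (\<theta> ^ p - \<theta>) < 0"
  shows "int p * w \<theta> = w (\<theta> ^ p - \<theta>)"
proof -
  have \<theta>: "\<theta> \<noteq> 0" using assms by auto
  have "w \<theta> < 0"
  proof (rule ccontr)
    assume "\<not> w \<theta> < 0"
    hence "val_ge w \<theta> 0" by (simp add: val_ge_def)
    hence "val_ge w (\<theta> ^ p - \<theta>) 0" using val_ge_power[OF assms(2), of 0 p] assms(2) N
      by (intro val_ge_diff) simp_all
    thus False using assms by (simp add: val_ge_def)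
  qed
  thus ?thesis using val_root_dominant(2)[OF assms(1,2) \<theta>] by simp
qed

text \<open>
  Since \<open>p w(\<theta>) = - e n\<close> and \<open>n\<close> is prime to \<open>p\<close>, the ramification index \<open>e\<close> is a multiple of \<open>p\<close>.
\<close>

lemma ramified_artin_schrierI:
  assumes AS: "artin_schrier F \<theta> p" and F: "F \<subseteq> N" "\<theta> \<in> N"
    and e: "(e::int) > 0" "\<And>c. c \<in> F \<Longrightarrow> c \<noteq> 0 \<Longrightarrow> w c = e * v c"
    and red: "\<theta> ^ p - \<theta> \<noteq> 0" "v (\<theta> ^ p - \<theta>) = - n" "n > 0" "\<not> int p dvd n"
  shows "\<exists>d>0. e = int p * d \<and> ramified_artin_schrier N w F \<theta> p d n"
proof -
  interpret A: artin_schrier F \<theta> p by fact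
  have "w (\<theta> ^ p - \<theta>) = - (e * n)" using e(2)[OF A.wp red(1)] red(2) by simp
  moreover have "0 < e * n" using e(1) red(3) by simp
  ultimately have pw: "int p * w \<theta> = - (e * n)" using val_root_neg[OF A.p2 F(2) red(1)] by simp
  hence "int p dvd e * n" by (metis dvd_minus_iff dvd_triv_left)
  hence "int p dvd e" using red(4) A.prime
    by (metis prime_dvd_mult_iff prime_int_nat_transfer prime_nat_int_transfer)
  then obtain d where d: "e = int p * d" by (auto simp: dvd_def)
  have "0 < int p * d" using d e(1) by simp
  hence d0: "d > 0" by (simp add: zero_less_mult_iff)
  have th: "w \<theta> = - (d * n)" using pw d A.p2 by (simp add: mult.assoc flip: mult_minus_right)
  have dv: "int p * d dvd w c" if "c \<in> F" "c \<noteq> 0" for c using e(2)[OF that] d by simp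
  have "ramified_artin_schrier N w F \<theta> p d n"
    by (intro ramified_artin_schrier.intro ramified_artin_schrier_axioms.intro valued_field_axioms AS)
      (rule F(1) F(2) d0 red(3) red(4) th | erule (1) dv)+
  thus ?thesis using d d0 by blast
qed

end

section \<open>Extending a discrete valuation\<close>

definition ring_set :: "'a::field set \<Rightarrow> bool"
  where "ring_set R \<longleftrightarrow> 1 \<in> R \<and> (\<forall>x\<in>R. \<forall>y\<in>R. x - y \<in> R \<and> x * y \<in> R)"

context
  fixes R :: "'a::field set"
  assumes R: "ring_set R"
begin

lemma ring_set_one: "1 \<in> R" using R by (auto simp: ring_set_def)
lemma ring_set_diff: "x \<in> R \<Longrightarrow> y \<in> R \<Longrightarrow> x - y \<in> R" using R by (auto simp: ring_set_def)
lemma ring_set_mult: "x \<in> R \<Longrightarrow> y \<in> R \<Longrightarrow> x * y \<in> R" using R by (auto simp: ring_set_def)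
lemma ring_set_zero: "0 \<in> R" using ring_set_diff[OF ring_set_one ring_set_one] by simp
lemma ring_set_uminus: "x \<in> R \<Longrightarrow> - x \<in> R" using ring_set_diff[OF ring_set_zero, of x] by simp
lemma ring_set_add: "x \<in> R \<Longrightarrow> y \<in> R \<Longrightarrow> x + y \<in> R"
  using ring_set_diff[of x "- y"] ring_set_uminus[of y] by simp
lemma ring_set_power: "x \<in> R \<Longrightarrow> x ^ n \<in> R"
  by (induction n) (auto intro: ring_set_one ring_set_mult)
lemma ring_set_sum: "(\<And>i. i \<in> A \<Longrightarrow> c i \<in> R) \<Longrightarrow> sum c A \<in> R"
  by (induction A rule: infinite_finite_induct) (auto intro: ring_set_zero ring_set_add)

lemmas ring_set_closed = ring_set_one ring_set_zero ring_set_diff ring_set_mult ring_set_uminus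
  ring_set_add ring_set_power ring_set_sum

lemma ring_set_adjoin: "ring_set {poly q x | q. poly_over R q}" (is "ring_set ?S")
  and ring_set_adjoin_incl: "R \<subseteq> {poly q x | q. poly_over R q}" "x \<in> {poly q x | q. poly_over R q}"
proof -
  have c: "[:c:] \<in> Collect (poly_over R)" if "c \<in> R" for c
    using that ring_set_zero by (auto simp: poly_over_def coeff_pCons split: nat.splits)
  show "ring_set ?S" unfolding ring_set_def
  proof (intro conjI ballI)
    show "1 \<in> ?S" using c[OF ring_set_one] by (intro CollectI exI[of _ "[:1:]"]) auto
    fix y z assume "y \<in> ?S" "z \<in> ?S"
    then obtain q r where q: "poly_over R q" "y = poly q x" and r: "poly_over R r" "z = poly r x" by auto
    show "y - z \<in> ?S" using q r
      by (intro CollectI exI[of _ "q - r"]) (auto simp: poly_over_def intro: ring_set_diff)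
    show "y * z \<in> ?S" using q r
      by (intro CollectI exI[of _ "q * r"])
        (auto simp: poly_over_def Polynomial.coeff_mult intro!: ring_set_sum ring_set_mult)
  qed
  show "R \<subseteq> ?S" using c by (intro subsetI CollectI exI[of _ "[:_:]"]) auto
  show "x \<in> ?S" using ring_set_one ring_set_zero
    by (intro CollectI exI[of _ "[:0,1:]"]) (auto simp: poly_over_def coeff_pCons split: nat.splits)
qed

end

text \<open>
  Chevalley's extension argument: a subring of \<open>N\<close> that is maximal among those not containing \<open>1/\<pi>\<close> is
  a valuation ring (\<open>valuation_property\<close>).  By maximality, every element \<open>x\<close> outside \<open>R\<close> satisfies
  a relation \<open>1 = \<pi>(a\<^sub>0 + \<dots> + a\<^sub>n x\<^sup>n)\<close> over \<open>R\<close>.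
\<close>

locale maximal_ring =
  fixes N R :: "'a::field set" and \<pi> :: 'a
  assumes N: "subfield N \<Omega>" and R: "ring_set R" and RN: "R \<subseteq> N"
    and pi: "\<pi> \<in> R" "\<pi> \<noteq> 0" "inverse \<pi> \<notin> R"
    and maximal: "ring_set S \<Longrightarrow> R \<subseteq> S \<Longrightarrow> S \<subseteq> N \<Longrightarrow> inverse \<pi> \<notin> S \<Longrightarrow> S = R"
begin

lemma adjoin_N: "x \<in> N \<Longrightarrow> {poly q x | q. poly_over R q} \<subseteq> N"
proof
  fix y assume x: "x \<in> N" and "y \<in> {poly q x | q. poly_over R q}"
  then obtain q where q: "poly_over R q" "y = poly q x" by auto
  have "poly_over N q" using q(1) RN by (auto simp: poly_over_def)
  thus "y \<in> N" using q(2) x poly_over_in[OF N] by simp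
qed

lemma adjoin_inverse_pi:
  assumes "x \<in> N" "x \<notin> R" obtains q where "poly_over R q" "poly q x = inverse \<pi>"
proof -
  let ?S = "{poly q x | q. poly_over R q}"
  have "?S \<noteq> R" using ring_set_adjoin_incl(2)[OF R, of x] assms(2) by blast
  hence "inverse \<pi> \<in> ?S"
    using maximal[OF ring_set_adjoin[OF R] ring_set_adjoin_incl(1)[OF R] adjoin_N[OF assms(1)]] by blast
  then obtain q where "poly_over R q" "inverse \<pi> = poly q x" by blast
  thus thesis using that[of q] by simp
qed

lemma one_minus_power: assumes "b \<in> R" shows "\<exists>b'\<in>R. (1 - \<pi> * b) ^ k = 1 - \<pi> * b'"
proof (induction k)
  case 0 show ?case using ring_set_zero[OF R] by (intro bexI[of _ 0]) auto
next
  case (Suc k)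
  then obtain b' where b': "b' \<in> R" "(1 - \<pi> * b) ^ k = 1 - \<pi> * b'" by auto
  have "(1 - \<pi> * b) ^ Suc k = 1 - \<pi> * (b + b' - \<pi> * b * b')"
    unfolding power_Suc b'(2) by (simp add: algebra_simps)
  moreover have "b + b' - \<pi> * b * b' \<in> R" using assms b' pi by (intro ring_set_closed[OF R])
  ultimately show ?case by blast
qed

text \<open>
  If the inverse of \<open>u = 1 - \<pi> b\<close> were not in \<open>R\<close>, then \<open>1/\<pi>\<close> would be a polynomial of some degree \<open>k\<close> in
  \<open>1/u\<close>.  Multiplication by \<open>u\<^sup>k\<close>, which has the form \<open>1 - \<pi> b'\<close>, puts \<open>1/\<pi>\<close> into \<open>R\<close>.
\<close>

lemma one_minus_unit: assumes b: "b \<in> R" shows "1 - \<pi> * b \<noteq> 0" "inverse (1 - \<pi> * b) \<in> R"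
proof -
  define u where "u = 1 - \<pi> * b"
  have uR: "u \<in> R" using b pi unfolding u_def by (intro ring_set_closed[OF R])
  have u0: "u \<noteq> 0"
  proof
    assume "u = 0"
    hence "inverse \<pi> = b" using pi by (simp add: u_def inverse_eq_divide divide_eq_eq mult.commute)
    thus False using b pi by simp
  qed
  thus "1 - \<pi> * b \<noteq> 0" by (simp add: u_def)
  have "inverse u \<in> R"
  proof (rule ccontr)
    assume "inverse u \<notin> R"
    moreover have "inverse u \<in> N" using uR RN N by auto
    ultimately obtain q where q: "poly_over R q" "poly q (inverse u) = inverse \<pi>"
      using adjoin_inverse_pi by blast
    define k where "k = Polynomial.degree q"
    have "u ^ k * inverse \<pi> = (\<Sum>i\<le>k. Polynomial.coeff q i * (u ^ k * inverse u ^ i))"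
      unfolding q(2)[symmetric] poly_altdef k_def sum_distrib_left by (simp add: algebra_simps)
    also have "\<dots> = (\<Sum>i\<le>k. Polynomial.coeff q i * u ^ (k - i))"
      using u0 by (intro sum.cong) (auto simp: power_diff power_inverse field_class.field_divide_inverse)
    also have "\<dots> \<in> R" using q(1) uR by (intro ring_set_closed[OF R]) (auto simp: poly_over_def)
    finally have k: "u ^ k * inverse \<pi> \<in> R" .
    obtain b' where b': "b' \<in> R" "u ^ k = 1 - \<pi> * b'" using one_minus_power[OF b] unfolding u_def by blast
    have "u ^ k * inverse \<pi> + b' = inverse \<pi>" unfolding b'(2) using pi by (simp add: field_simps)
    thus False using ring_set_add[OF R k b'(1)] pi by simp
  qed
  thus "inverse (1 - \<pi> * b) \<in> R" by (simp add: u_def)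
qed

definition rel :: "'a \<Rightarrow> nat \<Rightarrow> bool"
  where "rel x n \<longleftrightarrow> (\<exists>a. (\<forall>i. a i \<in> R) \<and> \<pi> * (\<Sum>i\<le>n. a i * x ^ i) = 1)"

lemma rel_ex: assumes "x \<in> N" "x \<notin> R" shows "\<exists>n. rel x n"
proof -
  obtain q where "poly_over R q" "poly q x = inverse \<pi>" using adjoin_inverse_pi[OF assms] .
  thus ?thesis using pi unfolding rel_def
    by (intro exI[of _ "Polynomial.degree q"] exI[of _ "Polynomial.coeff q"])
      (auto simp: poly_over_def poly_altdef[symmetric])
qed

lemma rel_0: "\<not> rel x 0"
proof
  assume "rel x 0"
  then obtain a where "a \<in> R" "\<pi> * a = 1" unfolding rel_def by (auto simp: atMost_0)
  hence "inverse \<pi> \<in> R" by (metis inverse_unique)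
  thus False using pi by simp
qed

lemma rel_mono: assumes "rel x m" "m \<le> n" shows "rel x n"
proof -
  obtain a where a: "\<forall>i. a i \<in> R" "\<pi> * (\<Sum>i\<le>m. a i * x ^ i) = 1" using assms(1) by (auto simp: rel_def)
  have "(\<Sum>i\<le>n. (if i \<le> m then a i else 0) * x ^ i) = (\<Sum>i\<le>m. (if i \<le> m then a i else 0) * x ^ i)"
    by (rule sum.mono_neutral_right) (use assms(2) in auto)
  hence "(\<Sum>i\<le>n. (if i \<le> m then a i else 0) * x ^ i) = (\<Sum>i\<le>m. a i * x ^ i)" by simp
  thus ?thesis using a ring_set_zero[OF R] unfolding rel_def
    by (intro exI[of _ "\<lambda>i. if i \<le> m then a i else 0"]) auto
qed

text \<open>
  As \<open>1 - \<pi> b\<^sub>0\<close> is a unit, the relation for \<open>1/x\<close> expresses \<open>x\<close> to the power \<open>n + 1\<close> through lower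
  powers.  Substitution into the relation for \<open>x\<close> removes its top term.
\<close>

lemma rel_reduce: assumes x: "x \<noteq> 0" and rx: "rel x (Suc n)" and ri: "rel (inverse x) (Suc n)" shows "rel x n"
proof -
  obtain a where a: "\<And>i. a i \<in> R" "\<pi> * (\<Sum>i\<le>Suc n. a i * x ^ i) = 1" using rx by (auto simp: rel_def)
  obtain b where b: "\<And>i. b i \<in> R" "\<pi> * (\<Sum>i\<le>Suc n. b i * inverse x ^ i) = 1" using ri by (auto simp: rel_def)
  define u where "u = inverse (1 - \<pi> * b 0)"
  have u: "u \<in> R" "u * (1 - \<pi> * b 0) = 1" using one_minus_unit[OF b(1)[of 0]] by (auto simp: u_def)
  have "1 - \<pi> * b 0 = \<pi> * (\<Sum>i<Suc n. b (Suc i) * inverse x ^ Suc i)"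
    using b(2) by (simp add: sum.atMost_Suc_shift lessThan_Suc_atMost algebra_simps del: sum.atMost_Suc)
  hence "1 = u * \<pi> * (\<Sum>i<Suc n. b (Suc i) * inverse x ^ Suc i)"
    using u(2) by (simp add: mult.assoc)
  hence "x ^ Suc n = (\<Sum>i<Suc n. u * \<pi> * b (Suc i) * (x ^ Suc n * inverse x ^ Suc i))"
  proof -
    assume 1: "1 = u * \<pi> * (\<Sum>i<Suc n. b (Suc i) * inverse x ^ Suc i)"
    have "x ^ Suc n = x ^ Suc n * (u * \<pi> * (\<Sum>i<Suc n. b (Suc i) * inverse x ^ Suc i))"
      by (subst 1[symmetric]) simp
    also have "\<dots> = (\<Sum>i<Suc n. u * \<pi> * b (Suc i) * (x ^ Suc n * inverse x ^ Suc i))"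
      unfolding sum_distrib_left by (intro sum.cong refl) (simp only: ac_simps)
    finally show ?thesis .
  qed
  also have "\<dots> = (\<Sum>i<Suc n. u * \<pi> * b (Suc i) * x ^ (Suc n - Suc i))"
    using x by (intro sum.cong refl) (auto simp: power_diff power_inverse field_class.field_divide_inverse)
  also have "\<dots> = (\<Sum>i<Suc n. u * \<pi> * b (Suc n - i) * x ^ i)"
    by (subst sum.nat_diff_reindex[symmetric]) (intro sum.cong refl, auto)
  finally have top: "x ^ Suc n = (\<Sum>i<Suc n. u * \<pi> * b (Suc n - i) * x ^ i)" .
  define c where "c i = a i + a (Suc n) * (u * \<pi> * b (Suc n - i))" for i
  have "(\<Sum>i\<le>n. c i * x ^ i) = (\<Sum>i\<le>n. a i * x ^ i) + a (Suc n) * x ^ Suc n"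
    unfolding top by (simp add: c_def sum.distrib sum_distrib_left algebra_simps lessThan_Suc_atMost
        del: sum.lessThan_Suc)
  hence "\<pi> * (\<Sum>i\<le>n. c i * x ^ i) = 1" using a(2) by simp
  moreover have "c i \<in> R" for i unfolding c_def using a b u pi by (intro ring_set_closed[OF R])
  ultimately show ?thesis by (auto simp: rel_def)
qed

text \<open>
  Otherwise both \<open>x\<close> and \<open>1/x\<close> have relations of least degree, and the one of smaller degree shortens the
  other.
\<close>

lemma valuation_property: assumes "x \<in> N" "x \<noteq> 0" shows "x \<in> R \<or> inverse x \<in> R"
proof (rule ccontr)
  assume neg: "\<not> ?thesis"
  define n where "n = (LEAST n. rel x n)"
  define m where "m = (LEAST m. rel (inverse x) m)"
  have n: "rel x n" unfolding n_def by (rule LeastI_ex, rule rel_ex) (use assms neg in auto)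
  have m: "rel (inverse x) m" unfolding m_def by (rule LeastI_ex, rule rel_ex) (use assms neg N in auto)
  have nmin: "n \<le> i" if "rel x i" for i unfolding n_def using that by (rule Least_le)
  have mmin: "m \<le> i" if "rel (inverse x) i" for i unfolding m_def using that by (rule Least_le)
  show False
  proof (cases "m \<le> n")
    case True
    obtain i where i: "n = Suc i" using n rel_0 by (cases n) auto
    have "rel x i" using rel_reduce[OF assms(2), of i] n rel_mono[OF m True] i by simp
    thus False using nmin[of i] i by simp
  next
    case False
    obtain i where i: "m = Suc i" using m rel_0 by (cases m) auto
    have "rel (inverse x) i" using rel_reduce[of "inverse x" i] assms m rel_mono[OF n, of m] i False by simp
    thus False using mmin[of i] i by simp
  qed
qed

definition U :: "'a set" where "U = {x \<in> R. x \<noteq> 0 \<and> inverse x \<in> R}"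

lemma U_mult: "x \<in> U \<Longrightarrow> y \<in> U \<Longrightarrow> x * y \<in> U"
  unfolding U_def using ring_set_mult[OF R] by (auto simp: nonzero_inverse_mult_distrib)
lemma U_inverse: "x \<in> U \<Longrightarrow> inverse x \<in> U" by (auto simp: U_def)
lemma U_one: "1 \<in> U" using ring_set_one[OF R] by (auto simp: U_def)
lemma U_power: "x \<in> U \<Longrightarrow> x ^ n \<in> U" by (induction n) (auto simp: U_one U_mult)

lemma nonunit_add:
  assumes "x \<in> R" "y \<in> R" "x \<notin> U" "y \<notin> U" shows "x + y \<notin> U"
proof -
  have *: False if "x \<in> R" "y \<in> R" "x \<notin> U" "x + y \<in> U" "x \<noteq> 0" "y / x \<in> R" for x y
  proof -
    have "inverse x = (1 + y / x) * inverse (x + y)" using that by (simp add: U_def field_simps)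
    also have "\<dots> \<in> R" using that ring_set_closed(1,4,6)[OF R] by (auto simp: U_def)
    finally show False using that by (auto simp: U_def)
  qed
  show ?thesis
  proof
    assume s: "x + y \<in> U"
    have nz: "x \<noteq> 0" "y \<noteq> 0" using s assms by auto
    have "x \<in> N" "y \<in> N" using assms RN by auto
    hence "y / x \<in> N" "y / x \<noteq> 0" using N nz by auto
    hence "y / x \<in> R \<or> x / y \<in> R" using valuation_property[of "y / x"] by simp
    thus False using *[of x y] *[of y x] s assms nz by (auto simp: add.commute)
  qed
qed

lemma nonunit_sum:
  assumes "finite A" "\<And>i. i \<in> A \<Longrightarrow> c i \<in> R \<and> c i \<notin> U" shows "sum c A \<in> R \<and> sum c A \<notin> U"
  using assms
proof (induction A rule: finite_induct)
  case empty thus ?case using ring_set_zero[OF R] by (auto simp: U_def)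
next
  case (insert i A)
  thus ?case using nonunit_add[of "c i" "sum c A"] ring_set_add[OF R] by auto
qed

lemma exists_dividing_all:
  assumes "finite A" "A \<noteq> {}" "\<And>i. i \<in> A \<Longrightarrow> t i \<in> N \<and> t i \<noteq> 0"
  shows "\<exists>i\<in>A. \<forall>j\<in>A. t j / t i \<in> R"
  using assms
proof (induction A rule: finite_ne_induct)
  case (singleton i) thus ?case using ring_set_one[OF R] by auto
next
  case (insert i A)
  then obtain i0 where i0: "i0 \<in> A" "\<forall>j\<in>A. t j / t i0 \<in> R" by auto
  have nz: "t i \<noteq> 0" "t i0 \<noteq> 0" "t i / t i0 \<in> N" using insert.prems i0 N by auto
  show ?case
  proof (cases "t i / t i0 \<in> R")
    case True thus ?thesis using i0 by auto
  next
    case False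
    hence inv: "t i0 / t i \<in> R" using valuation_property[of "t i / t i0"] nz by auto
    have "t j / t i \<in> R" if "j \<in> A" for j
    proof -
      have "t j / t i = (t j / t i0) * (t i0 / t i)" using nz by simp
      thus ?thesis using ring_set_mult[OF R, of "t j / t i0" "t i0 / t i"] i0 that inv by metis
    qed
    thus ?thesis using nz ring_set_one[OF R] by (intro bexI[of _ i]) auto
  qed
qed

text \<open>
  The terms of an algebraic equation of \<open>x\<close> over \<open>K\<close> have sum zero, so two of them agree up to a unit.
  Their quotient is an element of \<open>K\<close> times \<open>x\<^sup>k\<close> with \<open>1 \<le> k \<le> n\<close>, and \<open>n!\<close> is a common multiple of the
  possible \<open>k\<close>.
\<close>

lemma power_in_base:
  assumes K: "subfield K \<Omega>" "K \<subseteq> N" and dim: "amb.dimension n K N" and x: "x \<in> N" "x \<noteq> 0"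
  shows "\<exists>y\<in>K. y \<noteq> 0 \<and> x ^ fact n / y \<in> U"
proof -
  obtain c m0 where c: "\<And>m. m \<le> n \<Longrightarrow> c m \<in> K" "(\<Sum>m\<le>n. c m * x ^ m) = 0" "m0 \<le> n" "c m0 \<noteq> 0"
    using lin_dependent[OF K(1) dim, of "\<lambda>m. x ^ m"] subfield_power[OF N x(1)] by blast
  define A where "A = {m. m \<le> n \<and> c m \<noteq> 0}"
  define t where "t m = c m * x ^ m" for m
  have A: "finite A" "A \<noteq> {}" using c by (auto simp: A_def)
  have t: "t i \<in> N \<and> t i \<noteq> 0" if "i \<in> A" for i
  proof -
    have "c i \<in> N" "c i \<noteq> 0" using that c(1)[of i] K(2) unfolding A_def by blast+
    thus ?thesis using x subfield_mult[OF N _ subfield_power[OF N x(1)]] by (simp add: t_def)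
  qed
  obtain i where i: "i \<in> A" "\<forall>j\<in>A. t j / t i \<in> R" using exists_dividing_all[of A t] A t by blast
  have "(\<Sum>m\<in>A. t m) = 0"
  proof -
    have "(\<Sum>m\<in>A. t m) = (\<Sum>m\<le>n. t m)" by (rule sum.mono_neutral_left) (auto simp: A_def t_def)
    thus ?thesis using c(2) by (simp add: t_def)
  qed
  hence "(\<Sum>m\<in>A. t m / t i) = 0" by (simp flip: sum_divide_distrib)
  hence s: "(\<Sum>m\<in>A - {i}. t m / t i) = - 1"
    using A(1) i t[OF i(1)] by (simp add: sum.remove eq_neg_iff_add_eq_0 add.commute)
  have "\<exists>j\<in>A - {i}. t j / t i \<in> U"
  proof (rule ccontr)
    assume "\<not> ?thesis"
    hence "(\<Sum>m\<in>A - {i}. t m / t i) \<notin> U" using nonunit_sum[of "A - {i}" "\<lambda>m. t m / t i"] A i by auto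
    thus False unfolding s using ring_set_closed(1,5)[OF R] by (auto simp: U_def)
  qed
  then obtain j where j: "j \<in> A" "j \<noteq> i" "t j / t i \<in> U" by auto
  have cc: "c i \<noteq> 0" "c j \<noteq> 0" "c i \<in> K" "c j \<in> K" "i \<le> n" "j \<le> n" using i j c by (auto simp: A_def)
  have "\<exists>k y. 1 \<le> k \<and> k \<le> n \<and> y \<in> K \<and> y \<noteq> 0 \<and> x ^ k / y \<in> U"
  proof (cases "i < j")
    case True
    have "x ^ j = x ^ (j - i) * x ^ i" using True by (simp flip: power_add)
    hence "x ^ (j - i) / (c i / c j) = t j / t i" using x(2) cc(1,2) by (simp add: t_def)
    thus ?thesis using True cc j K by (intro exI[of _ "j - i"] exI[of _ "c i / c j"]) auto
  next
    case False
    have "x ^ i = x ^ (i - j) * x ^ j" using False by (simp flip: power_add)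
    hence "x ^ (i - j) / (c j / c i) = inverse (t j / t i)" using x(2) cc(1,2) by (simp add: t_def)
    thus ?thesis using False cc j K U_inverse[OF j(3)] by (intro exI[of _ "i - j"] exI[of _ "c j / c i"]) auto
  qed
  then obtain k y where k: "1 \<le> k" "k \<le> n" "y \<in> K" "y \<noteq> 0" "x ^ k / y \<in> U" by auto
  obtain r where r: "fact n = k * r" using dvd_fact[OF k(1,2)] by (auto elim: dvdE)
  have "(x ^ k / y) ^ r \<in> U" using k(5) by (rule U_power)
  moreover have "(x ^ k / y) ^ r = x ^ fact n / y ^ r" by (simp add: r power_divide power_mult)
  ultimately show ?thesis using k K by (intro bexI[of _ "y ^ r"]) auto
qed

end

text \<open>
  Zorn's lemma, applied to the subrings of \<open>N\<close> that contain the valuation ring of \<open>K\<close> but not \<open>1/\<pi>\<close>.  No such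
  ring contains an element of \<open>K\<close> of negative value, since it would then contain \<open>1/\<pi>\<close>.
\<close>

lemma exists_maximal_ring:
  assumes K: "discrete_valuation K v" and N: "subfield N \<Omega>" "K \<subseteq> N"
  obtains R \<pi> where "maximal_ring N R \<pi>" "\<pi> \<in> K" "v \<pi> = 1" "R \<inter> K = valuation_ring K v"
proof -
  interpret V: valued_field K v using K by (simp add: discrete_valuation_iff)
  obtain \<pi> where pi: "\<pi> \<in> K" "\<pi> \<noteq> 0" "v \<pi> = 1" using discrete_valuation_uniformizer[OF K] .
  let ?O = "valuation_ring K v"
  have O: "ring_set ?O" unfolding ring_set_def
  proof (intro conjI ballI)
    show "1 \<in> ?O" using V.N by (simp add: valuation_ring_def val_ge_def)
    fix x y assume "x \<in> ?O" "y \<in> ?O"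
    hence xy: "x \<in> K" "y \<in> K" "val_ge v x 0" "val_ge v y 0" by (auto simp: valuation_ring_def)
    show "x - y \<in> ?O" using xy V.N V.val_ge_diff[OF xy] by (simp add: valuation_ring_def)
    show "x * y \<in> ?O" using xy V.N V.val_ge_mult0[OF xy] by (simp add: valuation_ring_def)
  qed
  define \<R> where "\<R> = {R. ring_set R \<and> ?O \<subseteq> R \<and> R \<subseteq> N \<and> inverse \<pi> \<notin> R}"
  have "\<exists>M\<in>\<R>. \<forall>T\<in>\<R>. M \<subseteq> T \<longrightarrow> T = M"
  proof (rule subset_Zorn_nonempty)
    have "inverse \<pi> \<notin> ?O" using pi V.N by (simp add: valuation_ring_def val_ge_def V.val_inverse)
    moreover have "?O \<subseteq> N" using N(2) unfolding valuation_ring_def by blast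
    ultimately have "?O \<in> \<R>" using O by (simp add: \<R>_def)
    thus "\<R> \<noteq> {}" by blast
    fix C assume C: "C \<noteq> {}" "subset.chain \<R> C"
    have "ring_set (\<Union>C)" unfolding ring_set_def
    proof (intro conjI ballI)
      obtain T where "T \<in> C" "T \<in> \<R>" using C by (auto simp: subset.chain_def)
      thus "1 \<in> \<Union>C" by (auto simp: \<R>_def ring_set_def)
      fix x y assume "x \<in> \<Union>C" "y \<in> \<Union>C"
      then obtain T Y where XY: "T \<in> C" "Y \<in> C" "x \<in> T" "y \<in> Y" by auto
      have "T \<subseteq> Y \<or> Y \<subseteq> T" using C(2) XY(1,2) by (auto simp: subset.chain_def)
      then obtain Z where "Z \<in> C" "x \<in> Z" "y \<in> Z" using XY by blast
      moreover have "ring_set Z" using calculation C by (auto simp: subset.chain_def \<R>_def)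
      ultimately show "x - y \<in> \<Union>C" "x * y \<in> \<Union>C" by (auto simp: ring_set_def)
    qed
    moreover have CR: "T \<in> \<R>" if "T \<in> C" for T using C(2) that by (auto simp: subset.chain_def)
    moreover obtain T0 where "T0 \<in> C" using C(1) by auto
    hence "?O \<subseteq> \<Union>C" using CR[of T0] by (auto simp: \<R>_def)
    moreover have "\<Union>C \<subseteq> N" "inverse \<pi> \<notin> \<Union>C" using CR by (auto simp: \<R>_def)
    ultimately show "\<Union>C \<in> \<R>" by (simp add: \<R>_def)
  qed
  then obtain R where R: "R \<in> \<R>" "\<And>T. T \<in> \<R> \<Longrightarrow> R \<subseteq> T \<Longrightarrow> T = R" by auto
  have piR: "\<pi> \<in> R" using R(1) pi by (auto simp: \<R>_def valuation_ring_def val_ge_def subset_iff)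
  have max: "maximal_ring N R \<pi>"
  proof (rule maximal_ring.intro)
    fix S assume "ring_set S" "R \<subseteq> S" "S \<subseteq> N" "inverse \<pi> \<notin> S"
    thus "S = R" using R(1) R(2)[of S] unfolding \<R>_def by blast
  qed (use R(1) piR pi N in \<open>auto simp: \<R>_def\<close>)
  have "R \<inter> K = ?O"
  proof
    show "?O \<subseteq> R \<inter> K" using R(1) by (auto simp: \<R>_def valuation_ring_def)
    show "R \<inter> K \<subseteq> ?O"
    proof
      fix z assume z: "z \<in> R \<inter> K"
      show "z \<in> ?O"
      proof (rule ccontr)
        assume "z \<notin> ?O"
        hence nz: "z \<noteq> 0" "v z < 0" using z by (auto simp: valuation_ring_def val_ge_def)
        have "inverse (z * \<pi>) \<in> ?O" using nz z pi V.N
          by (auto simp: valuation_ring_def val_ge_def V.val_inverse V.val_mult)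
        hence "z * inverse (z * \<pi>) \<in> R" using R(1) z by (auto simp: \<R>_def ring_set_def)
        moreover have "z * inverse (z * \<pi>) = inverse \<pi>" using nz by simp
        ultimately show False using R(1) by (simp only: \<R>_def) blast
      qed
    qed
  qed
  thus thesis using that max pi by blast
qed

text \<open>
  Let \<open>M = n!\<close>.  By \<open>power_in_base\<close>, \<open>x\<^sup>M\<close> is a unit times some \<open>y \<in> K\<close>.  The function \<open>u(x) = v(y)\<close> is a
  valuation that restricts to \<open>M v\<close> on \<open>K\<close>; division by its least positive value normalises it.
\<close>

theorem exists_valuation_extension:
  assumes K: "discrete_valuation K v" and Nf: "subfield N \<Omega>" and KN: "K \<subseteq> N" and dim: "amb.dimension n K N"
  obtains w e where "discrete_valuation N w" "e > 0" "\<And>x. x \<in> K \<Longrightarrow> x \<noteq> 0 \<Longrightarrow> w x = int e * v x"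
proof -
  interpret V: valued_field K v using K by (simp add: discrete_valuation_iff)
  obtain R \<pi> where max: "maximal_ring N R \<pi>" and piK: "\<pi> \<in> K" "v \<pi> = 1" and RK: "R \<inter> K = valuation_ring K v"
    by (rule exists_maximal_ring[OF K Nf KN])
  interpret maximal_ring N R \<pi> by fact
  define M :: nat where "M = fact n"
  have M: "M > 0" by (simp add: M_def)
  have RK_iff: "x \<in> R \<longleftrightarrow> val_ge v x 0" if "x \<in> K" for x
    using RK that unfolding valuation_ring_def by blast
  have UK: "v y = 0" if "y \<in> U" "y \<in> K" for y
  proof -
    have "val_ge v y 0" "val_ge v (inverse y) 0" "y \<noteq> 0"
      using that RK_iff V.N by (simp_all add: U_def)
    thus ?thesis using that by (simp add: val_ge_def V.val_inverse)
  qed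
  define u where "u x = v (SOME y. y \<in> K \<and> y \<noteq> 0 \<and> x ^ M / y \<in> U)" for x
  have u_eq: "u x = v y" if "y \<in> K" "y \<noteq> 0" "x ^ M / y \<in> U" for x y
  proof -
    define z where "z = (SOME y. y \<in> K \<and> y \<noteq> 0 \<and> x ^ M / y \<in> U)"
    have z: "z \<in> K \<and> z \<noteq> 0 \<and> x ^ M / z \<in> U" unfolding z_def by (rule someI[of _ y]) (use that in auto)
    have x: "x ^ M \<noteq> 0" using that by (auto simp: U_def)
    have "y / z = (x ^ M / z) * inverse (x ^ M / y)" using that z x by (simp add: field_simps)
    hence "y / z \<in> U" using U_mult U_inverse that z by metis
    hence "v (y / z) = 0" using UK that z V.N by simp
    thus ?thesis using that z by (simp add: u_def flip: z_def) (simp add: V.val_divide)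
  qed
  have ex: "\<exists>y\<in>K. y \<noteq> 0 \<and> x ^ M / y \<in> U" if "x \<in> N" "x \<noteq> 0" for x
    unfolding M_def by (rule power_in_base[OF V.N KN dim that])
  have u_mult: "u (x * y) = u x + u y" if xy: "x \<in> N" "y \<in> N" "x \<noteq> 0" "y \<noteq> 0" for x y
  proof -
    obtain a b where a: "a \<in> K" "a \<noteq> 0" "x ^ M / a \<in> U" and b: "b \<in> K" "b \<noteq> 0" "y ^ M / b \<in> U"
      using ex xy by blast
    have eq: "(x * y) ^ M / (a * b) = (x ^ M / a) * (y ^ M / b)" by (simp add: power_mult_distrib)
    have "(x * y) ^ M / (a * b) \<in> U" unfolding eq by (rule U_mult[OF a(3) b(3)])
    hence "u (x * y) = v (a * b)" using a b V.N by (intro u_eq) auto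
    thus ?thesis using a b u_eq[OF a] u_eq[OF b] by (simp add: V.val_mult)
  qed
  have u_K: "u x = int M * v x" if "x \<in> K" "x \<noteq> 0" for x
    using u_eq[of "x ^ M" x] that V.N U_one by (simp add: V.val_power)
  have u_R: "0 \<le> u x \<longleftrightarrow> x \<in> R" if x: "x \<in> N" "x \<noteq> 0" for x
  proof -
    obtain a where a: "a \<in> K" "a \<noteq> 0" "x ^ M / a \<in> U" using ex x by blast
    have "0 \<le> u x \<longleftrightarrow> a \<in> R" using u_eq[OF a] RK_iff[OF a(1)] a(2) by (simp add: val_ge_def)
    also have "\<dots> \<longleftrightarrow> x ^ M \<in> R"
    proof
      assume "a \<in> R"
      have "(x ^ M / a) * a \<in> R"
        by (rule ring_set_mult[OF R]) (use \<open>a \<in> R\<close> a(3) in \<open>simp_all add: U_def\<close>)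
      moreover have "(x ^ M / a) * a = x ^ M" using a(2) by simp
      ultimately show "x ^ M \<in> R" by (simp only:)
    next
      assume "x ^ M \<in> R"
      have "inverse (x ^ M / a) \<in> R" using a(3) unfolding U_def by blast
      hence "x ^ M * inverse (x ^ M / a) \<in> R" using \<open>x ^ M \<in> R\<close> by (intro ring_set_mult[OF R])
      moreover have "x ^ M * inverse (x ^ M / a) = a" using a(2) x by simp
      ultimately show "a \<in> R" by (simp only:)
    qed
    also have "\<dots> \<longleftrightarrow> x \<in> R"
    proof
      assume xM: "x ^ M \<in> R"
      show "x \<in> R"
      proof (rule ccontr)
        assume "x \<notin> R"
        hence "inverse x \<in> R" using valuation_property x by blast
        hence "x ^ M * inverse x ^ (M - 1) \<in> R" using xM ring_set_closed(4,7)[OF R] by blast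
        moreover have "x ^ M = x * x ^ (M - 1)" using M by (cases M) auto
        hence "x ^ M * inverse x ^ (M - 1) = x" using x by (simp add: power_inverse)
        ultimately show False using \<open>x \<notin> R\<close> by simp
      qed
    qed (rule ring_set_power[OF R])
    finally show ?thesis .
  qed
  have u_one: "u 1 = 0" using u_K[of 1] V.N by simp
  have u_inverse: "u (inverse x) = - u x" if "x \<in> N" "x \<noteq> 0" for x
    using u_mult[of x "inverse x"] that N u_one by simp
  have u_power: "u (x powi k) = k * u x" if "x \<in> N" "x \<noteq> 0" for x k
  proof -
    have nat: "u (y ^ i) = int i * u y" if "y \<in> N" "y \<noteq> 0" for y i
      by (induction i) (use that u_one u_mult N in \<open>auto simp: algebra_simps\<close>)
    show ?thesis using nat[of x] nat[of "inverse x"] that N u_inverse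
      by (auto simp: power_int_def)
  qed
  have u_add: "min (u x) (u y) \<le> u (x + y)" if xy: "x \<in> N" "y \<in> N" "x \<noteq> 0" "y \<noteq> 0" "x + y \<noteq> 0" for x y
  proof -
    have *: "u x \<le> u (x + y)" if xy: "x \<in> N" "y \<in> N" "x \<noteq> 0" "y \<noteq> 0" "x + y \<noteq> 0" and le: "u x \<le> u y" for x y
    proof -
      have "u (y / x) \<ge> 0" using le xy N u_mult[of y "inverse x"] u_inverse[of x]
        by (simp add: field_class.field_divide_inverse)
      hence "y / x \<in> R" using u_R[of "y / x"] xy N by simp
      hence "1 + y / x \<in> R" using ring_set_closed(1,6)[OF R] by blast
      moreover have eq: "x + y = x * (1 + y / x)" using xy by (simp add: field_simps)
      moreover have "1 + y / x \<noteq> 0" using eq xy by auto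
      ultimately have "0 \<le> u (1 + y / x)" using u_R[of "1 + y / x"] xy N by simp
      moreover have "u (x + y) = u x + u (1 + y / x)"
        by (subst eq, rule u_mult) (use xy N \<open>1 + y / x \<noteq> 0\<close> in auto)
      ultimately show ?thesis by simp
    qed
    show ?thesis using *[of x y] *[of y x] xy by (cases "u x \<le> u y") (auto simp: add.commute)
  qed
  define D where "D d \<longleftrightarrow> d > 0 \<and> (\<exists>x\<in>N. x \<noteq> 0 \<and> u x = int d)" for d
  have DM: "D M" unfolding D_def using M u_K[of \<pi>] piK pi(2) KN V.N V.val_one
    by (intro conjI bexI[of _ \<pi>]) auto
  define d where "d = (LEAST d. D d)"
  have Dd: "D d" unfolding d_def by (rule LeastI[of D M, OF DM])
  then obtain z where z: "z \<in> N" "z \<noteq> 0" "u z = int d" and d: "d > 0" by (auto simp: D_def)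
  have dvd: "int d dvd u x" if x: "x \<in> N" "x \<noteq> 0" for x
  proof (rule ccontr)
    assume "\<not> int d dvd u x"
    hence "u x mod int d \<noteq> 0" by presburger
    hence r: "u x mod int d > 0" using pos_mod_sign[of "int d" "u x"] d by linarith
    define y where "y = x * z powi (- (u x div int d))"
    have "u y = u x + - (u x div int d) * int d"
    proof -
      have zp: "z powi k \<in> N" "z powi k \<noteq> 0" for k
        using z N by (simp_all add: power_int_eq_0_iff)
      show ?thesis unfolding y_def u_mult[OF x(1) zp(1) x(2) zp(2)] u_power[OF z(1,2)] z(3) ..
    qed
    also have "\<dots> = u x mod int d" by (simp add: minus_div_mult_eq_mod)
    finally have uy: "u y = u x mod int d" .
    have y: "y \<in> N" "y \<noteq> 0" using x z N by (auto simp: y_def power_int_eq_0_iff)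
    have "D (nat (u x mod int d))" using r y uy by (auto simp: D_def)
    hence "d \<le> nat (u x mod int d)" unfolding d_def by (rule Least_le)
    moreover have "nat (u x mod int d) < d" using d r by (simp add: nat_less_iff)
    ultimately show False by simp
  qed
  define w where "w x = u x div int d" for x
  have uw: "u x = int d * w x" if "x \<in> N" "x \<noteq> 0" for x using dvd[OF that] by (simp add: w_def)
  have "int d dvd int M" using dvd[OF subsetD[OF KN piK(1)] pi(2)] u_K[OF piK(1) pi(2)] piK(2) by simp
  then obtain e where e: "int M = int d * e" unfolding dvd_def by blast
  have e0: "e > 0" using e M d by (metis of_nat_0_less_iff zero_less_mult_pos)
  have "discrete_valuation N w" unfolding discrete_valuation_def
  proof (intro conjI ballI)
    show "subfield N \<Omega>" by (rule N)
    fix x y assume "x \<in> N - {0}" "y \<in> N - {0}"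
    hence xy: "x \<in> N" "x \<noteq> 0" "y \<in> N" "y \<noteq> 0" by auto
    show "w (x * y) = w x + w y"
    proof -
      have "int d * w (x * y) = int d * (w x + w y)"
        using u_mult[of x y] xy uw[of x] uw[of y] uw[of "x * y"] N by (simp add: distrib_left)
      thus ?thesis using d by simp
    qed
    show "val_ge w (x + y) (min (w x) (w y))"
    proof (cases "x + y = 0")
      case False
      have "min (int d * w x) (int d * w y) \<le> int d * w (x + y)"
        using u_add[of x y] xy False uw[of x] uw[of y] uw[of "x + y"] N by simp
      hence "int d * min (w x) (w y) \<le> int d * w (x + y)" using d by (simp add: min_mult_distrib_left)
      thus ?thesis using d False by (simp add: val_ge_def)
    qed simp
  next
    show "w ` (N - {0}) = UNIV"
    proof (intro equalityI subsetI)
      fix k :: int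
      have "w (z powi k) = k" using u_power[OF z(1,2)] z(3) d by (simp add: w_def)
      moreover have "z powi k \<in> N - {0}" using z N by (auto simp: power_int_eq_0_iff)
      ultimately show "k \<in> w ` (N - {0})" by force
    qed auto
  qed
  moreover have "w x = int (nat e) * v x" if "x \<in> K" "x \<noteq> 0" for x
  proof -
    have "int d * w x = int d * (e * v x)" using u_K[OF that] uw[of x] that KN e by auto
    thus ?thesis using d e0 by simp
  qed
  ultimately show thesis using that[of w "nat e"] e0 by auto
qed

section \<open>Complete fields and the reduction of Artin--Schrier classes\<close>

lemma local_fieldD:
  assumes "local_field K v"
  shows "valued_field K v" "discrete_valuation K v" "subfield K \<Omega>"
  using assms by (auto simp: local_field_def discrete_valuation_iff valued_field_def)

text \<open>
  The negated series of iterated \<open>p\<close>-th powers of \<open>m\<close> converges to a root.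
\<close>

lemma hensel_artin_schrier:
  fixes m :: "'a::field"
  assumes K: "local_field K v" and ch: "CHAR('a) = p" and pr: "Factorial_Ring.prime p"
    and m: "m \<in> K" "val_ge v m 1"
  obtains x where "x \<in> K" "x ^ p - x = m"
proof -
  interpret valued_field K v using K by (rule local_fieldD)
  have p2: "p \<ge> 2" using pr by (rule prime_ge_2_nat)
  have neg: "(- x :: 'a) ^ p = - (x ^ p)" for x using minus_power_prime_CHAR[of p x] ch pr by simp
  define s where "s n = - (\<Sum>r<n. m ^ (p ^ r))" for n :: nat
  have sK: "s n \<in> K" for n unfolding s_def using m N by simp
  have pw: "val_ge v (m ^ (p ^ r)) (int r)" for r
  proof (rule val_ge_mono[OF val_ge_power[OF m(1,2)]])
    have "r < p ^ r" using p2 by (intro power_gt_expt) auto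
    thus "int r \<le> int (p ^ r) * 1" by simp
  qed
  have tail: "val_ge v (s n - s n0) (int n0)" if "n0 \<le> n" for n n0
  proof -
    have "(\<Sum>r<n. m ^ (p ^ r)) = (\<Sum>r<n0. m ^ (p ^ r)) + (\<Sum>r=n0..<n. m ^ (p ^ r))"
      using that sum.atLeastLessThan_concat[of 0 n0 n "\<lambda>r. m ^ (p ^ r)"] by (simp add: lessThan_atLeast0)
    hence "s n0 - s n = (\<Sum>r=n0..<n. m ^ (p ^ r))" by (simp add: s_def)
    moreover have "val_ge v (\<Sum>r=n0..<n. m ^ (p ^ r)) (int n0)"
      by (rule val_ge_sum) (use m N val_ge_mono[OF pw] in auto)
    ultimately show ?thesis using val_ge_diff_swap[OF sK sK] by metis
  qed
  have "val_Cauchy v s" unfolding val_Cauchy_def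
  proof
    fix c :: int
    have "val_ge v (s a - s b) c" if "a \<ge> nat c" "b \<ge> nat c" for a b
    proof -
      have "val_ge v ((s a - s (nat c)) - (s b - s (nat c))) (int (nat c))"
        by (rule val_ge_diff[OF _ _ tail[OF that(1)] tail[OF that(2)]]) (use sK N in simp_all)
      from val_ge_mono[OF this, of c] show ?thesis by simp
    qed
    thus "\<exists>n0. \<forall>m\<ge>n0. \<forall>n\<ge>n0. val_ge v (s m - s n) c" by blast
  qed
  moreover have "range s \<subseteq> K" using sK by auto
  ultimately obtain x where x: "x \<in> K" "val_tendsto v s x" using K unfolding local_field_def by blast
  have wp: "s n ^ p - s n = m - m ^ (p ^ n)" for n
  proof -
    have "s n ^ p = - (\<Sum>r<n. m ^ (p ^ Suc r))"
      using ch pr by (simp add: s_def neg freshmans_dream_sum flip: power_mult) (simp add: mult.commute)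
    moreover have "(\<Sum>r<n. m ^ (p ^ r)) - (\<Sum>r<n. m ^ (p ^ Suc r)) = m - m ^ (p ^ n)"
      using sum_lessThan_telescope'[of "\<lambda>r. m ^ (p ^ r)" n] by (simp add: sum_subtractf)
    ultimately show ?thesis by (simp add: s_def)
  qed
  define y where "y = x ^ p - x - m"
  have yK: "y \<in> K" using x m N by (simp add: y_def)
  have "y = 0"
  proof (rule ccontr)
    assume "y \<noteq> 0"
    define c where "c = max 0 (v y + 1)"
    obtain n0 where n0: "\<forall>n\<ge>n0. val_ge v (s n - x) c" using x(2) unfolding val_tendsto_def by blast
    define n where "n = max n0 (nat c)"
    have d: "val_ge v (s n - x) c" using n0 by (simp add: n_def)
    define z where "z = s n - x"
    have zK: "z \<in> K" using sK x N by (simp add: z_def)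
    have zc: "val_ge v z c" using d by (simp add: z_def)
    have "val_ge v (z ^ p) c"
      by (rule val_ge_mono[OF val_ge_power[OF zK zc]]) (use p2 in \<open>simp add: c_def mult_le_cancel_right1\<close>)
    moreover have "val_ge v (m ^ (p ^ n)) c"
      by (rule val_ge_mono[OF pw]) (simp add: n_def)
    moreover have "y = - (z ^ p) + z - m ^ (p ^ n)"
    proof -
      have "x = s n - z" by (simp add: z_def)
      hence "x ^ p - x = (s n ^ p - s n) - (z ^ p - z)" using artin_schrier_diff[OF ch pr] by simp
      thus ?thesis by (simp add: y_def wp)
    qed
    ultimately have "val_ge v y c" using zK zc m N by (auto intro!: val_ge_diff val_ge_add)
    thus False using \<open>y \<noteq> 0\<close> by (simp add: val_ge_def c_def)
  qed
  thus thesis using that[OF x(1)] by (simp add: y_def)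
qed

lemma coefficient_fieldD:
  assumes k: "coefficient_field K v k" and K: "valued_field K v"
  shows "subfield k \<Omega>" "k \<subseteq> K" "\<And>c. c \<in> k \<Longrightarrow> c \<noteq> 0 \<Longrightarrow> v c = 0"
    "\<And>x. x \<in> K \<Longrightarrow> val_ge v x 0 \<Longrightarrow> \<exists>c\<in>k. val_ge v (x - c) 1"
proof -
  show kf: "subfield k \<Omega>" and kK: "k \<subseteq> K" using k by (auto simp: coefficient_field_def valuation_ring_def)
  interpret valued_field K v by fact
  show "v c = 0" if "c \<in> k" "c \<noteq> 0" for c
  proof -
    have "inverse c \<in> k" using that kf by simp
    moreover have "val_ge v x 0" if "x \<in> k" for x
      using k that unfolding coefficient_field_def valuation_ring_def by blast
    ultimately have "val_ge v c 0" "val_ge v (inverse c) 0" using that by blast+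
    moreover have "c \<in> K" using that kK by auto
    ultimately show ?thesis using that by (simp add: val_ge_def val_inverse)
  qed
  show "\<exists>c\<in>k. val_ge v (x - c) 1" if "x \<in> K" "val_ge v x 0" for x
    using k that unfolding coefficient_field_def valuation_ring_def by blast
qed

text \<open>
  The value of \<open>g\<close> is negative and divisible by \<open>p\<close>, but the residue \<open>c\<close> of \<open>g t\<^sup>p\<close> has no \<open>p\<close>-th root in \<open>k\<close>,
  so that the leading term of \<open>g\<close> cannot be cancelled by any \<open>x\<^sup>p - x\<close>.  A root of \<open>X\<^sup>p - X - g\<close> then generates
  a fiercely ramified extension: the residue field extension is purely inseparable.
\<close>

definition fierce :: "nat \<Rightarrow> 'a::field set \<Rightarrow> ('a \<Rightarrow> int) \<Rightarrow> 'a set \<Rightarrow> 'a \<Rightarrow> bool"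
  where "fierce p F w k g \<longleftrightarrow> (\<exists>t c s. t \<in> F \<and> t \<noteq> 0 \<and> c \<in> k \<and> (\<forall>d\<in>k. d ^ p \<noteq> c) \<and> g \<noteq> 0 \<and>
     w g = - (int p * s) \<and> s > 0 \<and> w t = s \<and> val_ge w (g * t ^ p - c) 1)"

text \<open>
  If the value of \<open>f\<close> is \<open>-ps < 0\<close> and the residue \<open>c\<close> of \<open>f t\<^sup>p\<close> with \<open>w(t) = s\<close> equals \<open>d\<^sup>p\<close>, then the choice
  \<open>x = -d/t\<close> cancels the leading term, and induction on \<open>-w(f)\<close> applies.  An integral \<open>f\<close> is congruent to
  its residue by \<open>hensel_artin_schrier\<close>.  The clause about \<open>b\<close> records that the reduction preserves all
  lower bounds \<open>b \<le> 0\<close> on the value.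
\<close>

lemma artin_schrier_reduction:
  fixes F :: "'a::field set"
  assumes F: "local_field F w" and k: "coefficient_field F w k" and ch: "CHAR('a) = p" and pr: "Factorial_Ring.prime p"
    and f: "f \<in> F"
  shows "\<exists>x\<in>F. (\<forall>b\<le>0. val_ge w f b \<longrightarrow> val_ge w (f + x ^ p - x) b) \<and>
    (f + x ^ p - x \<in> k \<or>
     (reduced_element p w (f + x ^ p - x) \<and> w (f + x ^ p - x) < 0) \<or> fierce p F w k (f + x ^ p - x))"
  using f
proof (induction "nat (- w f)" arbitrary: f rule: less_induct)
  case less
  interpret valued_field F w using F by (rule local_fieldD)
  note kD = coefficient_fieldD[OF k valued_field_axioms]
  have p2: "p \<ge> 2" using pr by (rule prime_ge_2_nat)
  have f: "f \<in> F" by fact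
  have neg: "(- x :: 'a) ^ p = - (x ^ p)" for x using minus_power_prime_CHAR[of p x] ch pr by simp
  consider "val_ge w f 0" | "f \<noteq> 0" "w f < 0" "\<not> int p dvd w f" | "f \<noteq> 0" "w f < 0" "int p dvd w f"
    unfolding val_ge_def using not_less by blast
  thus ?case
  proof cases
    case 1
    obtain c where c: "c \<in> k" "val_ge w (f - c) 1" using kD(4) f 1 by blast
    have cF: "c \<in> F" using c kD by auto
    obtain x where x: "x \<in> F" "x ^ p - x = f - c"
      by (rule hensel_artin_schrier[OF F ch pr _ c(2)]) (use f cF N in auto)
    have eq: "f + (- x) ^ p - (- x) = c" using x by (simp add: neg algebra_simps)
    have "val_ge w c b" if "b \<le> 0" for b using kD(3)[OF c(1)] that by (cases "c = 0") (simp_all add: val_ge_def)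
    hence "(\<forall>b\<le>0. val_ge w f b \<longrightarrow> val_ge w c b) \<and> c \<in> k" using c(1) by blast
    moreover have "- x \<in> F" using x N by simp
    ultimately show ?thesis by (intro bexI[of _ "- x"]) (unfold eq, blast)
  next
    case 2
    have "coprime (w f) (int p)" using 2(3) pr
      by (metis coprime_commute prime_imp_coprime_int prime_nat_int_transfer)
    hence "reduced_element p w f" using 2 by (simp add: reduced_element_def)
    moreover have eq: "f + 0 ^ p - 0 = f" using p2 by simp
    ultimately show ?thesis using 2 N by (intro bexI[of _ 0]) (unfold eq, auto)
  next
    case 3
    then obtain s' where s': "w f = int p * s'" by auto
    define s where "s = - s'"
    have s: "w f = - (int p * s)" "s > 0" using s' 3 p2 by (auto simp: s_def mult_less_0_iff)
    obtain \<pi> where pi: "\<pi> \<in> F" "\<pi> \<noteq> 0" "w \<pi> = 1" using discrete_valuation_uniformizer local_fieldD[OF F] by metis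
    define t where "t = \<pi> powi s"
    have t: "t \<in> F" "t \<noteq> 0" "w t = s" using pi N by (auto simp: t_def val_power_int power_int_eq_0_iff)
    have ftp: "w (f * t ^ p) = 0" using t f 3 N s by (simp add: val_mult val_power)
    hence "val_ge w (f * t ^ p) 0" by (simp add: val_ge_def)
    then obtain c where c: "c \<in> k" "val_ge w (f * t ^ p - c) 1" using kD(4)[of "f * t ^ p"] f t N by auto
    have cF: "c \<in> F" using c kD by auto
    show ?thesis
    proof (cases "\<exists>d\<in>k. d ^ p = c")
      case False
      hence "fierce p F w k f" unfolding fierce_def using t c s 3 by blast
      moreover have eq: "f + 0 ^ p - 0 = f" using p2 by simp
      ultimately show ?thesis using N by (intro bexI[of _ 0]) (unfold eq, auto)
    next
      case True
      then obtain d where d: "d \<in> k" "d ^ p = c" by auto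
      have dF: "d \<in> F" using d kD by auto
      define y where "y = - (d / t)"
      have y: "y \<in> F" using dF t N by (simp add: y_def)
      define f' where "f' = f + y ^ p - y"
      have f': "f' \<in> F" using f y N by (simp add: f'_def)
      have "f' = (f * t ^ p - c) / t ^ p + d / t"
        using t by (simp add: f'_def y_def neg power_divide d field_simps)
      moreover have "val_ge w ((f * t ^ p - c) / t ^ p) (1 - int p * s)"
      proof -
        have "val_ge w ((f * t ^ p - c) * inverse (t ^ p)) (1 + - (int p * s))"
          by (rule val_ge_mult) (use c f cF t N in \<open>auto simp: val_inverse val_power val_ge_def\<close>)
        thus ?thesis by (simp add: field_class.field_divide_inverse)
      qed
      moreover have "val_ge w (d / t) (1 - int p * s)"
      proof (cases "d = 0")
        case False
        have "w (d / t) = - s" using False dF t kD(3) d by (simp add: val_divide)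
        moreover have "2 * s \<le> int p * s" using p2 s(2) by (intro mult_right_mono) auto
        ultimately have "1 - int p * s \<le> w (d / t)" using s(2) by linarith
        thus ?thesis by (simp add: val_ge_def)
      qed simp
      ultimately have ge: "val_ge w f' (1 - int p * s)"
        using f t cF dF N by (auto intro!: val_ge_add)
      have trans: "f' + x ^ p - x = f + (x + y) ^ p - (x + y)" for x
        using artin_schrier_add[OF ch pr, of x y] by (simp add: f'_def algebra_simps)
      have mono: "val_ge w f' b" if "val_ge w f b" for b
        by (rule val_ge_mono[OF ge]) (use that 3(1) s in \<open>simp add: val_ge_def\<close>)
      have "\<exists>x\<in>F. (\<forall>b\<le>0. val_ge w f' b \<longrightarrow> val_ge w (f' + x ^ p - x) b) \<and>
          (f' + x ^ p - x \<in> k \<or>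
           (reduced_element p w (f' + x ^ p - x) \<and> w (f' + x ^ p - x) < 0) \<or> fierce p F w k (f' + x ^ p - x))"
      proof (cases "f' = 0")
        case True
        have eq: "f' + 0 ^ p - 0 = 0" using True p2 by simp
        show ?thesis using N kD(1) by (intro bexI[of _ 0]) (unfold eq, auto)
      next
        case False
        hence "w f' > w f" using ge s by (simp add: val_ge_def)
        hence "nat (- w f') < nat (- w f)" using 3 by simp
        thus ?thesis using less.hyps f' by blast
      qed
      then obtain x where x: "x \<in> F" "\<forall>b\<le>0. val_ge w f' b \<longrightarrow> val_ge w (f' + x ^ p - x) b"
          "f' + x ^ p - x \<in> k \<or>
           (reduced_element p w (f' + x ^ p - x) \<and> w (f' + x ^ p - x) < 0) \<or> fierce p F w k (f' + x ^ p - x)"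
        by blast
      show ?thesis
        by (rule bexI[of _ "x + y"]) (use x y N mono trans in auto)
    qed
  qed
qed

lemma poly_diff_val_ge:
  assumes "valued_field N u" "k \<subseteq> N" "subfield k \<Omega>" "\<And>c. c \<in> k \<Longrightarrow> val_ge u c 0"
    and "poly_over k Q" "a \<in> N" "b \<in> N" "val_ge u a 0" "val_ge u b 0" "val_ge u (a - b) 1"
  shows "val_ge u (poly Q a - poly Q b) 1"
  using assms(5)
proof (induction Q)
  case (pCons c Q)
  interpret valued_field N u by fact
  have Q: "poly_over k Q" "c \<in> k" using pCons assms(3) by auto
  have QN: "poly_over N Q" using Q(1) assms(2) by (auto simp: poly_over_def)
  have int: "val_ge u (poly Q a) 0" using Q(1)
  proof (induction Q)
    case (pCons c Q)
    have c: "c \<in> k" "poly_over k Q" using pCons assms(3) by auto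
    hence "poly_over N Q" "c \<in> N" using assms(2) by (auto simp: poly_over_def)
    thus ?case using pCons c assms N by (auto intro!: val_ge_add val_ge_mult0)
  qed simp
  have "poly (pCons c Q) a - poly (pCons c Q) b = poly Q a * (a - b) + b * (poly Q a - poly Q b)"
    by (simp add: algebra_simps)
  moreover have "val_ge u (poly Q a * (a - b)) 1"
    by (rule val_ge_mult0) (use int assms QN N in auto)
  moreover have "val_ge u (b * (poly Q a - poly Q b)) 1"
    by (rule val_ge_mult0) (use pCons Q assms QN N in auto)
  ultimately show ?case using assms QN N by (auto intro!: val_ge_add)
qed simp

text \<open>
  For \<open>d \<notin> k\<close> the polynomial \<open>X\<^sup>p - d\<^sup>p\<close>, the \<open>p\<close>-th power of \<open>X - d\<close>, is the minimal polynomial of \<open>d\<close> over \<open>k\<close>.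
  So every polynomial over \<open>k\<close> that vanishes at \<open>d\<close> has \<open>d\<close> as a multiple root.
\<close>

lemma simple_root_imp_in_base:
  fixes k :: "'a::field set"
  assumes k: "subfield k \<Omega>" and ch: "CHAR('a) = p" and pr: "Factorial_Ring.prime p"
    and P: "poly_over k P" "rsquarefree P" "poly P d = 0" and d: "d ^ p \<in> k"
  shows "d \<in> k"
proof (rule ccontr)
  assume notin: "d \<notin> k"
  have p2: "p \<ge> 2" using pr by (rule prime_ge_2_nat)
  let ?Q = "\<Prod>i<p. [:- (d + 0), 1:]"
  have eq: "?Q = Polynomial.monom 1 p - [:d ^ p:]"
  proof -
    have "?Q = [:- d, 1:] ^ p" by simp
    also have "[:- d, 1:] = Polynomial.monom 1 1 + [:- d:]" by (simp add: Polynomial.monom_altdef)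
    also have "(Polynomial.monom 1 1 + [:- d:]) ^ p = Polynomial.monom 1 1 ^ p + [:- d:] ^ p"
      by (rule freshmans_dream) (use ch pr in auto)
    also have "[:- d:] ^ p = [:(- d) ^ p:]" by (simp add: poly_const_pow)
    also have "(- d) ^ p = - (d ^ p)" using minus_power_prime_CHAR[of p d] ch pr by simp
    finally show ?thesis by (simp add: monom_power)
  qed
  have Qk: "poly_over k ?Q" unfolding eq using k d by (intro poly_over_diff poly_over_monom) auto
  have degQ: "Polynomial.degree ?Q = p" by (subst degree_prod_eq_sum_degree) auto
  have Q0: "?Q \<noteq> 0" using degQ p2 by force
  obtain S R where SR: "poly_over k S" "poly_over k R" "P = S * ?Q + R" "R = 0 \<or> Polynomial.degree R < Polynomial.degree ?Q"
    by (rule poly_over_division[OF k Qk Q0 P(1)])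
  have "poly ?Q d = 0" unfolding eq by (simp add: poly_monom)
  hence "poly P d = poly S d * 0 + poly R d" by (subst SR(3)) (simp only: poly_add poly_mult)
  hence Rd: "poly R d = 0" using P(3) by simp
  have "R = 0"
  proof (cases "R = 0")
    case False
    hence deg: "Polynomial.degree R < p" using SR(4) degQ by simp
    show ?thesis
      by (rule no_small_annihilator[OF k ch _ Qk _ _ notin SR(2) Rd deg, of 0]) (use k p2 in auto)
  qed
  hence "[:- d, 1:] ^ p dvd P" using SR(3) by simp
  hence "[:- d, 1:] ^ 2 dvd P" using p2 by (rule power_le_dvd)
  hence "Polynomial.order d P \<ge> 2" using P(2) by (simp add: order_divides rsquarefree_def)
  moreover have "Polynomial.order d P = 0 \<or> Polynomial.order d P = 1" using P(2) by (simp add: rsquarefree_def)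
  ultimately show False by linarith
qed

text \<open>
  The residue class of \<open>y\<close> is a \<open>p\<close>-th root of that of \<open>c\<close> and a root of a separable polynomial \<open>P\<close> over \<open>k\<close>.
  The polynomial \<open>Q\<close> whose coefficients are the \<open>p\<close>-th powers of those of \<open>P\<close> satisfies \<open>Q(z\<^sup>p) = P(z)\<^sup>p\<close>,
  so \<open>Q\<close> vanishes at \<open>c\<close> modulo the maximal ideal, hence exactly, as \<open>Q(c) \<in> k\<close>.  Then \<open>P\<close> vanishes at the \<open>p\<close>-th root
  \<open>d\<close> of \<open>c\<close>, and this root is simple.
\<close>

lemma residue_separable_pth_power:
  fixes N :: "'a::field set"
  assumes N: "valued_field N u" and k: "subfield k \<Omega>" "k \<subseteq> N" "\<And>c. c \<in> k \<Longrightarrow> c \<noteq> 0 \<Longrightarrow> u c = 0"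
    and ch: "CHAR('a) = p" and pr: "Factorial_Ring.prime p" and root: "\<exists>d. d ^ p = c"
    and sep: "\<And>y. y \<in> N \<Longrightarrow> val_ge u y 0 \<Longrightarrow> \<exists>P. poly_over k P \<and> rsquarefree P \<and> val_ge u (poly P y) 1"
    and c: "c \<in> k" and y: "y \<in> N" "val_ge u (y ^ p - c) 1"
  shows "\<exists>d\<in>k. d ^ p = c"
proof -
  interpret valued_field N u by fact
  have p2: "p \<ge> 2" using pr by (rule prime_ge_2_nat)
  have kint: "val_ge u c 0" if "c \<in> k" for c using k(3) that by (cases "c = 0") (auto simp: val_ge_def)
  have cN: "c \<in> N" using c k by auto
  have ypN: "y ^ p \<in> N" using y N by simp
  have yp: "val_ge u (y ^ p) 0"
  proof -
    have "val_ge u ((y ^ p - c) + c) 0"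
      by (rule val_ge_add) (use y c cN kint ypN N val_ge_mono[OF y(2)] in auto)
    thus ?thesis by simp
  qed
  have y0: "val_ge u y 0" using yp y p2 by (cases "y = 0") (auto simp: val_ge_def val_power zero_le_mult_iff)
  obtain P where P: "poly_over k P" "rsquarefree P" "val_ge u (poly P y) 1" using sep[OF y(1) y0] by blast
  define Q where "Q = map_poly (\<lambda>a. a ^ p) P"
  have cQ: "Polynomial.coeff Q i = Polynomial.coeff P i ^ p" for i
    using p2 by (simp add: Q_def coeff_map_poly)
  have Qk: "poly_over k Q" using P(1) k(1) by (auto simp: poly_over_def cQ)
  have frob: "poly Q (z ^ p) = poly P z ^ p" for z
  proof -
    have degQ: "Polynomial.degree Q \<le> Polynomial.degree P" by (rule degree_le) (use p2 in \<open>auto simp: cQ coeff_eq_0\<close>)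
    have "poly P z ^ p = (\<Sum>i\<le>Polynomial.degree P. (Polynomial.coeff P i * z ^ i) ^ p)"
      unfolding poly_altdef using ch pr by (simp add: freshmans_dream_sum)
    also have "\<dots> = (\<Sum>i\<le>Polynomial.degree P. Polynomial.coeff Q i * (z ^ p) ^ i)"
      by (simp add: cQ power_mult_distrib mult.commute flip: power_mult)
    also have "\<dots> = poly Q (z ^ p)" unfolding poly_altdef
      by (rule sum.mono_neutral_right) (use degQ in \<open>auto simp: coeff_eq_0\<close>)
    finally show ?thesis ..
  qed
  obtain d where d: "d ^ p = c" using root by auto
  have PN: "poly_over N P" using P(1) k(2) by (auto simp: poly_over_def)
  have PyN: "poly P y \<in> N" using PN y N by simp
  have "val_ge u (poly Q (y ^ p)) 1" unfolding frob
    by (rule val_ge_mono[OF val_ge_power[OF PyN P(3)]]) (use p2 in simp)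
  moreover have "val_ge u (poly Q (y ^ p) - poly Q c) 1"
    by (rule poly_diff_val_ge[OF valued_field_axioms k(2,1) kint Qk ypN cN yp kint[OF c] y(2)])
  moreover have QN: "poly_over N Q" using Qk k(2) by (auto simp: poly_over_def)
  hence "poly Q (y ^ p) \<in> N" "poly Q c \<in> N" using ypN cN N by simp_all
  ultimately have "val_ge u (poly Q (y ^ p) - (poly Q (y ^ p) - poly Q c)) 1"
    using N by (intro val_ge_diff[where y = "poly Q (y ^ p) - poly Q c"]) simp_all
  hence "val_ge u (poly Q c) 1" by simp
  moreover have "poly Q c \<in> k" using Qk c k(1) by simp
  ultimately have "poly Q c = 0"
    using k(3)[of "poly Q c"] by (cases "poly Q c = 0") (simp_all add: val_ge_def)
  hence "poly P d = 0" using frob[of d] d p2 by simp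
  hence "d \<in> k" using simple_root_imp_in_base[OF k(1) ch pr P(1,2)] d c by simp
  thus ?thesis using d by blast
qed

text \<open>
  For a fierce class with root \<open>\<beta>\<close>, the element \<open>\<beta> t\<close> is a unit of \<open>N\<close> whose residue is a \<open>p\<close>-th root of
  \<open>c\<close>, against \<open>residue_separable_pth_power\<close>.
\<close>

lemma not_fierce:
  fixes N :: "'a::field set"
  assumes N: "valued_field N u" and F: "valued_field F w" "F \<subseteq> N" "\<And>x. x \<in> F \<Longrightarrow> x \<noteq> 0 \<Longrightarrow> u x = e * w x" "e > 0"
    and k: "coefficient_field F w k"
    and ch: "CHAR('a) = p" and pr: "Factorial_Ring.prime p" and root: "\<And>c. \<exists>d::'a. d ^ p = c"
    and sep: "\<And>y. y \<in> N \<Longrightarrow> val_ge u y 0 \<Longrightarrow> \<exists>P. poly_over k P \<and> rsquarefree P \<and> val_ge u (poly P y) 1"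
    and b: "\<beta> \<in> N" "\<beta> ^ p - \<beta> \<in> F"
  shows "\<not> fierce p F w k (\<beta> ^ p - \<beta>)"
proof
  assume "fierce p F w k (\<beta> ^ p - \<beta>)"
  then obtain t c s where t: "t \<in> F" "t \<noteq> 0" "c \<in> k" "\<forall>d\<in>k. d ^ p \<noteq> c" "\<beta> ^ p - \<beta> \<noteq> 0"
     "w (\<beta> ^ p - \<beta>) = - (int p * s)" "s > 0" "w t = s" "val_ge w ((\<beta> ^ p - \<beta>) * t ^ p - c) 1"
    by (auto simp: fierce_def)
  interpret valued_field N u by fact
  have p2: "p \<ge> 2" using pr by (rule prime_ge_2_nat)
  note kD = coefficient_fieldD[OF k F(1)]
  have kN: "k \<subseteq> N" using kD F by auto
  have uk: "u x = 0" if "x \<in> k" "x \<noteq> 0" for x using F(3)[of x] kD(2) kD(3)[OF that] that by auto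
  have tN: "t \<in> N" "c \<in> N" "\<beta> ^ p - \<beta> \<in> N" using t F b kN by auto
  have b0: "\<beta> \<noteq> 0" using t(5) p2 by auto
  have ub: "u (\<beta> ^ p - \<beta>) = - (e * int p * s)" using F(3)[OF b(2) t(5)] t(6) by simp
  have "0 < e * int p * s" using F(4) p2 t(7) by simp
  hence "int p * u \<beta> = - (e * int p * s)" using val_root_neg[OF p2 b(1) t(5)] ub by simp
  hence "int p * u \<beta> = int p * (- (e * s))" by (simp add: ac_simps)
  hence ubeta: "u \<beta> = - (e * s)" using p2 by (simp only: mult_cancel_left) auto
  define y where "y = \<beta> * t"
  have yN: "y \<in> N" using b tN N by (simp add: y_def)
  have eq: "y ^ p - c = ((\<beta> ^ p - \<beta>) * t ^ p - c) + \<beta> * t ^ p" by (simp add: y_def power_mult_distrib algebra_simps)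
  have FN: "subfield F \<Omega>" using F(1) by (rule valued_field.N)
  have "val_ge u ((\<beta> ^ p - \<beta>) * t ^ p - c) 1"
  proof (cases "(\<beta> ^ p - \<beta>) * t ^ p - c = 0")
    case False
    have "(\<beta> ^ p - \<beta>) * t ^ p - c \<in> F" 
      by (rule subfield_diff[OF FN subfield_mult[OF FN b(2) subfield_power[OF FN t(1)]] subsetD[OF kD(2) t(3)]])
    hence "u ((\<beta> ^ p - \<beta>) * t ^ p - c) = e * w ((\<beta> ^ p - \<beta>) * t ^ p - c)" using F(3) False by blast
    moreover have "e * 1 \<le> e * w ((\<beta> ^ p - \<beta>) * t ^ p - c)"
      using t(9) False F(4) by (intro mult_left_mono) (auto simp: val_ge_def)
    ultimately have "1 \<le> u ((\<beta> ^ p - \<beta>) * t ^ p - c)" using F(4) by linarith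
    thus ?thesis by (simp add: val_ge_def)
  qed simp
  moreover have "val_ge u (\<beta> * t ^ p) 1"
  proof -
    have "u (\<beta> * t ^ p) = - (e * s) + int p * (e * s)"
      using b b0 tN t F(3)[of t] N by (simp add: val_mult val_power ubeta)
    also have "\<dots> = (int p - 1) * (e * s)" by (simp add: algebra_simps)
    finally have "u (\<beta> * t ^ p) = (int p - 1) * (e * s)" .
    moreover have "0 < (int p - 1) * (e * s)" using p2 F(4) t(7) by (intro mult_pos_pos) auto
    ultimately show ?thesis by (simp add: val_ge_def)
  qed
  ultimately have "val_ge u (y ^ p - c) 1" unfolding eq using b tN N
    by (intro val_ge_add subfield_diff subfield_mult) auto
  hence "\<exists>d\<in>k. d ^ p = c"
    using residue_separable_pth_power[OF valued_field_axioms kD(1) kN uk ch pr root sep t(3) yN] by blast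
  thus False using t(4) by blast
qed

section \<open>Completeness of ramified Artin--Schrier extensions\<close>

text \<open>
  The valuation \<open>w' = w/d\<close> is the normalised valuation of \<open>K(\<theta>)\<close>.
\<close>

locale ramified_local = ramified_artin_schrier N w K \<theta> p d n
  for N :: "'a::field set" and w :: "'a \<Rightarrow> int" and K :: "'a set" and \<theta> :: 'a and p :: nat and d n :: int +
  fixes v :: "'a \<Rightarrow> int" and k :: "'a set"
  assumes K: "local_field K v" and k: "coefficient_field K v k"
    and val_K: "c \<in> K \<Longrightarrow> c \<noteq> 0 \<Longrightarrow> w c = int p * d * v c"
begin

definition w' :: "'a \<Rightarrow> int" where "w' z = w z div d"

lemma w_eq: "z \<in> E \<Longrightarrow> z \<noteq> 0 \<Longrightarrow> w z = d * w' z"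
  using dvd_E by (simp add: w'_def)

lemma val_ge_w': "z \<in> E \<Longrightarrow> val_ge w' z a \<longleftrightarrow> val_ge w z (d * a)"
  using w_eq d by (cases "z = 0") (simp_all add: val_ge_def)

lemma w'_K: "c \<in> K \<Longrightarrow> c \<noteq> 0 \<Longrightarrow> w' c = int p * v c"
  using w_eq[of c] val_K[of c] F_subset d by (auto simp: mult.assoc mult.left_commute)

lemma discrete_w': "discrete_valuation E w'"
  unfolding discrete_valuation_iff
proof
  show val: "valued_field E w'"
  proof (rule valued_field.intro)
    fix x y assume xy: "x \<in> E" "y \<in> E" "x \<noteq> 0" "y \<noteq> 0"
    have xyN: "x \<in> N" "y \<in> N" using xy E_sub by blast+
    have "d * w' (x * y) = d * (w' x + w' y)"
      using w_eq[of x] w_eq[of y] w_eq[of "x * y"] xy xyN E_subfield by (simp add: val_mult distrib_left)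
    thus "w' (x * y) = w' x + w' y" using d by simp
    have "val_ge w (x + y) (d * min (w' x) (w' y))"
      using val_add[OF xyN xy(3,4)] w_eq[of x] w_eq[of y] xy d by (simp add: min_mult_distrib_left)
    thus "val_ge w' (x + y) (min (w' x) (w' y))" using xy E_subfield by (simp add: val_ge_w')
  qed (rule E_subfield)
  obtain \<pi> where pi: "\<pi> \<in> K" "\<pi> \<noteq> 0" "v \<pi> = 1" using discrete_valuation_uniformizer local_fieldD[OF K] by metis
  obtain A m where A: "int p * A - int m * n = 1" "m \<noteq> 0" "m < p" by (rule bezout)
  have y: "\<pi> powi A * \<theta> ^ m \<in> E" "\<pi> powi A * \<theta> ^ m \<noteq> 0" "w (\<pi> powi A * \<theta> ^ m) = d"
    by (rule uniformizer_E; use pi A val_K[OF pi(1,2)] in simp)+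
  hence wy: "w' (\<pi> powi A * \<theta> ^ m) = 1" using d by (simp add: w'_def)
  show "w' ` (E - {0}) = UNIV"
  proof (intro equalityI subsetI)
    fix j :: int
    have "w' ((\<pi> powi A * \<theta> ^ m) powi j) = j" using valued_field.val_power_int[OF val y(1,2), of j] wy by simp
    moreover have "(\<pi> powi A * \<theta> ^ m) powi j \<in> E - {0}"
      using subfield_power_int[OF E_subfield y(1)] y(2) by (simp add: power_int_eq_0_iff)
    ultimately show "j \<in> w' ` (E - {0})" by (metis imageI)
  qed simp
qed

text \<open>
  By \<open>nonconstant_term\<close>, all terms but the constant one of an integral element lie in the maximal
  ideal, so no residue classes are added to those of \<open>K\<close>.
\<close>

lemma coefficient_w': "coefficient_field E w' k"
proof -
  interpret V: valued_field K v using K by (rule local_fieldD)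
  interpret W: valued_field E w' using discrete_w' by (simp add: discrete_valuation_iff)
  note kD = coefficient_fieldD[OF k V.valued_field_axioms]
  have int_k: "val_ge w' c 0" if "c \<in> k" for c
    using w'_K[of c] kD(2) kD(3)[OF that] that by (cases "c = 0") (auto simp: val_ge_def)
  show ?thesis unfolding coefficient_field_def
  proof (intro conjI ballI)
    show "subfield k \<Omega>" by (rule kD)
    show "k \<subseteq> valuation_ring E w'" using int_k kD(2) F_subset by (auto simp: valuation_ring_def)
    fix x assume "x \<in> valuation_ring E w'"
    hence x: "x \<in> E" "val_ge w x 0" using val_ge_w'[of x 0] by (auto simp: valuation_ring_def)
    obtain c where c: "\<And>m. c m \<in> K" "x = (\<Sum>m<p. c m * \<theta> ^ m)"
      "\<And>a. val_ge w x a \<longleftrightarrow> (\<forall>m<p. val_ge w (c m * \<theta> ^ m) a)" using theta_basis[OF x(1)] by blast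
    have cN: "c m \<in> N" for m using c(1) F_sub by auto
    have "val_ge w (c 0) 0" using c(3)[of 0] x(2) p2 by (metis mult.right_neutral power_0 pos2 less_le_trans)
    moreover have "0 < int p * d" using d p2 by simp
    ultimately have "val_ge v (c 0) 0" using val_K[OF c(1), of 0]
      by (cases "c 0 = 0") (simp_all add: val_ge_def zero_le_mult_iff)
    then obtain r where r: "r \<in> k" "val_ge v (c 0 - r) 1" using kD(4)[OF c(1)] by blast
    have rK: "r \<in> K" using r kD(2) by auto
    have c0r: "val_ge w (c 0 - r) d"
    proof (cases "c 0 - r = 0")
      case False
      have "c 0 - r \<in> K" using c(1) rK V.N by simp
      hence "w (c 0 - r) = int p * d * v (c 0 - r)" by (rule val_K) fact
      moreover have "1 \<le> v (c 0 - r)" using r(2) False by (simp add: val_ge_def)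
      moreover have "d * 1 \<le> d * (int p * v (c 0 - r))"
        using mult_mono[of 1 "int p" 1 "v (c 0 - r)"] calculation(2) p2 d by (intro mult_left_mono) auto
      ultimately show ?thesis by (simp add: val_ge_def ac_simps)
    qed simp
    have eq: "x - r = (c 0 - r) + (\<Sum>m\<in>{..<p} - {0}. c m * \<theta> ^ m)"
      using p2 by (subst c(2), subst sum.remove[of _ 0]) auto
    have "val_ge w (\<Sum>m\<in>{..<p} - {0}. c m * \<theta> ^ m) d"
    proof (rule val_ge_sum)
      fix m assume m: "m \<in> {..<p} - {0}"
      show "c m * \<theta> ^ m \<in> N" using cN theta_N N by simp
      show "val_ge w (c m * \<theta> ^ m) d"
      proof (cases "c m = 0")
        case False
        have "val_ge w (c m * \<theta> ^ m) 0" using c(3)[of 0] x(2) m by auto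
        hence "d \<le> w (c m) - int m * d * n" using nonconstant_term[OF c(1) False, of m] m by auto
        thus ?thesis using False cN[of m] theta_N theta_nz N by (simp add: val_ge_def val_mult val_theta_power)
      qed simp
    qed
    moreover have "(\<Sum>m\<in>{..<p} - {0}. c m * \<theta> ^ m) \<in> N"
      by (rule subfield_sum[OF N]) (use cN theta_N N in simp)
    ultimately have "val_ge w (x - r) d" unfolding eq using c0r cN rK F_sub N by (intro val_ge_add) auto
    moreover have xr: "x - r \<in> E" using x rK F_subset E_subfield by auto
    ultimately have ge: "val_ge w' (x - r) 1" by (simp add: val_ge_w')
    show "\<exists>!c. c \<in> k \<and> val_ge w' (x - c) 1"
    proof (intro ex1I conjI)
      show "r \<in> k" "val_ge w' (x - r) 1" by fact+
      fix r' assume r': "r' \<in> k \<and> val_ge w' (x - r') 1"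
      have xr': "x - r' \<in> E" using x r' kD(2) F_subset E_subfield by auto
      have "val_ge w' ((x - r) - (x - r')) 1" by (rule W.val_ge_diff) (use xr xr' ge r' in auto)
      hence ge': "val_ge w' (r' - r) 1" by simp
      show "r' = r"
      proof (rule ccontr)
        assume "r' \<noteq> r"
        moreover have rr: "r' - r \<in> k" using r r' kD(1) by simp
        ultimately have "v (r' - r) = 0" using kD(3) by simp
        hence "w' (r' - r) = 0" using w'_K[of "r' - r"] rr kD(2) \<open>r' \<noteq> r\<close> by auto
        thus False using ge' \<open>r' \<noteq> r\<close> by (simp add: val_ge_def)
      qed
    qed
  qed
qed

text \<open>
  By \<open>val_indep_theta\<close>, the coefficients of a Cauchy sequence in the basis of powers of \<open>\<theta>\<close> are Cauchy
  sequences in \<open>K\<close>.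
\<close>

lemma complete_w': "local_field E w'"
  unfolding local_field_def
proof (intro conjI allI impI)
  interpret V: valued_field K v using K by (rule local_fieldD)
  show "discrete_valuation E w'" by (rule discrete_w')
  fix s assume s: "range s \<subseteq> E \<and> val_Cauchy w' s"
  have "\<forall>r. \<exists>c. (\<forall>m. c m \<in> K) \<and> s r = (\<Sum>m<p. c m * \<theta> ^ m)"
    using power_basis s by (metis range_subsetD)
  then obtain c where c: "\<And>r m. c r m \<in> K" "\<And>r. s r = (\<Sum>m<p. c r m * \<theta> ^ m)" by metis
  have sE: "s r \<in> E" for r using s by auto
  have diff: "s a - s b = (\<Sum>m<p. (c a m - c b m) * \<theta> ^ m)" for a b
    by (simp add: c(2) sum_subtractf left_diff_distrib)
  have "\<exists>l\<in>K. val_tendsto v (\<lambda>r. c r m) l" if m: "m < p" for m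
  proof -
    have "val_Cauchy v (\<lambda>r. c r m)" unfolding val_Cauchy_def
    proof
      fix C :: int
      obtain n0 where n0: "\<forall>a\<ge>n0. \<forall>b\<ge>n0. val_ge w' (s a - s b) (int p * C)"
        using s unfolding val_Cauchy_def by meson
      have "val_ge v (c a m - c b m) C" if "a \<ge> n0" "b \<ge> n0" for a b
      proof (cases "c a m - c b m = 0")
        case False
        have "val_ge w (s a - s b) (d * (int p * C))" using n0 that sE E_subfield by (simp flip: val_ge_w')
        hence "val_ge w ((c a m - c b m) * \<theta> ^ m) (d * (int p * C))"
          unfolding diff using val_indep_ge_iff[OF F_sub val_indep_theta, of "\<lambda>m. c a m - c b m"] c(1) V.N m by simp
        moreover have "c a m - c b m \<in> K" using c(1) V.N by simp
        ultimately have "d * (int p * C) \<le> int p * d * v (c a m - c b m) - int m * d * n"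
          using False theta_N theta_nz N F_sub val_K[of "c a m - c b m"]
          by (auto simp: val_ge_def val_mult val_theta_power)
        moreover have "0 \<le> int m * d * n" using d n by simp
        ultimately have "d * (int p * C) \<le> d * (int p * v (c a m - c b m))" by (simp add: ac_simps)
        hence "C \<le> v (c a m - c b m)" using d p2 by simp
        thus ?thesis by (simp add: val_ge_def)
      qed simp
      thus "\<exists>n0. \<forall>a\<ge>n0. \<forall>b\<ge>n0. val_ge v (c a m - c b m) C" by blast
    qed
    moreover have "range (\<lambda>r. c r m) \<subseteq> K" using c(1) by auto
    ultimately show ?thesis using K unfolding local_field_def by blast
  qed
  hence "\<exists>l. \<forall>m<p. l m \<in> K \<and> val_tendsto v (\<lambda>r. c r m) (l m)" by metis
  then obtain l where l: "\<And>m. m < p \<Longrightarrow> l m \<in> K" "\<And>m. m < p \<Longrightarrow> val_tendsto v (\<lambda>r. c r m) (l m)" by blast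
  define x where "x = (\<Sum>m<p. l m * \<theta> ^ m)"
  have xE: "x \<in> E" unfolding x_def
  proof (rule subfield_sum[OF E_subfield])
    fix m assume "m \<in> {..<p}"
    hence "l m \<in> E" using l(1)[of m] F_subset by auto
    thus "l m * \<theta> ^ m \<in> E" using gen_in E_subfield by simp
  qed
  have "val_tendsto w' s x" unfolding val_tendsto_def
  proof
    fix C :: int
    define B where "B = \<bar>C\<bar> + int p * n"
    have "\<forall>m<p. \<exists>n0. \<forall>r\<ge>n0. val_ge v (c r m - l m) B" using l(2) unfolding val_tendsto_def by blast
    then obtain n0 where n0: "\<And>m r. m < p \<Longrightarrow> r \<ge> n0 m \<Longrightarrow> val_ge v (c r m - l m) B" by metis
    define M where "M = Max (n0 ` {..<p})"
    have nM: "n0 m \<le> M" if "m < p" for m unfolding M_def using that by (intro Max_ge) auto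
    have "val_ge w' (s r - x) C" if r: "r \<ge> M" for r
    proof -
      have "val_ge w (s r - x) (d * C)"
      proof -
        have eq: "s r - x = (\<Sum>m<p. (c r m - l m) * \<theta> ^ m)"
          by (simp add: c(2) x_def sum_subtractf left_diff_distrib)
        show ?thesis unfolding eq
        proof (rule val_ge_sum)
          fix m assume m: "m \<in> {..<p}"
          have cl: "c r m - l m \<in> K" using c(1) l(1) m V.N by simp
          thus "(c r m - l m) * \<theta> ^ m \<in> N" using F_sub theta_N N by auto
          show "val_ge w ((c r m - l m) * \<theta> ^ m) (d * C)"
          proof (cases "c r m - l m = 0")
            case False
            have "B \<le> v (c r m - l m)" using n0[of m r] nM[of m] m r False by (simp add: val_ge_def)
            moreover have "0 \<le> v (c r m - l m)"
            proof -
              have "0 \<le> int p * n" using n by simp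
              thus ?thesis using calculation unfolding B_def by linarith
            qed
            hence "1 * v (c r m - l m) \<le> int p * v (c r m - l m)" using p2 by (intro mult_right_mono) auto
            moreover have "int m * n \<le> int p * n" using m n by (intro mult_right_mono) auto
            ultimately have "C \<le> int p * v (c r m - l m) - int m * n" by (simp add: B_def)
            hence "d * C \<le> d * (int p * v (c r m - l m) - int m * n)" using d by (intro mult_left_mono) auto
            also have "\<dots> = w ((c r m - l m) * \<theta> ^ m)"
            proof -
              have "c r m - l m \<in> N" using cl F_sub by auto
              hence "w ((c r m - l m) * \<theta> ^ m) = w (c r m - l m) + w (\<theta> ^ m)"
                by (rule val_mult) (use False theta_N theta_nz N in simp_all)
              also have "\<dots> = d * (int p * v (c r m - l m) - int m * n)"
                unfolding val_K[OF cl False] val_theta_power by (simp add: algebra_simps)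
              finally show ?thesis ..
            qed
            finally show ?thesis by (simp add: val_ge_def)
          qed simp
        qed
      qed
      thus ?thesis using sE xE E_subfield by (simp add: val_ge_w')
    qed
    thus "\<exists>n0. \<forall>r\<ge>n0. val_ge w' (s r - x) C" by blast
  qed
  thus "\<exists>x\<in>E. val_tendsto w' s x" using xE by blast
qed

end

section \<open>Two independent Artin--Schrier elements\<close>

text \<open>
  The last assumption says that the classes of the two elements modulo \<open>\<wp>(K)\<close> are linearly
  independent over the prime field; equivalently, the degree is \<open>p\<^sup>2\<close>.
\<close>

locale as_pair =
  fixes K :: "'a::field set" and \<theta>1 \<theta>2 :: 'a and p :: nat
  assumes K_sf: "subfield K \<Omega>" and CHAR: "CHAR('a) = p" and prime: "Factorial_Ring.prime p"
    and wp1: "\<theta>1 ^ p - \<theta>1 \<in> K" and wp2: "\<theta>2 ^ p - \<theta>2 \<in> K"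
    and indep: "a \<in> prime_field \<Longrightarrow> b \<in> prime_field \<Longrightarrow> a * \<theta>1 + b * \<theta>2 \<in> K \<Longrightarrow> a = 0 \<and> b = 0"
begin

definition N :: "'a set" where "N = generate_field \<Omega> (insert \<theta>2 (insert \<theta>1 K))"

lemma pf01: "(0::'a) \<in> prime_field" "(1::'a) \<in> prime_field"
  by (auto intro: range_eqI[of _ _ 0] range_eqI[of _ _ 1])

lemma theta1_notin: "\<theta>1 \<notin> K" using indep[OF pf01(2,1)] by auto

sublocale A1: artin_schrier K \<theta>1 p
  by (rule artin_schrier.intro) (use K_sf CHAR prime wp1 theta1_notin in auto)

text \<open>
  An Artin--Schrier root in \<open>K(\<theta>\<^sub>1)\<close> would be \<open>b \<theta>\<^sub>1 + x\<close> by \<open>descent\<close>, against independence.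
\<close>

lemma theta2_notin: "\<theta>2 \<notin> A1.E"
proof
  assume "\<theta>2 \<in> A1.E"
  then obtain b x where b: "b \<in> prime_field" "x \<in> K" "\<theta>2 = b * \<theta>1 + x" by (rule A1.descent[OF _ wp2])
  have "- b \<in> prime_field" using subfield_prime_field[OF CHAR prime] b(1) by simp
  moreover have "- b * \<theta>1 + 1 * \<theta>2 \<in> K" using b by simp
  ultimately show False using indep[of "- b" 1] pf01 by simp
qed

sublocale A2: artin_schrier A1.E \<theta>2 p
  by (rule artin_schrier.intro) (use A1.E_subfield A1.F_subset CHAR prime wp2 theta2_notin in auto)

lemma N_sf: "subfield N \<Omega>" and K_N: "K \<subseteq> N" and theta_N: "\<theta>1 \<in> N" "\<theta>2 \<in> N"
  using generate_field_ambient[of "insert \<theta>2 (insert \<theta>1 K)"] by (auto simp: N_def)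

lemma N_least: "subfield H \<Omega> \<Longrightarrow> K \<subseteq> H \<Longrightarrow> \<theta>1 \<in> H \<Longrightarrow> \<theta>2 \<in> H \<Longrightarrow> N \<subseteq> H"
  unfolding N_def by (rule generate_field_ambient) auto

lemma E1_N: "A1.E \<subseteq> N" by (rule A1.E_least) (use N_sf K_N theta_N in auto)

lemma N_eq: "A2.E = N"
proof
  show "A2.E \<subseteq> N" by (rule A2.E_least) (use N_sf E1_N theta_N in auto)
  show "N \<subseteq> A2.E"
    by (rule N_least) (use A2.E_subfield A2.F_subset A2.gen_in A1.F_subset A1.gen_in in auto)
qed

lemma dimension_N: "amb.dimension (p * p) K N"
  using amb.telescopic_base[OF K_sf A1.E_subfield A1.dimension_E A2.dimension_E] by (simp add: N_eq)

lemma swap: "as_pair K \<theta>2 \<theta>1 p"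
  by (rule as_pair.intro) (use K_sf CHAR prime wp1 wp2 indep in \<open>auto simp: add.commute\<close>)

lemma N_swap: "as_pair.N K \<theta>2 \<theta>1 = N"
  unfolding as_pair.N_def[OF swap] N_def by (simp add: insert_commute)

end

locale as_pair_val = as_pair K \<theta>1 \<theta>2 p
  for K :: "'a::field set" and \<theta>1 \<theta>2 :: 'a and p :: nat +
  fixes v w :: "'a \<Rightarrow> int" and k :: "'a set" and e :: nat
  assumes K: "local_field K v" and k: "coefficient_field K v k"
    and w: "discrete_valuation N w" and e: "e > 0"
    and val_K: "c \<in> K \<Longrightarrow> c \<noteq> 0 \<Longrightarrow> w c = int e * v c"
begin

sublocale V: valued_field K v using K by (rule local_fieldD)
sublocale W: valued_field N w using w by (simp add: discrete_valuation_iff)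

lemmas kD = coefficient_fieldD[OF k V.valued_field_axioms]

lemma p2: "p \<ge> 2" by (rule A1.p2)

lemma w_onto: obtains x where "x \<in> N" "x \<noteq> 0" "w x = 1"
  using discrete_valuation_uniformizer[OF w] by blast

lemma ramified_first:
  assumes red: "\<theta>1 ^ p - \<theta>1 \<noteq> 0" "v (\<theta>1 ^ p - \<theta>1) = - n" "n > 0" "\<not> int p dvd n"
  obtains d where "d > 0" "int e = int p * d" "ramified_artin_schrier N w K \<theta>1 p d n"
proof -
  have "0 < int e" using e by simp
  from W.ramified_artin_schrierI[OF A1.artin_schrier_axioms K_N theta_N(1) this val_K red]
  show thesis using that by blast
qed

text \<open>
  The class of \<open>\<theta>\<^sub>2\<close> is reduced over the complete field \<open>K(\<theta>\<^sub>1)\<close>, which replaces \<open>\<theta>\<^sub>2\<close> by \<open>\<beta> = \<theta>\<^sub>2 + \<eta>\<close>.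
  If the reduced class lies in \<open>k\<close>, then the class of \<open>\<eta>\<close> lies in \<open>K\<close> and \<open>\<eta> = b \<theta>\<^sub>1 + x\<close> by \<open>descent\<close>.
  If it has negative value prime to \<open>p\<close>, the second step is ramified as well.
\<close>

theorem ramified_or_residual:
  assumes red: "\<theta>1 ^ p - \<theta>1 \<noteq> 0" "v (\<theta>1 ^ p - \<theta>1) = - n" "n > 0" "\<not> int p dvd n"
    and root: "\<And>c. \<exists>d::'a. d ^ p = c"
    and sep: "\<And>y. y \<in> N \<Longrightarrow> val_ge w y 0 \<Longrightarrow> \<exists>P. poly_over k P \<and> rsquarefree P \<and> val_ge w (poly P y) 1"
  shows "e = p * p \<or> (\<exists>b\<in>prime_field. \<exists>x\<in>K. (\<theta>2 ^ p - \<theta>2) + b * (\<theta>1 ^ p - \<theta>1) + x ^ p - x \<in> k)"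
proof -
  obtain d where d: "d > 0" "int e = int p * d" and ram: "ramified_artin_schrier N w K \<theta>1 p d n"
    by (rule ramified_first[OF red])
  interpret R: ramified_artin_schrier N w K \<theta>1 p d n by (rule ram)
  interpret R: ramified_local N w K \<theta>1 p d n v k
    by unfold_locales (use K k val_K d in auto)
  note red = artin_schrier_reduction[OF R.complete_w' R.coefficient_w' CHAR prime, of "\<theta>2 ^ p - \<theta>2"]
  have f2: "\<theta>2 ^ p - \<theta>2 \<in> A1.E" using wp2 A1.F_subset by auto
  obtain \<eta> where eta: "\<eta> \<in> A1.E" and
    cases: "(\<theta>2 ^ p - \<theta>2) + \<eta> ^ p - \<eta> \<in> k \<or>
     (reduced_element p R.w' ((\<theta>2 ^ p - \<theta>2) + \<eta> ^ p - \<eta>) \<and> R.w' ((\<theta>2 ^ p - \<theta>2) + \<eta> ^ p - \<eta>) < 0) \<or>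
      fierce p A1.E R.w' k ((\<theta>2 ^ p - \<theta>2) + \<eta> ^ p - \<eta>)"
    using red[OF f2] by blast
  define \<beta> where "\<beta> = \<theta>2 + \<eta>"
  have beq: "(\<theta>2 ^ p - \<theta>2) + \<eta> ^ p - \<eta> = \<beta> ^ p - \<beta>"
    using artin_schrier_add[OF CHAR prime, of \<theta>2 \<eta>] by (simp add: \<beta>_def algebra_simps)
  have bN: "\<beta> \<in> N" using eta E1_N theta_N N_sf by (auto simp: \<beta>_def)
  have bE: "\<beta> ^ p - \<beta> \<in> A1.E" unfolding beq[symmetric] using f2 eta A1.E_subfield by simp
  have bnot: "\<beta> \<notin> A1.E"
  proof
    assume "\<beta> \<in> A1.E"
    hence "\<beta> - \<eta> \<in> A1.E" using eta A1.E_subfield by simp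
    thus False using theta2_notin by (simp add: \<beta>_def)
  qed
  have vE: "valued_field A1.E R.w'" using R.discrete_w' by (simp add: discrete_valuation_iff)
  have nf: "\<not> fierce p A1.E R.w' k (\<beta> ^ p - \<beta>)"
    by (rule not_fierce[OF W.valued_field_axioms vE E1_N R.w_eq d(1) R.coefficient_w' CHAR prime root sep bN bE])
  consider "\<beta> ^ p - \<beta> \<in> k" | "reduced_element p R.w' (\<beta> ^ p - \<beta>)" "R.w' (\<beta> ^ p - \<beta>) < 0"
    using cases nf unfolding beq by blast
  thus ?thesis
  proof cases
    case 1
    have "\<eta> ^ p - \<eta> = (\<beta> ^ p - \<beta>) - (\<theta>2 ^ p - \<theta>2)" using beq by (simp add: algebra_simps)
    also have "\<dots> \<in> K" by (rule subfield_diff[OF K_sf]) (use 1 kD(2) wp2 in auto)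
    finally obtain b x where b: "b \<in> prime_field" "x \<in> K" "\<eta> = b * \<theta>1 + x" by (rule A1.descent[OF eta])
    have eta_eq: "\<eta> ^ p - \<eta> = b * (\<theta>1 ^ p - \<theta>1) + (x ^ p - x)"
      unfolding b(3) by (simp only: artin_schrier_add[OF CHAR prime] artin_schrier_scale[OF CHAR prime b(1)])
    have "(\<theta>2 ^ p - \<theta>2) + b * (\<theta>1 ^ p - \<theta>1) + x ^ p - x
        = (\<theta>2 ^ p - \<theta>2) + (b * (\<theta>1 ^ p - \<theta>1) + (x ^ p - x))" by (simp only: add_diff_eq add.assoc)
    also have "\<dots> = (\<theta>2 ^ p - \<theta>2) + (\<eta> ^ p - \<eta>)" by (simp only: eta_eq)
    also have "\<dots> = \<beta> ^ p - \<beta>" using beq by (simp only: add_diff_eq)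
    finally have "(\<theta>2 ^ p - \<theta>2) + b * (\<theta>1 ^ p - \<theta>1) + x ^ p - x = \<beta> ^ p - \<beta>" .
    thus ?thesis using 1 b by metis
  next
    case 2
    define n' where "n' = - R.w' (\<beta> ^ p - \<beta>)"
    have bnz: "\<beta> ^ p - \<beta> \<noteq> 0" using 2 by (simp add: reduced_element_def)
    have n': "n' > 0" "\<not> int p dvd n'"
    proof -
      show "n' > 0" using 2 by (simp add: n'_def)
      show "\<not> int p dvd n'"
      proof
        assume "int p dvd n'"
        hence "int p dvd R.w' (\<beta> ^ p - \<beta>)" by (simp add: n'_def)
        hence "int p dvd 1" using 2(1) unfolding reduced_element_def by (meson coprime_common_divisor dvd_refl)
        thus False using p2 by simp
      qed
    qed
    have AS: "artin_schrier A1.E \<beta> p"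
      by (rule artin_schrier.intro) (use A1.E_subfield CHAR prime bE bnot in auto)
    have "R.w' (\<beta> ^ p - \<beta>) = - n'" by (simp add: n'_def)
    from W.ramified_artin_schrierI[OF AS E1_N bN d(1) R.w_eq bnz this n']
    obtain d2 where d2: "d2 > 0" "d = int p * d2" and ram2: "ramified_artin_schrier N w A1.E \<beta> p d2 n'"
      by blast
    interpret S: ramified_artin_schrier N w A1.E \<beta> p d2 n' by (rule ram2)
    have "N \<subseteq> S.E"
    proof (rule N_least)
      have "\<beta> - \<eta> \<in> S.E" using S.gen_in S.F_subset eta S.E_subfield by auto
      thus "\<theta>2 \<in> S.E" by (simp add: \<beta>_def)
    qed (use S.E_subfield S.F_subset A1.F_subset A1.gen_in in auto)
    obtain x where x: "x \<in> N" "x \<noteq> 0" "w x = 1" by (rule w_onto)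
    have "d2 dvd w x" by (rule S.dvd_E) (use x \<open>N \<subseteq> S.E\<close> in auto)
    hence "d2 = 1" using x d2(1) by simp
    hence "int e = int (p * p)" using d d2 by simp
    thus ?thesis by (metis of_nat_eq_iff)
  qed
qed

text \<open>
  Divide \<open>z\<close> by its coefficient of least value.  The residues of the resulting integral coefficients
  define a nonzero element of \<open>k(\<theta>\<^sub>1)\<close>, a field that consists of integral elements and hence of
  units; so \<open>z\<close> has the value of that coefficient.
\<close>

lemma unramified_first:
  assumes c: "\<theta>1 ^ p - \<theta>1 \<in> k" and z: "z \<in> A1.E" "z \<noteq> 0"
  shows "int e dvd w z"
proof -
  obtain c where cK: "\<And>m. c m \<in> K" and zc: "z = (\<Sum>m<p. c m * \<theta>1 ^ m)" using A1.power_basis[OF z(1)] by blast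
  define A where "A = {m. m < p \<and> c m \<noteq> 0}"
  have "A \<noteq> {}"
  proof
    assume "A = {}"
    hence "z = 0" unfolding zc by (intro sum.neutral) (auto simp: A_def)
    thus False using z by simp
  qed
  moreover have finA: "finite A" by (simp add: A_def)
  ultimately obtain m0 where m0: "m0 \<in> A" "\<And>m. m \<in> A \<Longrightarrow> v (c m0) \<le> v (c m)"
    using ex_is_arg_min_if_finite[of A "\<lambda>m. v (c m)"] unfolding is_arg_min_linorder by auto
  have cm0: "c m0 \<noteq> 0" "m0 < p" using m0 by (auto simp: A_def)
  define q where "q m = c m / c m0" for m
  have qK: "q m \<in> K" for m using cK V.N by (simp add: q_def)
  have qint: "val_ge v (q m) 0" if "m < p" for m
    using m0(2)[of m] that cm0 cK by (cases "c m = 0") (simp_all add: q_def val_ge_def V.val_divide A_def)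
  have "\<forall>m. \<exists>r. m < p \<longrightarrow> r \<in> k \<and> val_ge v (q m - r) 1" using kD(4)[OF qK qint] by blast
  then obtain r where r: "\<And>m. m < p \<Longrightarrow> r m \<in> k" "\<And>m. m < p \<Longrightarrow> val_ge v (q m - r m) 1" by metis
  have k_sf: "subfield k \<Omega>" and kK: "k \<subseteq> K" by (rule kD)+
  interpret Ak: artin_schrier k \<theta>1 p
    by (rule artin_schrier.intro) (use k_sf CHAR prime c theta1_notin kK assms(1) in auto)
  define \<xi> where "\<xi> = (\<Sum>m<p. r m * \<theta>1 ^ m)"
  have xiE: "\<xi> \<in> Ak.E" unfolding \<xi>_def
  proof (rule subfield_sum[OF Ak.E_subfield])
    fix m assume "m \<in> {..<p}"
    hence "r m \<in> Ak.E" using r(1)[of m] Ak.F_subset by auto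
    thus "r m * \<theta>1 ^ m \<in> Ak.E" using Ak.gen_in Ak.E_subfield by simp
  qed
  have AkN: "Ak.E \<subseteq> N" by (rule Ak.E_least) (use N_sf kK K_N theta_N in auto)
  have wk: "val_ge w x 0" if "x \<in> k" for x
    using val_K[of x] kD(3)[OF that] kK that by (cases "x = 0") (auto simp: val_ge_def)
  have wth: "val_ge w \<theta>1 0" by (rule W.val_root_nonneg[OF p2 theta_N(1) wk[OF assms(1)]])
  have AkO: "val_ge w x 0" if x: "x \<in> Ak.E" for x
  proof -
    obtain a where a: "\<And>m. a m \<in> k" "x = (\<Sum>m<p. a m * \<theta>1 ^ m)" using Ak.power_basis[OF x] by blast
    show ?thesis unfolding a(2)
    proof (rule W.val_ge_sum)
      fix m
      have "a m \<in> N" using a(1) kK K_N by auto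
      thus "a m * \<theta>1 ^ m \<in> N" "val_ge w (a m * \<theta>1 ^ m) 0"
        using theta_N N_sf wk[OF a(1)] W.val_ge_power[OF theta_N(1) wth, of m]
        by (auto intro: W.val_ge_mult0)
    qed
  qed
  have xi0: "\<xi> \<noteq> 0"
  proof
    assume "\<xi> = 0"
    hence "r m0 = 0" using lin_indepD[OF Ak.power_indep, of r m0] r(1) cm0(2) by (simp add: \<xi>_def)
    hence "val_ge v (q m0) 1" using r(2)[OF cm0(2)] by simp
    thus False using cm0 by (simp add: q_def val_ge_def)
  qed
  have xiN: "\<xi> \<in> N" using xiE AkN by auto
  have wxi: "w \<xi> = 0"
  proof -
    have "inverse \<xi> \<in> Ak.E" using xiE Ak.E_subfield by simp
    hence "val_ge w (inverse \<xi>) 0" "val_ge w \<xi> 0" using AkO xiE by auto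
    thus ?thesis using xi0 xiN by (simp add: val_ge_def W.val_inverse)
  qed
  have zq: "z / c m0 = \<xi> + (\<Sum>m<p. (q m - r m) * \<theta>1 ^ m)"
    by (simp add: zc \<xi>_def sum_divide_distrib q_def flip: sum.distrib) (simp add: algebra_simps)
  have rK: "q m - r m \<in> K" if "m < p" for m using qK r(1)[OF that] kK V.N by auto
  have "val_ge w (\<Sum>m<p. (q m - r m) * \<theta>1 ^ m) 1"
  proof (rule W.val_ge_sum)
    fix m assume m: "m \<in> {..<p}"
    have qr: "q m - r m \<in> N" using rK m K_N by auto
    thus "(q m - r m) * \<theta>1 ^ m \<in> N" using theta_N N_sf by simp
    have "val_ge w (q m - r m) 1"
    proof (cases "q m - r m = 0")
      case False
      have "1 \<le> v (q m - r m)" using r(2)[of m] m False by (simp add: val_ge_def)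
      moreover have "int e * v (q m - r m) = w (q m - r m)" using val_K[OF rK False] m by simp
      moreover have "1 * 1 \<le> int e * v (q m - r m)" using e calculation(1) by (intro mult_mono) auto
      ultimately show ?thesis by (simp add: val_ge_def)
    qed simp
    moreover have "val_ge w (\<theta>1 ^ m) 0" using W.val_ge_power[OF theta_N(1) wth, of m] by simp
    ultimately show "val_ge w ((q m - r m) * \<theta>1 ^ m) 1"
      using W.val_ge_mult[OF qr, of "\<theta>1 ^ m" 1 0] theta_N N_sf by simp
  qed
  moreover have "(\<Sum>m<p. (q m - r m) * \<theta>1 ^ m) \<in> N"
  proof (rule subfield_sum[OF N_sf])
    fix m assume "m \<in> {..<p}"
    hence "q m - r m \<in> N" using rK[of m] K_N by auto
    thus "(q m - r m) * \<theta>1 ^ m \<in> N" using theta_N N_sf by simp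
  qed
  ultimately have "w (z / c m0) = 0" unfolding zq using W.val_add_eq(2)[OF xiN _ xi0] wxi by simp
  moreover have "c m0 \<in> N" "z \<in> N" using cK K_N z E1_N by auto
  ultimately have "w z = int e * v (c m0)" using W.val_divide[of z "c m0"] z cm0 val_K[OF cK cm0(1)] by simp
  thus ?thesis by simp
qed

text \<open>
  The element \<open>\<theta>\<^sub>2\<close> is ramified over \<open>K\<close>, and by \<open>unramified_first\<close> it remains so over \<open>K(\<theta>\<^sub>1)\<close>, whose
  values are those of \<open>K\<close>.
\<close>

lemma ramified_second:
  assumes c: "\<theta>1 ^ p - \<theta>1 \<in> k"
    and red: "\<theta>2 ^ p - \<theta>2 \<noteq> 0" "v (\<theta>2 ^ p - \<theta>2) = - n" "n > 0" "\<not> int p dvd n"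
  shows "e = p" "ramified_artin_schrier N w A1.E \<theta>2 p 1 n"
proof -
  interpret sw: as_pair_val K \<theta>2 \<theta>1 p v w k e
    by (rule as_pair_val.intro[OF swap], rule as_pair_val_axioms.intro)
      (use K k w e val_K in \<open>auto simp: N_swap\<close>)
  obtain d where d: "d > 0" "int e = int p * d" and ram: "ramified_artin_schrier N w K \<theta>2 p d n"
    using sw.ramified_first[OF red] unfolding N_swap by blast
  have th: "w \<theta>2 = - (d * n)" using ramified_artin_schrier.val_theta[OF ram] .
  interpret S: ramified_artin_schrier N w A1.E \<theta>2 p d n
    by unfold_locales (use E1_N theta_N d red th unramified_first[OF c] in auto)
  obtain x where x: "x \<in> N" "x \<noteq> 0" "w x = 1" by (rule w_onto)
  have "d dvd w x" by (rule S.dvd_E) (use x N_eq in auto)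
  hence "d = 1" using x d(1) by simp
  thus "e = p" "ramified_artin_schrier N w A1.E \<theta>2 p 1 n" using d S.ramified_artin_schrier_axioms by auto
qed

end

section \<open>Automorphisms\<close>

lemma fixing_hom_comp:
  assumes "fixing_hom F N \<sigma>" "fixing_hom F N \<tau>" shows "fixing_hom F N (\<lambda>z. \<sigma> (\<tau> z))"
  using assms by (auto simp: fixing_hom_def)

lemma fixing_hom_restrict:
  assumes "subfield N \<Omega>" "F \<subseteq> N"
  shows "fixing_hom F N (restrict \<sigma> N) \<longleftrightarrow> fixing_hom F N \<sigma>"
  using assms unfolding fixing_hom_def by (auto simp: subset_iff)

lemma carrier_Gal_iff:
  assumes K: "subfield K \<Omega>" and N: "subfield N \<Omega>" "K \<subseteq> N"
  shows "\<sigma> \<in> carrier (Gal K N) \<longleftrightarrow> fixing_hom K N \<sigma> \<and> \<sigma> \<in> extensional N \<and> bij_betw \<sigma> N N"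
proof
  assume "\<sigma> \<in> carrier (Gal K N)"
  hence *: "\<sigma> \<in> Bij N" "\<sigma> \<in> ring_hom (\<Omega>\<lparr>carrier := N\<rparr>) (\<Omega>\<lparr>carrier := N\<rparr>)" "\<forall>x\<in>K. \<sigma> x = x"
    by (auto simp: Gal_def)
  thus "fixing_hom K N \<sigma> \<and> \<sigma> \<in> extensional N \<and> bij_betw \<sigma> N N"
    unfolding fixing_hom_def Bij_def ring_hom_def by auto
next
  assume *: "fixing_hom K N \<sigma> \<and> \<sigma> \<in> extensional N \<and> bij_betw \<sigma> N N"
  hence "\<sigma> 1 = 1" using K by (auto simp: fixing_hom_def)
  thus "\<sigma> \<in> carrier (Gal K N)" using * unfolding Gal_def fixing_hom_def Bij_def ring_hom_def by auto
qed

lemma mult_Gal: "\<sigma> \<in> carrier (Gal K N) \<Longrightarrow> \<tau> \<in> carrier (Gal K N) \<Longrightarrow> \<sigma> \<otimes>\<^bsub>Gal K N\<^esub> \<tau> = compose N \<sigma> \<tau>"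
  by (auto simp: Gal_def BijGroup_def)

lemma root_diff_prime_field:
  fixes \<theta> :: "'a::field"
  assumes ch: "CHAR('a) = p" "Factorial_Ring.prime p" and K: "subfield K \<Omega>" "subfield N \<Omega>" "K \<subseteq> N"
    and \<sigma>: "fixing_hom K N \<sigma>" and \<theta>: "\<theta> \<in> N" "\<theta> ^ p - \<theta> \<in> K"
  shows "\<sigma> \<theta> - \<theta> \<in> prime_field"
proof -
  note hom = fixing_hom_fix[OF \<sigma> K] fixing_hom_diff[OF \<sigma> K] fixing_hom_power[OF \<sigma> K]
  have "\<sigma> \<theta> ^ p - \<sigma> \<theta> = \<theta> ^ p - \<theta>" using hom(1)[OF \<theta>(2)] hom(2)[of "\<theta> ^ p" \<theta>] hom(3)[OF \<theta>(1)] \<theta>(1) K(2) by simp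
  hence "(\<sigma> \<theta> - \<theta>) ^ p = \<sigma> \<theta> - \<theta>" using artin_schrier_diff[OF ch, of "\<sigma> \<theta>" \<theta>] by simp
  thus ?thesis using prime_field_iff[OF ch] by blast
qed

lemma fixing_hom_agree:
  assumes K: "subfield K \<Omega>" "subfield N \<Omega>" "K \<subseteq> N" and \<sigma>: "fixing_hom K N \<sigma>" and \<tau>: "fixing_hom K N \<tau>"
  shows "subfield {z \<in> N. \<sigma> z = \<tau> z} \<Omega>" "K \<subseteq> {z \<in> N. \<sigma> z = \<tau> z}"
proof -
  note s = fixing_hom_fix[OF \<sigma> K] fixing_hom_diff[OF \<sigma> K] fixing_hom_add[OF \<sigma> K] fixing_hom_mult[OF \<sigma> K]
    fixing_hom_nonzero[OF \<sigma> K]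
  note t = fixing_hom_fix[OF \<tau> K] fixing_hom_diff[OF \<tau> K] fixing_hom_add[OF \<tau> K] fixing_hom_mult[OF \<tau> K]
  show "K \<subseteq> {z \<in> N. \<sigma> z = \<tau> z}" using s(1) t(1) K by auto
  show "subfield {z \<in> N. \<sigma> z = \<tau> z} \<Omega>"
  proof (rule subfield_ambientI)
    show "1 \<in> {z \<in> N. \<sigma> z = \<tau> z}" using s(1)[of 1] t(1)[of 1] K by simp
    fix x assume x: "x \<in> {z \<in> N. \<sigma> z = \<tau> z}"
    thus "- x \<in> {z \<in> N. \<sigma> z = \<tau> z}" using s(2)[of 0 x] t(2)[of 0 x] s(1)[of 0] t(1)[of 0] K by simp
    assume x0: "x \<noteq> 0"
    have "\<sigma> x * \<sigma> (inverse x) = 1" "\<tau> x * \<tau> (inverse x) = 1"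
      using s(4)[of x "inverse x"] t(4)[of x "inverse x"] s(1)[of 1] t(1)[of 1] x x0 K by simp_all
    hence "\<sigma> (inverse x) = \<tau> (inverse x)" using x by (metis (mono_tags, lifting) inverse_unique mem_Collect_eq)
    thus "inverse x \<in> {z \<in> N. \<sigma> z = \<tau> z}" using x K by simp
  qed (use s(3,4) t(3,4) K in auto)
qed

context artin_schrier
begin

lemma shift_hom: assumes b: "b \<in> prime_field" shows "fixing_hom F E (shift b)"
  unfolding fixing_hom_def by (simp add: shift_in[OF b] shift_add[OF b] shift_mult[OF b] shift_base[OF b])

lemma hom_unique:
  assumes "fixing_hom F E \<sigma>" "fixing_hom F E \<tau>" "\<sigma> \<theta> = \<tau> \<theta>" "z \<in> E" shows "\<sigma> z = \<tau> z"
proof -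
  have "E \<subseteq> {z \<in> E. \<sigma> z = \<tau> z}"
    by (rule E_least) (use fixing_hom_agree[OF F E_subfield F_subset assms(1,2)] assms(3) gen_in in auto)
  thus ?thesis using assms by auto
qed

lemma shift_bij: assumes b: "b \<in> prime_field" shows "bij_betw (shift b) E E"
  unfolding bij_betw_def
proof
  show "inj_on (shift b) E"
    using fixing_hom_inj[OF shift_hom[OF b] F E_subfield F_subset] by (auto simp: inj_on_def)
  show "shift b ` E = E" using shift_in[OF b] shift_surj[OF b] by (auto simp: image_iff) metis
qed

definition aut :: "'a \<Rightarrow> 'a \<Rightarrow> 'a" where "aut b = restrict (shift b) E"

lemma carrier_Gal: "carrier (Gal F E) = aut ` prime_field"
proof (intro equalityI subsetI)
  fix \<sigma> assume "\<sigma> \<in> carrier (Gal F E)"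
  hence \<sigma>: "fixing_hom F E \<sigma>" "\<sigma> \<in> extensional E" using carrier_Gal_iff[OF F E_subfield F_subset] by auto
  define b where "b = \<sigma> \<theta> - \<theta>"
  have b: "b \<in> prime_field" unfolding b_def
    by (rule root_diff_prime_field[OF CHAR prime F E_subfield F_subset \<sigma>(1) gen_in wp])
  have "\<sigma> z = shift b z" if "z \<in> E" for z
    by (rule hom_unique[OF \<sigma>(1) shift_hom[OF b] _ that]) (unfold shift_gen[OF b], simp add: b_def)
  hence "\<sigma> = aut b" unfolding aut_def using \<sigma>(2) by (intro extensionalityI[of _ E]) auto
  thus "\<sigma> \<in> aut ` prime_field" using b by blast
next
  fix \<sigma> assume "\<sigma> \<in> aut ` prime_field"
  then obtain b where b: "b \<in> prime_field" "\<sigma> = aut b" by blast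
  have "fixing_hom F E (aut b)" unfolding aut_def
    using fixing_hom_restrict[OF E_subfield F_subset] shift_hom[OF b(1)] by blast
  moreover have "bij_betw (aut b) E E" using shift_bij[OF b(1)] unfolding aut_def by (simp add: bij_betw_def inj_on_def cong: image_cong)
  ultimately show "\<sigma> \<in> carrier (Gal F E)"
    unfolding carrier_Gal_iff[OF F E_subfield F_subset] b(2) by (simp add: aut_def)
qed

lemma aut_gen: "b \<in> prime_field \<Longrightarrow> aut b \<theta> = \<theta> + b"
  using shift_gen gen_in by (simp add: aut_def)

lemma aut_hom: "b \<in> prime_field \<Longrightarrow> fixing_hom F E (aut b)"
  unfolding aut_def using fixing_hom_restrict[OF E_subfield F_subset] shift_hom by blast

end

context as_pair
begin

text \<open>
  The automorphism \<open>\<theta>\<^sub>1 \<mapsto> \<theta>\<^sub>1 + s\<close>, \<open>\<theta>\<^sub>2 \<mapsto> \<theta>\<^sub>2 + t\<close>, composed of the shifts of the two towers from \<open>K(\<theta>\<^sub>2)\<close> and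
  \<open>K(\<theta>\<^sub>1)\<close> to \<open>N\<close>, each of which fixes the other generator.
\<close>

definition sig :: "'a \<Rightarrow> 'a \<Rightarrow> 'a \<Rightarrow> 'a"
  where "sig s t = restrict (\<lambda>z. artin_schrier.shift (artin_schrier.E K \<theta>2) \<theta>1 s (A2.shift t z)) N"

lemma hom_unique:
  assumes "fixing_hom K N \<sigma>" "fixing_hom K N \<tau>" "\<sigma> \<theta>1 = \<tau> \<theta>1" "\<sigma> \<theta>2 = \<tau> \<theta>2" "z \<in> N"
  shows "\<sigma> z = \<tau> z"
proof -
  have "N \<subseteq> {z \<in> N. \<sigma> z = \<tau> z}"
    by (rule N_least) (use fixing_hom_agree[OF K_sf N_sf K_N assms(1,2)] assms(3,4) theta_N in auto)
  thus ?thesis using assms by auto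
qed

context
  fixes s t :: 'a
  assumes s: "s \<in> prime_field" and t: "t \<in> prime_field"
begin

lemma sig_hom: "fixing_hom K N (sig s t)"
  and sig_gen: "sig s t \<theta>1 = \<theta>1 + s" "sig s t \<theta>2 = \<theta>2 + t"
  and sig_bij: "bij_betw (sig s t) N N"
proof -
  interpret sw: as_pair K \<theta>2 \<theta>1 p by (rule swap)
  have E: "sw.A2.E = N" using sw.N_eq N_swap by simp
  have h1: "fixing_hom sw.A1.E N (sw.A2.shift s)" using sw.A2.shift_hom[OF s] by (simp add: E)
  have h2: "fixing_hom A1.E N (A2.shift t)" using A2.shift_hom[OF t] by (simp add: N_eq)
  have h1K: "fixing_hom K N (sw.A2.shift s)" by (rule fixing_hom_subset[OF h1 sw.A1.F_subset])
  have h2K: "fixing_hom K N (A2.shift t)" by (rule fixing_hom_subset[OF h2 A1.F_subset])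
  have tK: "t \<in> K" using t K_sf by auto
  have eq: "sig s t z = sw.A2.shift s (A2.shift t z)" if "z \<in> N" for z using that by (simp add: sig_def)
  have "fixing_hom K N (\<lambda>z. sw.A2.shift s (A2.shift t z))" by (rule fixing_hom_comp[OF h1K h2K])
  thus "fixing_hom K N (sig s t)" unfolding sig_def using fixing_hom_restrict[OF N_sf K_N] by blast
  have "A2.shift t \<theta>1 = \<theta>1" by (rule A2.shift_base[OF t A1.gen_in])
  thus "sig s t \<theta>1 = \<theta>1 + s" using eq[OF theta_N(1)] sw.A2.shift_gen[OF s] by simp
  have "sw.A2.shift s (\<theta>2 + t) = sw.A2.shift s \<theta>2 + sw.A2.shift s t"
    by (rule fixing_hom_add[OF h1K K_sf N_sf K_N theta_N(2)]) (use tK K_N in auto)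
  also have "\<dots> = \<theta>2 + t"
    using sw.A2.shift_base[OF s sw.A1.gen_in] fixing_hom_fix[OF h1K K_sf N_sf K_N tK] by simp
  finally show "sig s t \<theta>2 = \<theta>2 + t" using eq[OF theta_N(2)] A2.shift_gen[OF t] by simp
  have b1: "bij_betw (sw.A2.shift s) N N" using sw.A2.shift_bij[OF s] by (simp only: E)
  have b2: "bij_betw (A2.shift t) N N" using A2.shift_bij[OF t] by (simp only: N_eq)
  have "bij_betw (sw.A2.shift s \<circ> A2.shift t) N N" by (rule bij_betw_trans[OF b2 b1])
  thus "bij_betw (sig s t) N N"
    by (rule bij_betw_cong[THEN iffD1, rotated]) (simp add: eq)
qed

lemma sig_ext: "sig s t \<in> extensional N" by (simp add: sig_def)

lemma sig_Gal: "sig s t \<in> carrier (Gal K N)"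
  unfolding carrier_Gal_iff[OF K_sf N_sf K_N] using sig_hom sig_bij sig_ext by blast

end

lemma sig_line_hom: assumes t: "t \<in> prime_field" shows "fixing_hom A1.E N (sig 0 t)"
proof -
  note z0 = pf01(1)
  have id: "fixing_hom K N (\<lambda>z. z)" by (simp add: fixing_hom_def)
  have "A1.E \<subseteq> {z \<in> N. sig 0 t z = z}"
    by (rule A1.E_least) (use fixing_hom_agree[OF K_sf N_sf K_N sig_hom[OF z0 t] id] sig_gen[OF z0 t] theta_N in auto)
  thus ?thesis using sig_hom[OF z0 t] unfolding fixing_hom_def by blast
qed

lemma hom_eq_sig:
  assumes "fixing_hom K N \<sigma>"
  obtains s t where "s \<in> prime_field" "t \<in> prime_field" "\<sigma> \<theta>1 = \<theta>1 + s" "\<sigma> \<theta>2 = \<theta>2 + t"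
    "\<And>z. z \<in> N \<Longrightarrow> \<sigma> z = sig s t z"
proof -
  have st: "\<sigma> \<theta>1 - \<theta>1 \<in> prime_field" "\<sigma> \<theta>2 - \<theta>2 \<in> prime_field"
    using root_diff_prime_field[OF CHAR prime K_sf N_sf K_N assms] theta_N wp1 wp2 by blast+
  have eq: "\<sigma> z = sig (\<sigma> \<theta>1 - \<theta>1) (\<sigma> \<theta>2 - \<theta>2) z" if "z \<in> N" for z
    by (rule hom_unique[OF assms sig_hom[OF st] _ _ that]) (simp_all add: sig_gen[OF st])
  show thesis by (rule that[of "\<sigma> \<theta>1 - \<theta>1" "\<sigma> \<theta>2 - \<theta>2"]) (use st eq in auto)
qed

lemma carrier_Gal: "carrier (Gal K N) = (\<lambda>(s, t). sig s t) ` (prime_field \<times> prime_field)"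
proof (intro equalityI subsetI)
  fix \<sigma> assume "\<sigma> \<in> carrier (Gal K N)"
  hence \<sigma>: "fixing_hom K N \<sigma>" "\<sigma> \<in> extensional N" using carrier_Gal_iff[OF K_sf N_sf K_N] by auto
  obtain s t where st: "s \<in> prime_field" "t \<in> prime_field" "\<And>z. z \<in> N \<Longrightarrow> \<sigma> z = sig s t z"
    using hom_eq_sig[OF \<sigma>(1)] by metis
  hence "\<sigma> = sig s t" using \<sigma>(2) sig_ext[OF st(1,2)] by (intro extensionalityI[of _ N]) auto
  thus "\<sigma> \<in> (\<lambda>(s, t). sig s t) ` (prime_field \<times> prime_field)" using st by force
qed (auto simp: sig_Gal)

lemma sig_inj:
  assumes "s \<in> prime_field" "t \<in> prime_field" "s' \<in> prime_field" "t' \<in> prime_field" "sig s t = sig s' t'"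
  shows "s = s' \<and> t = t'"
  using sig_gen[OF assms(1,2)] sig_gen[OF assms(3,4)] assms(5) by auto

lemma pf_closed:
  "s \<in> prime_field \<Longrightarrow> t \<in> prime_field \<Longrightarrow> s + t \<in> (prime_field :: 'a set)"
  "s \<in> prime_field \<Longrightarrow> t \<in> prime_field \<Longrightarrow> s - t \<in> (prime_field :: 'a set)"
  "s \<in> prime_field \<Longrightarrow> t \<in> prime_field \<Longrightarrow> s * t \<in> (prime_field :: 'a set)"
  "s \<in> prime_field \<Longrightarrow> - s \<in> (prime_field :: 'a set)"
  using subfield_add[OF subfield_prime_field[OF CHAR prime]] subfield_diff[OF subfield_prime_field[OF CHAR prime]]
    subfield_mult[OF subfield_prime_field[OF CHAR prime]] subfield_uminus[OF subfield_prime_field[OF CHAR prime]]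
  by blast+

lemma sig_comp:
  assumes "s \<in> prime_field" "t \<in> prime_field" "s' \<in> prime_field" "t' \<in> prime_field" "z \<in> N"
  shows "sig s t (sig s' t' z) = sig (s + s') (t + t') z"
proof (rule hom_unique[OF _ _ _ _ assms(5)])
  note h = sig_hom[OF assms(1,2)]
  have K: "s' \<in> K" "t' \<in> K" using assms K_sf by auto
  hence KN: "s' \<in> N" "t' \<in> N" using K_N by auto
  show "fixing_hom K N (\<lambda>z. sig s t (sig s' t' z))"
    by (rule fixing_hom_comp[OF h sig_hom[OF assms(3,4)]])
  show "fixing_hom K N (sig (s + s') (t + t'))" by (rule sig_hom) (use assms pf_closed in auto)
  have pf: "s + s' \<in> prime_field" "t + t' \<in> prime_field" using pf_closed(1) assms by blast+
  show "sig s t (sig s' t' \<theta>1) = sig (s + s') (t + t') \<theta>1"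
    unfolding sig_gen[OF assms(3,4)] sig_gen[OF pf]
    using fixing_hom_add[OF h K_sf N_sf K_N theta_N(1) KN(1)] fixing_hom_fix[OF h K_sf N_sf K_N K(1)]
      sig_gen[OF assms(1,2)] by simp
  show "sig s t (sig s' t' \<theta>2) = sig (s + s') (t + t') \<theta>2"
    unfolding sig_gen[OF assms(3,4)] sig_gen[OF pf]
    using fixing_hom_add[OF h K_sf N_sf K_N theta_N(2) KN(2)] fixing_hom_fix[OF h K_sf N_sf K_N K(2)]
      sig_gen[OF assms(1,2)] by simp
qed

end

section \<open>Roots and integrality\<close>

lemma synthetic_div_over:
  assumes R: "ring_set R" and c: "c \<in> R" and q: "poly_over R q"
  shows "poly_over R (synthetic_div q c) \<and> poly q c \<in> R"
  using q
proof (induction q)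
  case 0 thus ?case using ring_set_zero[OF R] by (auto simp: poly_over_def)
next
  case (pCons a q)
  have aq: "a \<in> R" "poly_over R q"
  proof -
    have c: "Polynomial.coeff (pCons a q) i \<in> R" for i using pCons.prems by (simp add: poly_over_def)
    show "a \<in> R" using c[of 0] by simp
    show "poly_over R q" unfolding poly_over_def using c[of "Suc _"] by simp
  qed
  hence IH: "poly_over R (synthetic_div q c)" "poly q c \<in> R" using pCons.IH by auto
  show ?case
  proof
    show "poly_over R (synthetic_div (pCons a q) c)"
      using IH by (auto simp: poly_over_def coeff_pCons split: nat.splits)
    show "poly (pCons a q) c \<in> R" using IH aq c ring_set_closed(4,6)[OF R] by simp
  qed
qed

text \<open>
  Synthetic division by \<open>X - r\<close> for \<open>r \<in> S\<close> keeps the coefficients in \<open>R\<close>.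
\<close>

lemma factor_roots_integral:
  assumes R: "ring_set R" and S: "finite S" "S \<subseteq> R" and q: "poly_over R q"
    and roots: "\<And>r. r \<in> S \<Longrightarrow> poly q r = 0" and z: "z \<in> R"
  shows "\<exists>h\<in>R. poly q z = (\<Prod>r\<in>S. z - r) * h"
  using S q roots
proof (induction S arbitrary: q rule: finite_induct)
  case empty
  thus ?case using synthetic_div_over[OF R z] by auto
next
  case (insert r S)
  let ?q = "synthetic_div q r"
  have qr: "poly q r = 0" by (rule insert.prems) simp
  have eq: "poly q y = (y - r) * poly ?q y" for y
    using arg_cong[OF synthetic_div_correct'[of r q], of "\<lambda>P. poly P y"] qr by (simp add: algebra_simps)
  have "\<exists>h\<in>R. poly ?q z = (\<Prod>r\<in>S. z - r) * h"
  proof (rule insert.IH)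
    show "S \<subseteq> R" using insert.prems by auto
    show "poly_over R ?q" using synthetic_div_over[OF R _ insert.prems(2)] insert.prems(1) by auto
    fix r' assume r': "r' \<in> S"
    hence "(r' - r) * poly ?q r' = 0" using eq[of r'] insert.prems(3)[of r'] by simp
    moreover have "r' \<noteq> r" using r' insert.hyps by auto
    ultimately show "poly ?q r' = 0" by simp
  qed
  thus ?case using insert.hyps eq[of z] by (auto simp: mult.assoc)
qed

section \<open>The ramification function of a totally ramified compositum\<close>

lemma monic_poly_of_roots:
  fixes f :: "'a::field poly"
  assumes "finite A" "inj_on x A" "\<And>t. t \<in> A \<Longrightarrow> poly f (x t) = 0"
    and "Polynomial.degree f = card A" "Polynomial.lead_coeff f = 1"
  shows "poly f z = (\<Prod>t\<in>A. z - x t)"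
proof -
  let ?P = "\<Prod>t\<in>A. [:- x t, 1:]"
  have deg: "Polynomial.degree ?P = card A" by (subst degree_prod_eq_sum_degree) auto
  have lc: "Polynomial.lead_coeff ?P = 1" by (simp add: Polynomial.lead_coeff_prod)
  have "f = ?P"
  proof (rule poly_eqI_degree_lead_coeff[of _ "card A" _ "x ` A"])
    show "Polynomial.coeff f (card A) = Polynomial.coeff ?P (card A)" using assms(4,5) deg lc by simp
    show "card A \<le> card (x ` A)" using assms(2) by (simp add: card_image)
    show "Polynomial.degree f \<le> card A" "Polynomial.degree ?P \<le> card A" using assms(4) deg by simp_all
    fix z assume "z \<in> x ` A"
    thus "poly f z = poly ?P z" using assms(1,3) by (auto simp: poly_prod)
  qed
  thus ?thesis by (simp add: poly_prod)
qed

lemma (in valued_field) ring_set_integers: "ring_set {z \<in> N. val_ge w z 0}"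
  unfolding ring_set_def
proof (intro conjI ballI)
  show "1 \<in> {z \<in> N. val_ge w z 0}" using N by (simp add: val_ge_def)
  fix x y assume "x \<in> {z \<in> N. val_ge w z 0}" "y \<in> {z \<in> N. val_ge w z 0}"
  thus "x - y \<in> {z \<in> N. val_ge w z 0}" "x * y \<in> {z \<in> N. val_ge w z 0}"
    using N val_ge_diff[of x y 0] val_ge_mult0[of x y 0] by simp_all
qed

lemma (in valued_field) val_prod:
  "finite A \<Longrightarrow> (\<And>t. t \<in> A \<Longrightarrow> c t \<in> N \<and> c t \<noteq> 0) \<Longrightarrow> w (prod c A) = (\<Sum>t\<in>A. w (c t)) \<and> prod c A \<in> N \<and> prod c A \<noteq> 0"
  by (induction A rule: finite_induct) (use N in \<open>auto simp: val_mult\<close>)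

locale as_pair_total = as_pair_val K \<theta>1 \<theta>2 p v w k e
  for K :: "'a::field set" and \<theta>1 \<theta>2 :: 'a and p :: nat and v w :: "'a \<Rightarrow> int" and k :: "'a set" and e :: nat +
  fixes x :: 'a
  assumes e_eq: "e = p * p" and x: "x \<in> N" "x \<noteq> 0" "w x = 1"
begin

lemma pp: "p * p > 0" using p2 by simp

lemma dvd_K: "c \<in> K \<Longrightarrow> c \<noteq> 0 \<Longrightarrow> int (p * p) dvd w c"
  using val_K e_eq by simp

lemma invariant: "fixing_hom K N \<sigma> \<Longrightarrow> z \<in> N \<Longrightarrow> z \<noteq> 0 \<Longrightarrow> w (\<sigma> z) = w z"
  by (rule W.val_hom_invariant[OF K_sf K_N dimension_N pp dvd_K x])

definition D :: "'a \<Rightarrow> 'a \<Rightarrow> int" where "D s t = w (sig s t x - x)"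

lemma x_basis:
  assumes "z \<in> N"
  shows "\<exists>c. (\<forall>m<p*p. c m \<in> K) \<and> z = (\<Sum>m<p*p. c m * x ^ m) \<and> (\<forall>a. val_ge w z a \<longleftrightarrow> (\<forall>m<p*p. val_ge w (c m * x ^ m) a))"
  by (rule W.uniformizer_basis[OF K_sf K_N dimension_N dvd_K x assms])

lemma x_poly:
  assumes z: "z \<in> N" "val_ge w z 0"
  obtains q where "poly_over K q" "poly_over {z \<in> N. val_ge w z 0} q" "z = poly q x"
proof -
  obtain c where c: "\<forall>m<p*p. c m \<in> K" "z = (\<Sum>m<p*p. c m * x ^ m)" "\<forall>a. val_ge w z a \<longleftrightarrow> (\<forall>m<p*p. val_ge w (c m * x ^ m) a)"
    using x_basis[OF z(1)] by blast
  define q where "q = (\<Sum>m<p*p. Polynomial.monom (c m) m)"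
  have cq: "Polynomial.coeff q i = (if i < p*p then c i else 0)" for i
    by (auto simp: q_def Polynomial.coeff_sum sum.If_cases if_distrib cong: if_cong)
  have "val_ge w (c m) 0" if m: "m < p*p" for m
  proof (rule W.uniformizer_coeff_integral[OF _ _ x m])
    show "val_ge w (c m * x ^ m) 0" using c(3) z(2) m by blast
    show "c m \<in> N" using c(1) m K_N by blast
    show "int (p * p) dvd w (c m)" if "c m \<noteq> 0" using dvd_K[of "c m"] c(1) m that by blast
  qed
  hence "Polynomial.coeff q i \<in> {z \<in> N. val_ge w z 0} \<and> Polynomial.coeff q i \<in> K" for i
    using c(1) K_N K_sf N_sf unfolding cq by (auto simp: subset_iff)
  moreover have "z = poly q x" unfolding c(2) q_def by (simp add: poly_sum poly_monom)
  ultimately show thesis by (intro that[of q]) (auto simp: poly_over_def)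
qed

lemma hom_fixes_x:
  assumes \<sigma>: "fixing_hom K N \<sigma>" and "\<sigma> x = x" and z: "z \<in> N" shows "\<sigma> z = z"
proof -
  obtain c where c: "\<forall>m<p*p. c m \<in> K" "z = (\<Sum>m<p*p. c m * x ^ m)" using x_basis[OF z] by blast
  have cN: "c m * x ^ m \<in> N" if "m < p * p" for m
  proof -
    have "c m \<in> N" using c(1) K_N that by blast
    thus ?thesis using x N_sf by simp
  qed
  have "\<sigma> z = (\<Sum>m<p*p. \<sigma> (c m * x ^ m))" unfolding c(2)
    by (rule fixing_hom_sum[OF \<sigma> K_sf N_sf K_N]) (use cN in auto)
  also have "\<dots> = (\<Sum>m<p*p. c m * x ^ m)"
  proof (rule sum.cong[OF refl])
    fix m assume m: "m \<in> {..<p*p}"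
    hence cm: "c m \<in> K" "c m \<in> N" using c(1) K_N by auto
    have "\<sigma> (c m * x ^ m) = \<sigma> (c m) * \<sigma> (x ^ m)"
      by (rule fixing_hom_mult[OF \<sigma> K_sf N_sf K_N cm(2)]) (use x N_sf in simp)
    thus "\<sigma> (c m * x ^ m) = c m * x ^ m"
      using fixing_hom_power[OF \<sigma> K_sf N_sf K_N x(1), of m] fixing_hom_fix[OF \<sigma> K_sf N_sf K_N cm(1)] assms(2) by simp
  qed
  finally show ?thesis using c(2) by simp
qed

lemma sig_x_ne:
  assumes "s \<in> prime_field" "t \<in> prime_field" "\<not> (s = 0 \<and> t = 0)" shows "sig s t x - x \<noteq> 0"
proof
  assume "sig s t x - x = 0"
  hence "sig s t \<theta>1 = \<theta>1 \<and> sig s t \<theta>2 = \<theta>2"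
    using hom_fixes_x[OF sig_hom[OF assms(1,2)]] theta_N by simp
  thus False using sig_gen[OF assms(1,2)] assms(3) by simp
qed

lemma sig_N: "s \<in> prime_field \<Longrightarrow> t \<in> prime_field \<Longrightarrow> z \<in> N \<Longrightarrow> sig s t z \<in> N"
  using fixing_hom_in[OF sig_hom K_sf N_sf K_N] by blast

text \<open>
  An integral \<open>z\<close> is \<open>q(x)\<close> for a polynomial \<open>q\<close> with integral coefficients in \<open>K\<close>.  The
  polynomial \<open>q - z\<close> vanishes at \<open>x\<close>, so its value at the image of \<open>x\<close>, which is the change of \<open>z\<close>, is an
  integral multiple of the change of \<open>x\<close>.
\<close>

lemma sig_diff_ge_iff:
  assumes st: "s \<in> prime_field" "t \<in> prime_field" "\<not> (s = 0 \<and> t = 0)"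
  shows "(\<forall>z\<in>N. val_ge w z 0 \<longrightarrow> val_ge w (sig s t z - z) a) \<longleftrightarrow> a \<le> D s t"
proof
  assume "\<forall>z\<in>N. val_ge w z 0 \<longrightarrow> val_ge w (sig s t z - z) a"
  hence "val_ge w (sig s t x - x) a" using x by (simp add: val_ge_def)
  thus "a \<le> D s t" using sig_x_ne[OF st] by (simp add: D_def val_ge_def)
next
  assume a: "a \<le> D s t"
  let ?O = "{z \<in> N. val_ge w z 0}"
  note \<sigma> = sig_hom[OF st(1,2)]
  have sx: "sig s t x \<in> ?O" using invariant[OF \<sigma> x(1,2)] x sig_N[OF st(1,2) x(1)] by (simp add: val_ge_def)
  have xO: "x \<in> ?O" using x by (simp add: val_ge_def)
  show "\<forall>z\<in>N. val_ge w z 0 \<longrightarrow> val_ge w (sig s t z - z) a"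
  proof (intro ballI impI)
    fix z assume z: "z \<in> N" "val_ge w z 0"
    obtain q where q: "poly_over K q" "poly_over ?O q" "z = poly q x" using x_poly[OF z] .
    have qz: "poly_over ?O (q - [:z:])"
      using q(2) z ring_set_closed(2,3)[OF W.ring_set_integers]
      by (auto simp: poly_over_def coeff_pCons split: nat.splits) 
    obtain h where h: "h \<in> ?O" "poly (q - [:z:]) (sig s t x) = (\<Prod>r\<in>{x}. sig s t x - r) * h"
      using factor_roots_integral[OF W.ring_set_integers, of "{x}" "q - [:z:]" "sig s t x"] qz xO sx q(3) by auto
    have "sig s t z = poly q (sig s t x)" unfolding q(3)
      by (rule fixing_hom_poly[OF \<sigma> K_sf N_sf K_N q(1) x(1)])
    hence eq: "sig s t z - z = (sig s t x - x) * h" using h(2) by simp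
    have "val_ge w ((sig s t x - x) * h) (D s t + 0)"
      by (rule W.val_ge_mult) (use h sx x N_sf in \<open>auto simp: D_def val_ge_def\<close>)
    thus "val_ge w (sig s t z - z) a" unfolding eq by (rule val_ge_mono) (use a in simp)
  qed
qed

text \<open>
  The cocycle relation \<open>\<sigma>\<tau>x - x = \<sigma>(\<tau>x - x) + (\<sigma>x - x)\<close> and the invariance of \<open>w\<close>.
\<close>

lemma D_add:
  assumes s: "s \<in> prime_field" "t \<in> prime_field" "s' \<in> prime_field" "t' \<in> prime_field"
    and ge: "val_ge w (sig s t x - x) a" "val_ge w (sig s' t' x - x) a"
  shows "val_ge w (sig (s + s') (t + t') x - x) a"
proof -
  note \<sigma> = sig_hom[OF s(1,2)]
  have N': "sig s' t' x - x \<in> N" using sig_N[OF s(3,4) x(1)] x(1) N_sf by simp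
  have eq: "sig (s + s') (t + t') x - x = sig s t (sig s' t' x - x) + (sig s t x - x)"
    using sig_comp[OF s x(1)] fixing_hom_diff[OF \<sigma> K_sf N_sf K_N sig_N[OF s(3,4) x(1)] x(1)] by simp
  have "val_ge w (sig s t (sig s' t' x - x)) a"
  proof (cases "sig s' t' x - x = 0")
    case True
    hence "sig s t (sig s' t' x - x) = 0" using fixing_hom_fix[OF \<sigma> K_sf N_sf K_N, of 0] K_sf by simp
    thus ?thesis by simp
  next
    case False
    thus ?thesis using invariant[OF \<sigma> N' False] ge(2) by (simp add: val_ge_def)
  qed
  thus ?thesis unfolding eq using ge(1) N_sf sig_N[OF s(1,2)] N' x(1) by (intro W.val_ge_add) auto
qed

text \<open>
  Serre's relation between the ramification function of a group and that of a quotient (Local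
  Fields, Chapter IV, Proposition 3).  Let \<open>\<sigma>\<close> be the automorphism \<open>\<theta>\<^sub>1 \<mapsto> \<theta>\<^sub>1 + s\<close> that fixes \<open>\<theta>\<^sub>2\<close>, and let
  \<open>PI\<close> be the product of the differences \<open>\<sigma>x - \<tau>x\<close> over the automorphisms \<open>\<tau>\<close> fixing \<open>\<theta>\<^sub>1\<close>.  Its value is
  the sum in question.  It is the value at \<open>\<sigma>x\<close> of the minimal polynomial \<open>f\<close> of \<open>x\<close> over \<open>K(\<theta>\<^sub>1)\<close>.
  As the conjugate of \<open>f\<close> vanishes there, \<open>PI\<close> is a combination of the changes of the coefficients of \<open>f\<close>
  under \<open>\<sigma>\<close>, which \<open>val_hom_diff\<close> bounds from below.  In the other direction, write an element \<open>z\<close> of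
  \<open>K(\<theta>\<^sub>1)\<close> as \<open>q(x)\<close> with integral coefficients in \<open>K\<close>.  All conjugates of \<open>x\<close> over \<open>K(\<theta>\<^sub>1)\<close> are roots of
  \<open>q - z\<close>, so \<open>PI\<close> divides \<open>\<sigma>z - z\<close>, and \<open>uniformizer_hom_diff\<close> provides a \<open>z\<close> for which this has
  value \<open>p(n + 1)\<close>.
\<close>

theorem coset_sum:
  assumes red: "\<theta>1 ^ p - \<theta>1 \<noteq> 0" "v (\<theta>1 ^ p - \<theta>1) = - n" "n > 0" "\<not> int p dvd n"
    and s: "s \<in> prime_field" "s \<noteq> 0"
  shows "(\<Sum>t\<in>prime_field. D s t) = int p * (n + 1)"
proof -
  let ?F = "prime_field :: 'a set"
  let ?O = "{z \<in> N. val_ge w z 0}"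
  note pf = prime_field_eq_of_nat[OF CHAR prime]
  obtain d where d: "d > 0" "int e = int p * d" "ramified_artin_schrier N w K \<theta>1 p d n"
    by (rule ramified_first[OF red])
  have dp: "d = int p" using d(2) e_eq p2 by simp
  interpret R: ramified_artin_schrier N w K \<theta>1 p "int p" n using d(3) unfolding dp .
  define cx where "cx t = sig 0 t x" for t
  define y where "y = sig s 0 x"
  have z0: "(0::'a) \<in> ?F" by (rule pf01)
  have X_N: "cx t \<in> N" if "t \<in> ?F" for t unfolding cx_def by (rule sig_N[OF z0 that x(1)])
  have wX: "w (cx t) = 1" if "t \<in> ?F" for t
    unfolding cx_def using invariant[OF sig_hom[OF z0 that] x(1,2)] x by simp
  have XO: "cx t \<in> ?O" if "t \<in> ?F" for t using X_N[OF that] wX[OF that] by (simp add: val_ge_def)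
  have y: "y \<in> N" "w y = 1" unfolding y_def
    using sig_N[OF s(1) z0 x(1)] invariant[OF sig_hom[OF s(1) z0] x(1,2)] x by auto
  hence yO: "y \<in> ?O" by (simp add: val_ge_def)
  have XX: "y - cx t \<noteq> 0 \<and> w (y - cx t) = D s (- t)" if t: "t \<in> ?F" for t
  proof -
    have mt: "- t \<in> ?F" by (rule pf_closed(4)[OF t])
    have "cx t = sig 0 t x" by (simp add: cx_def)
    have "sig 0 t (sig s (- t) x) = y"
      using sig_comp[OF z0 t s(1) mt x(1)] by (simp add: y_def)
    hence eq: "y - cx t = sig 0 t (sig s (- t) x - x)"
      using fixing_hom_diff[OF sig_hom[OF z0 t] K_sf N_sf K_N sig_N[OF s(1) mt x(1)] x(1)] by (simp add: cx_def)
    have nz: "sig s (- t) x - x \<noteq> 0" by (rule sig_x_ne[OF s(1) mt]) (use s in auto)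
    have inN: "sig s (- t) x - x \<in> N" using sig_N[OF s(1) mt x(1)] x(1) N_sf by simp
    show ?thesis unfolding eq
      using invariant[OF sig_hom[OF z0 t] inN nz] fixing_hom_nonzero[OF sig_hom[OF z0 t] K_sf N_sf K_N inN nz]
      by (simp add: D_def)
  qed
  define PI where "PI = (\<Prod>t\<in>?F. y - cx t)"
  have PI: "w PI = (\<Sum>t\<in>?F. w (y - cx t)) \<and> PI \<in> N \<and> PI \<noteq> 0" unfolding PI_def
    by (rule W.val_prod[OF pf(3)]) (use XX y X_N N_sf in auto)
  have "(\<Sum>t\<in>?F. w (y - cx t)) = (\<Sum>t\<in>?F. D s (- t))" by (rule sum.cong) (use XX in auto)
  also have "\<dots> = (\<Sum>t\<in>?F. D s t)"
    by (rule sum.reindex_bij_witness[of _ uminus uminus]) (use pf_closed(4) in auto)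
  finally have wPI: "w PI = (\<Sum>t\<in>?F. D s t)" using PI by simp
  have injX: "inj_on cx ?F"
  proof (rule inj_onI, rule ccontr)
    fix t t' assume t: "t \<in> ?F" "t' \<in> ?F" "cx t = cx t'" "t \<noteq> t'"
    have mt: "t - t' \<in> ?F" by (rule pf_closed(2)[OF t(1,2)])
    have "sig 0 t' (sig 0 (t - t') x) = cx t" using sig_comp[OF z0 t(2) z0 mt x(1)] by (simp add: cx_def)
    hence "sig 0 t' (sig 0 (t - t') x - x) = 0"
      using fixing_hom_diff[OF sig_hom[OF z0 t(2)] K_sf N_sf K_N sig_N[OF z0 mt x(1)] x(1)] t(3) by (simp add: cx_def)
    moreover have "sig 0 (t - t') x - x \<noteq> 0" by (rule sig_x_ne[OF z0 mt]) (use t in auto)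
    moreover have "sig 0 (t - t') x - x \<in> N" using sig_N[OF z0 mt x(1)] x(1) N_sf by simp
    ultimately show False using fixing_hom_nonzero[OF sig_hom[OF z0 t(2)] K_sf N_sf K_N] by blast
  qed
  note fixE = sig_line_hom
  note fE = A1.E_subfield N_sf E1_N
  define \<sigma> where "\<sigma> = sig s 0"
  have sh: "fixing_hom K N \<sigma>" "\<sigma> \<theta>1 = \<theta>1 + s" unfolding \<sigma>_def using sig_hom[OF s(1) z0] sig_gen[OF s(1) z0] by auto
  have yx: "y = \<sigma> x" by (simp add: y_def \<sigma>_def)
  have dvdE: "int p dvd w c" if "c \<in> A1.E" "c \<noteq> 0" for c using R.dvd_E that by blast
  have dimE: "amb.dimension p A1.E N" using A2.dimension_E by (simp add: N_eq)
  have ge: "int p * (n + 1) \<le> w PI"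
  proof -
    obtain c where c: "\<forall>m<p. c m \<in> A1.E" "x ^ p = (\<Sum>m<p. c m * x ^ m)"
      "\<forall>a. val_ge w (x ^ p) a \<longleftrightarrow> (\<forall>m<p. val_ge w (c m * x ^ m) a)"
      using W.uniformizer_basis[OF A1.E_subfield E1_N dimE dvdE x subfield_power[OF N_sf x(1), of p]] by blast
    have cN: "c m \<in> N" if "m < p" for m using c(1) E1_N that by blast
    have xpO: "val_ge w (x ^ p) 0" using W.val_ge_power[OF x(1), of 0 p] x by (simp add: val_ge_def)
    have cint: "val_ge w (c m) 0" if m: "m < p" for m
    proof (rule W.uniformizer_coeff_integral[OF _ cN[OF m] x m])
      show "val_ge w (c m * x ^ m) 0" using c(3) xpO m by blast
      show "int p dvd w (c m)" if "c m \<noteq> 0" using dvdE[of "c m"] c(1) m that by blast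
    qed
    define f where "f = Polynomial.monom 1 p - (\<Sum>m<p. Polynomial.monom (c m) m)"
    have degs: "Polynomial.degree (\<Sum>m<p. Polynomial.monom (c m) m) < p"
      using p2 by (intro degree_lessI) (auto simp: Polynomial.coeff_sum)
    have cf: "Polynomial.coeff f p = 1" by (simp add: f_def Polynomial.coeff_sum)
    have "Polynomial.degree f \<le> p" unfolding f_def
      by (rule degree_diff_le) (use degs in \<open>auto simp: degree_monom_eq\<close>)
    moreover have "p \<le> Polynomial.degree f" by (rule le_degree) (simp add: cf)
    ultimately have degf: "Polynomial.degree f = p" by simp
    have pf_z: "poly f z = z ^ p - (\<Sum>m<p. c m * z ^ m)" for z
      by (simp add: f_def poly_sum poly_monom)
    have fE': "poly_over A1.E f" unfolding f_def
      by (intro poly_over_diff poly_over_monom poly_over_sum) (use A1.E_subfield c(1) in auto)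
    have roots: "poly f (cx t) = 0" if t: "t \<in> ?F" for t
    proof -
      have "cx t = sig 0 t x" by (simp add: cx_def)
      hence "poly f (cx t) = sig 0 t (poly f x)"
        using fixing_hom_poly[OF fixE[OF t] fE fE' x(1)] by simp
      also have "poly f x = 0" using pf_z c(2) by simp
      also have "sig 0 t 0 = 0" using fixing_hom_fix[OF sig_hom[OF z0 t] K_sf N_sf K_N, of 0] K_sf by simp
      finally show ?thesis .
    qed
    have "poly f y = PI" unfolding PI_def
      by (rule monic_poly_of_roots[OF pf(3) injX roots]) (use degf cf pf(4) in auto)
    hence PIeq: "PI = y ^ p - (\<Sum>m<p. c m * y ^ m)" using pf_z by simp
    have "\<sigma> (x ^ p) = (\<Sum>m<p. \<sigma> (c m * x ^ m))" unfolding c(2)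
      by (rule fixing_hom_sum[OF sh(1) K_sf N_sf K_N]) (use cN x N_sf in simp)
    also have "\<dots> = (\<Sum>m<p. \<sigma> (c m) * y ^ m)"
    proof (rule sum.cong[OF refl])
      fix m assume "m \<in> {..<p}"
      thus "\<sigma> (c m * x ^ m) = \<sigma> (c m) * y ^ m"
        using fixing_hom_mult[OF sh(1) K_sf N_sf K_N cN[of m], of "x ^ m"] N_sf x(1)
          fixing_hom_power[OF sh(1) K_sf N_sf K_N x(1), of m] by (simp add: yx)
    qed
    finally have "y ^ p = (\<Sum>m<p. \<sigma> (c m) * y ^ m)"
      using fixing_hom_power[OF sh(1) K_sf N_sf K_N x(1), of p] by (simp add: yx)
    hence "PI = (\<Sum>m<p. (\<sigma> (c m) - c m) * y ^ m)"
      by (simp add: PIeq sum_subtractf left_diff_distrib)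
    moreover have "val_ge w (\<Sum>m<p. (\<sigma> (c m) - c m) * y ^ m) (int p * (n + 1))"
    proof (rule W.val_ge_sum)
      fix m assume m: "m \<in> {..<p}"
      have scN: "\<sigma> (c m) - c m \<in> N" using fixing_hom_in[OF sh(1) K_sf N_sf K_N cN[of m]] cN[of m] m N_sf by simp
      thus "(\<sigma> (c m) - c m) * y ^ m \<in> N" using y N_sf by simp
      have "val_ge w (\<sigma> (c m) - c m) (int p * (n + 1))"
        by (rule R.val_hom_diff[OF s(1) sh]) (use c(1) m cint in auto)
      moreover have "val_ge w (y ^ m) 0" using W.val_ge_power[OF y(1), of 0 m] y(2) by (simp add: val_ge_def)
      ultimately show "val_ge w ((\<sigma> (c m) - c m) * y ^ m) (int p * (n + 1))"
        using W.val_ge_mult[OF scN, of "y ^ m" "int p * (n + 1)" 0] y N_sf by simp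
    qed
    ultimately show ?thesis using PI by (simp add: val_ge_def)
  qed
  have le: "w PI \<le> int p * (n + 1)"
  proof -
    obtain \<pi> where pi: "\<pi> \<in> K" "\<pi> \<noteq> 0" "v \<pi> = 1" using discrete_valuation_uniformizer local_fieldD[OF K] by metis
    have wpi: "w \<pi> = int p * int p" using val_K[OF pi(1,2)] pi e_eq by simp
    obtain z where z: "z \<in> A1.E" "z \<noteq> 0" "w z = int p" "\<sigma> z - z \<noteq> 0" "w (\<sigma> z - z) = int p * (n + 1)"
      by (rule R.uniformizer_hom_diff[OF s(1) sh s(2) pi(1,2) wpi])
    have zN: "z \<in> N" "val_ge w z 0" using z E1_N by (auto simp: val_ge_def)
    obtain q where q: "poly_over K q" "poly_over ?O q" "z = poly q x" using x_poly[OF zN] .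
    have qz: "poly_over ?O (q - [:z:])"
      using q(2) zN ring_set_closed(2,3)[OF W.ring_set_integers]
      by (auto simp: poly_over_def coeff_pCons split: nat.splits)
    have roots: "poly (q - [:z:]) r = 0" if "r \<in> cx ` ?F" for r
    proof -
      obtain t where t: "t \<in> ?F" "r = sig 0 t x" using \<open>r \<in> cx ` ?F\<close> by (auto simp: cx_def)
      have "poly q r = sig 0 t z" unfolding t(2) q(3)
        by (rule fixing_hom_poly[OF sig_hom[OF z0 t(1)] K_sf N_sf K_N q(1) x(1), symmetric])
      also have "\<dots> = z" by (rule fixing_hom_fix[OF fixE[OF t(1)] fE z(1)])
      finally show ?thesis by simp
    qed
    obtain h where h: "h \<in> ?O" "poly (q - [:z:]) y = (\<Prod>r\<in>cx ` ?F. y - r) * h"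
      using factor_roots_integral[OF W.ring_set_integers, of "cx ` ?F" "q - [:z:]" y] pf(3) XO qz roots yO by blast
    have "(\<Prod>r\<in>cx ` ?F. y - r) = PI" unfolding PI_def by (rule prod.reindex_cong[OF injX]) auto
    moreover have "poly q y = \<sigma> z" unfolding yx q(3)
      by (rule fixing_hom_poly[OF sh(1) K_sf N_sf K_N q(1) x(1), symmetric])
    ultimately have eq: "\<sigma> z - z = PI * h" using h(2) by simp
    hence h0: "h \<noteq> 0" using z(4) by auto
    have "w (\<sigma> z - z) = w PI + w h" unfolding eq by (rule W.val_mult) (use PI h h0 in auto)
    moreover have "w h \<ge> 0" using h h0 by (simp add: val_ge_def)
    ultimately show ?thesis using z(5) by simp
  qed
  show ?thesis using ge le wPI by simp
qed

end

section \<open>Solving for the ramification function\<close>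

text \<open>
  Among the \<open>p + 1\<close> subextensions of degree \<open>p\<close>, the one generated by \<open>\<theta>\<^sub>1\<close> has jump \<open>l\<close>, and all others have
  jump \<open>i\<close>.
\<close>

locale as_pair_solved = as_pair_total K \<theta>1 \<theta>2 p v w k e x
  for K :: "'a::field set" and \<theta>1 \<theta>2 :: 'a and p :: nat and v w :: "'a \<Rightarrow> int" and k :: "'a set" and e :: nat and x :: 'a +
  fixes l i :: int
  assumes red1: "\<theta>1 ^ p - \<theta>1 \<noteq> 0" "v (\<theta>1 ^ p - \<theta>1) = - l" "l > 0" "\<not> int p dvd l"
    and red2: "a \<in> prime_field \<Longrightarrow> (\<theta>2 ^ p - \<theta>2) + a * (\<theta>1 ^ p - \<theta>1) \<noteq> 0"
      "a \<in> prime_field \<Longrightarrow> v ((\<theta>2 ^ p - \<theta>2) + a * (\<theta>1 ^ p - \<theta>1)) = - i"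
    and i: "\<not> int p dvd i" "l \<le> i"
begin

text \<open>
  This is \<open>coset_sum\<close> for the generator \<open>\<theta>\<^sub>2 + a\<theta>\<^sub>1\<close>: the automorphisms with \<open>t = c - a s\<close> are those that
  move it by \<open>c\<close>.
\<close>

lemma combined_coset_sum:
  assumes a: "a \<in> prime_field" and c: "c \<in> prime_field" "c \<noteq> 0"
  shows "(\<Sum>s\<in>prime_field. D s (c - a * s)) = int p * (i + 1)"
proof -
  let ?F = "prime_field :: 'a set"
  let ?th = "\<theta>2 + a * \<theta>1"
  have aK: "a \<in> K" using a K_sf by auto
  have wp: "?th ^ p - ?th = (\<theta>2 ^ p - \<theta>2) + a * (\<theta>1 ^ p - \<theta>1)"
    by (simp only: artin_schrier_add[OF CHAR prime] artin_schrier_scale[OF CHAR prime a])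
  have q: "as_pair K ?th \<theta>1 p"
  proof (rule as_pair.intro)
    show "?th ^ p - ?th \<in> K" unfolding wp using wp1 wp2 aK K_sf by (intro subfield_add subfield_mult) auto
    fix b c' assume b: "b \<in> ?F" "c' \<in> ?F" "b * ?th + c' * \<theta>1 \<in> K"
    have eq: "b * ?th + c' * \<theta>1 = (b * a + c') * \<theta>1 + b * \<theta>2" by (simp add: algebra_simps)
    have "b * a + c' = 0 \<and> b = 0"
      by (rule indep[OF pf_closed(1)[OF pf_closed(3)[OF b(1) a] b(2)] b(1) b(3)[unfolded eq]])
    thus "b = 0 \<and> c' = 0" by auto
  qed (use K_sf CHAR prime wp1 in auto)
  interpret Q: as_pair K ?th \<theta>1 p by (rule q)
  have QN: "Q.N = N"
  proof
    have aN: "a \<in> N" "a \<in> Q.N" using aK K_N Q.K_N by auto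
    show "Q.N \<subseteq> N" by (rule Q.N_least) (use N_sf K_N theta_N aN in auto)
    have "?th - a * \<theta>1 \<in> Q.N" by (rule subfield_diff[OF Q.N_sf Q.theta_N(1)]) (use Q.N_sf Q.theta_N aN in simp)
    thus "N \<subseteq> Q.N" by (intro N_least) (use Q.N_sf Q.K_N Q.theta_N in auto)
  qed
  interpret Q: as_pair_total K ?th \<theta>1 p v w k e x
    by (intro as_pair_total.intro as_pair_val.intro q as_pair_val_axioms.intro as_pair_total_axioms.intro)
      (use K k w e val_K e_eq x in \<open>auto simp: QN\<close>)
  have "Q.D c t = D t (c - a * t)" if t: "t \<in> ?F" for t
  proof -
    have ct: "c - a * t \<in> ?F" by (rule pf_closed(2)[OF c(1) pf_closed(3)[OF a t]])
    have tK: "t \<in> K" "c - a * t \<in> K" using t ct K_sf by auto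
    note \<sigma> = sig_hom[OF t ct]
    have "Q.sig c t x = sig t (c - a * t) x"
    proof (rule Q.hom_unique[unfolded QN, OF _ \<sigma> _ _ x(1)])
      show "fixing_hom K N (Q.sig c t)" using Q.sig_hom[OF c(1) t] by (simp add: QN)
      show "Q.sig c t \<theta>1 = sig t (c - a * t) \<theta>1" using Q.sig_gen(2)[OF c(1) t] sig_gen(1)[OF t ct] by simp
      have "sig t (c - a * t) ?th = sig t (c - a * t) \<theta>2 + sig t (c - a * t) a * sig t (c - a * t) \<theta>1"
        using fixing_hom_add[OF \<sigma> K_sf N_sf K_N theta_N(2), of "a * \<theta>1"]
          fixing_hom_mult[OF \<sigma> K_sf N_sf K_N _ theta_N(1), of a] aK K_N N_sf theta_N by auto
      also have "\<dots> = ?th + c"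
        unfolding fixing_hom_fix[OF \<sigma> K_sf N_sf K_N aK] sig_gen[OF t ct] by (simp add: algebra_simps)
      finally show "Q.sig c t ?th = sig t (c - a * t) ?th" using Q.sig_gen(1)[OF c(1) t] by simp
    qed
    thus ?thesis by (simp add: Q.D_def D_def)
  qed
  hence "(\<Sum>s\<in>?F. D s (c - a * s)) = (\<Sum>t\<in>?F. Q.D c t)" by (intro sum.cong) auto
  also have "\<dots> = int p * (i + 1)"
  proof (rule Q.coset_sum)
    show "?th ^ p - ?th \<noteq> 0" "v (?th ^ p - ?th) = - i" unfolding wp using red2[OF a] by blast+
    show "i > 0" using i(2) red1(3) by simp
  qed (use c i in blast)+
  finally show ?thesis .
qed

text \<open>
  Sum \<open>combined_coset_sum\<close>, with \<open>c = t\<close>, over all \<open>a\<close>.  The summands with \<open>s = 0\<close> contribute \<open>p D(0, t)\<close>.  For a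
  fixed \<open>s \<noteq> 0\<close> the second argument \<open>t - a s\<close> runs through the prime field, and \<open>coset_sum\<close> evaluates the sum.
\<close>

lemma D_fixing_theta1:
  assumes t: "t \<in> prime_field" "t \<noteq> 0"
  shows "D 0 t = l + 1 + int p * (i - l)"
proof -
  let ?F = "prime_field :: 'a set"
  note pf = prime_field_eq_of_nat[OF CHAR prime]
  have z0: "(0::'a) \<in> ?F" by (rule pf01)
  have "(\<Sum>a\<in>?F. \<Sum>s\<in>?F. D s (t - a * s)) = int p * (int p * (i + 1))"
    using combined_coset_sum[OF _ t] pf(4) by simp
  moreover have "(\<Sum>a\<in>?F. \<Sum>s\<in>?F. D s (t - a * s)) = (\<Sum>s\<in>?F. \<Sum>a\<in>?F. D s (t - a * s))" by (rule sum.swap)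
  moreover have "\<dots> = (\<Sum>a\<in>?F. D 0 (t - a * 0)) + (\<Sum>s\<in>?F - {0}. \<Sum>a\<in>?F. D s (t - a * s))"
    by (subst sum.remove[OF pf(3) z0]) (rule refl)
  moreover have "(\<Sum>s\<in>?F - {0}. \<Sum>a\<in>?F. D s (t - a * s)) = (\<Sum>s\<in>?F - {0}. int p * (l + 1))"
  proof (rule sum.cong[OF refl])
    fix s :: 'a assume "s \<in> ?F - {0}"
    hence s: "s \<in> ?F" "s \<noteq> 0" by auto
    have inv: "inverse s \<in> ?F" by (rule subfield_inverse[OF subfield_prime_field[OF CHAR prime] s(1)])
    have "(\<Sum>a\<in>?F. D s (t - a * s)) = (\<Sum>t'\<in>?F. D s t')"
    proof (rule sum.reindex_bij_witness[of _ "\<lambda>t'. (t - t') * inverse s" "\<lambda>a. t - a * s"])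
      fix a assume a: "a \<in> ?F"
      show "(t - (t - a * s)) * inverse s = a" using s by simp
      show "t - a * s \<in> ?F" by (rule pf_closed(2)[OF t(1) pf_closed(3)[OF a s(1)]])
    next
      fix t' assume t': "t' \<in> ?F"
      show "t - (t - t') * inverse s * s = t'" using s by (simp add: mult.assoc)
      show "(t - t') * inverse s \<in> ?F" by (rule pf_closed(3)[OF pf_closed(2)[OF t(1) t'] inv])
    qed simp
    thus "(\<Sum>a\<in>?F. D s (t - a * s)) = int p * (l + 1)" using coset_sum[OF red1 s] by simp
  qed
  moreover have "card (?F - {0}) = p - 1" using pf(3,4) z0 by simp
  ultimately have "int p * (int p * (i + 1)) = int p * D 0 t + (int p - 1) * (int p * (l + 1))"
    using pf(4) p2 by (simp add: of_nat_diff)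
  hence "int p * D 0 t = int p * (l + 1 + int p * (i - l))" by (simp add: algebra_simps)
  thus ?thesis using p2 by simp
qed

text \<open>
  The values \<open>D(s, t)\<close> for fixed \<open>s\<close> have average \<open>l + 1\<close>, so one of them is at least \<open>l + 1\<close>.  The others
  differ from it by automorphisms fixing \<open>\<theta>\<^sub>1\<close>, where \<open>D \<ge> l + 1\<close>; hence none is smaller, and all are equal.
\<close>

lemma D_moving_theta1:
  assumes s: "s \<in> prime_field" "s \<noteq> 0" and t: "t \<in> prime_field"
  shows "D s t = l + 1"
proof -
  let ?F = "prime_field :: 'a set"
  note pf = prime_field_eq_of_nat[OF CHAR prime]
  have z0: "(0::'a) \<in> ?F" by (rule pf01)
  note S = coset_sum[OF red1 s]
  have A: "l + 1 \<le> l + 1 + int p * (i - l)" using i(2) by simp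
  have ge: "l + 1 \<le> D s t'" if big: "l + 1 \<le> D s u" and u: "u \<in> ?F" and t': "t' \<in> ?F" for u t'
  proof (cases "t' = u")
    case False
    have tu: "t' - u \<in> ?F" "t' - u \<noteq> 0" using pf_closed(2)[OF t' u] False by auto
    have "val_ge w (sig (s + 0) (u + (t' - u)) x - x) (l + 1)"
    proof (rule D_add[OF s(1) u z0 tu(1)])
      show "val_ge w (sig s u x - x) (l + 1)" using big by (simp add: D_def val_ge_def)
      show "val_ge w (sig 0 (t' - u) x - x) (l + 1)"
        using D_fixing_theta1[OF tu] A by (simp add: D_def val_ge_def)
    qed
    thus ?thesis using sig_x_ne[OF s(1) t'] s by (simp add: D_def val_ge_def)
  qed (use big in simp)
  have "\<exists>u\<in>?F. l + 1 \<le> D s u"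
  proof (rule ccontr)
    assume "\<not> ?thesis"
    hence "D s t < l + 1" if "t \<in> ?F" for t using that not_le by blast
    moreover have "?F \<noteq> {}" using z0 by blast
    ultimately have "(\<Sum>t\<in>?F. D s t) < (\<Sum>t\<in>?F. l + 1)" using pf(3) by (intro sum_strict_mono)
    thus False using S pf(4) by simp
  qed
  then obtain u where u: "u \<in> ?F" "l + 1 \<le> D s u" by blast
  have all: "l + 1 \<le> D s t'" if "t' \<in> ?F" for t' using ge[OF u(2,1) that] .
  show ?thesis
  proof (rule ccontr)
    assume "D s t \<noteq> l + 1"
    hence "l + 1 < D s t" using all[OF t] by simp
    hence "(\<Sum>t\<in>?F. l + 1) < (\<Sum>t\<in>?F. D s t)" using all t pf(3) by (intro sum_strict_mono_ex1) auto
    thus False using S pf(4) by simp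
  qed
qed

end

section \<open>Herbrand functions of filtrations with two steps\<close>

definition card_ratio :: "'b set \<Rightarrow> 'b set \<Rightarrow> real"
  where "card_ratio A B = card B / card A"

context
  fixes K N :: "'a::field set" and v :: "'a \<Rightarrow> int" and b1 b2 :: int and A B C :: "('a \<Rightarrow> 'a) set"
  assumes b: "0 < b1" "b1 \<le> b2"
    and GA: "\<And>m. 0 \<le> m \<Longrightarrow> m \<le> b1 \<Longrightarrow> lower_group K v N m = A"
    and GB: "\<And>m. b1 < m \<Longrightarrow> m \<le> b2 \<Longrightarrow> lower_group K v N m = B"
    and GC: "\<And>m. b2 < m \<Longrightarrow> lower_group K v N m = C"
    and fin: "finite A" and sub: "C \<subseteq> B" "B \<subseteq> A" and ne: "C \<noteq> {}"
begin

lemma slopes: "0 < card_ratio A C" "card_ratio A C \<le> card_ratio A B" "card_ratio A B \<le> 1"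
proof -
  have fB: "finite B" by (rule finite_subset[OF sub(2) fin])
  have fC: "finite C" by (rule finite_subset[OF sub(1) fB])
  have "0 < card C" using fC ne by (simp add: card_gt_0_iff)
  moreover have "card C \<le> card B" by (rule card_mono[OF fB sub(1)])
  moreover have "card B \<le> card A" by (rule card_mono[OF fin sub(2)])
  ultimately show "0 < card_ratio A C" "card_ratio A C \<le> card_ratio A B" "card_ratio A B \<le> 1"
    unfolding card_ratio_def by (auto simp: divide_right_mono)
qed

lemma lower_group_step:
  assumes "u > -1"
  shows "lower_group_real K v N u = (if u \<le> b1 then A else if u \<le> b2 then B else C)"
proof -
  have "0 \<le> \<lceil>u\<rceil>" using assms by linarith
  moreover have "\<lceil>u\<rceil> \<le> b1 \<longleftrightarrow> u \<le> b1" "\<lceil>u\<rceil> \<le> b2 \<longleftrightarrow> u \<le> b2" by linarith+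
  ultimately show ?thesis unfolding lower_group_real_def using GA[of "\<lceil>u\<rceil>"] GB[of "\<lceil>u\<rceil>"] GC[of "\<lceil>u\<rceil>"] by force
qed

text \<open>
  Writing the step function as a combination of indicators reduces the Herbrand function to truncated
  lengths.
\<close>

lemma integrand_step:
  assumes "u > -1"
  shows "real (card (lower_group_real K v N u)) / real (card (lower_group K v N 0)) =
    card_ratio A C + (card_ratio A B - card_ratio A C) * indicator {..real_of_int b2} u + (1 - card_ratio A B) * indicator {..real_of_int b1} u"
proof -
  have A0: "lower_group K v N 0 = A" using GA[of 0] b by simp
  have "A \<noteq> {}" using sub ne by blast
  hence "card A > 0" using fin by (simp add: card_gt_0_iff)
  moreover have "real_of_int b1 \<le> real_of_int b2" using b by simp
  ultimately show ?thesis unfolding lower_group_step[OF assms] A0 using b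
    by (auto simp: card_ratio_def indicator_def)
qed

lemma integral_truncated:
  fixes t c :: real assumes "0 \<le> t" "0 < c"
  shows "has_bochner_integral lborel (indicator ({0<..<t} \<inter> {..c})) (min t c)"
proof -
  have "{0<..<t} \<inter> {..c} = (if t \<le> c then {0<..<t} else {0<..c})" using assms by auto
  moreover have "has_bochner_integral lborel (indicator {0<..<t}) (measure lborel {0<..<t})"
    "has_bochner_integral lborel (indicator {0<..c}) (measure lborel {0<..c})"
    using assms by (intro has_bochner_integral_real_indicator; simp)+
  ultimately show ?thesis using assms by (auto simp: min_def)
qed

text \<open>
  The Herbrand function has slope \<open>1\<close> up to \<open>b\<^sub>1\<close>, then \<open>|B|/|A|\<close> up to \<open>b\<^sub>2\<close>, and \<open>|C|/|A|\<close> from there on.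
\<close>

lemma herbrand_phi_eq:
  assumes "-1 \<le> t"
  shows "herbrand_phi K v N t = card_ratio A C * t + (card_ratio A B - card_ratio A C) * min t b2 + (1 - card_ratio A B) * min t b1"
proof (cases "0 \<le> t")
  case True
  let ?g = "\<lambda>u. real (card (lower_group_real K v N u)) / real (card (lower_group K v N 0))"
  have b': "0 < real_of_int b1" "0 < real_of_int b2" using b by auto
  have "has_bochner_integral lborel (indicator {0<..<t}) (measure lborel {0<..<t})"
    using True by (intro has_bochner_integral_real_indicator) auto
  hence I: "has_bochner_integral lborel (indicator {0<..<t}) t" using True by simp
  have "has_bochner_integral lborel
     (\<lambda>u. card_ratio A C * indicator {0<..<t} u + (card_ratio A B - card_ratio A C) * indicator ({0<..<t} \<inter> {..real_of_int b2}) u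
       + (1 - card_ratio A B) * indicator ({0<..<t} \<inter> {..real_of_int b1}) u)
     (card_ratio A C * t + (card_ratio A B - card_ratio A C) * min t b2 + (1 - card_ratio A B) * min t b1)"
    by (intro has_bochner_integral_add has_bochner_integral_mult_right I integral_truncated True b')
  hence "(LINT u|lborel. card_ratio A C * indicator {0<..<t} u + (card_ratio A B - card_ratio A C) * indicator ({0<..<t} \<inter> {..real_of_int b2}) u
       + (1 - card_ratio A B) * indicator ({0<..<t} \<inter> {..real_of_int b1}) u)
     = card_ratio A C * t + (card_ratio A B - card_ratio A C) * min t b2 + (1 - card_ratio A B) * min t b1"
    by (rule has_bochner_integral_integral_eq)
  moreover have "(LINT u|lborel. indicator {0<..<t} u *\<^sub>R ?g u) =
    (LINT u|lborel. card_ratio A C * indicator {0<..<t} u + (card_ratio A B - card_ratio A C) * indicator ({0<..<t} \<inter> {..real_of_int b2}) u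
       + (1 - card_ratio A B) * indicator ({0<..<t} \<inter> {..real_of_int b1}) u)"
  proof (rule Bochner_Integration.integral_cong[OF refl])
    fix u :: real
    show "indicator {0<..<t} u *\<^sub>R ?g u = card_ratio A C * indicator {0<..<t} u + (card_ratio A B - card_ratio A C) * indicator ({0<..<t} \<inter> {..real_of_int b2}) u
       + (1 - card_ratio A B) * indicator ({0<..<t} \<inter> {..real_of_int b1}) u"
    proof (cases "u \<in> {0<..<t}")
      case u: True
      hence "u > -1" by simp
      from integrand_step[OF this] u show ?thesis by (simp add: indicator_inter_arith)
    qed (simp add: indicator_inter_arith)
  qed
  moreover have "herbrand_phi K v N t = (LINT u|lborel. indicator {0<..<t} u *\<^sub>R ?g u)"
    using True unfolding herbrand_phi_def interval_lebesgue_integral_def set_lebesgue_integral_def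
    by (simp add: zero_ereal_def)
  ultimately show ?thesis by simp
next
  case False
  let ?g = "\<lambda>u. real (card (lower_group_real K v N u)) / real (card (lower_group K v N 0))"
  have "(LINT u|lborel. indicator {t<..<0} u *\<^sub>R ?g u) = (LINT u|lborel. indicator {t<..<0} u)"
  proof (rule Bochner_Integration.integral_cong[OF refl])
    fix u :: real
    show "indicator {t<..<0} u *\<^sub>R ?g u = indicator {t<..<0} u"
    proof (cases "u \<in> {t<..<0}")
      case u: True
      hence "u > -1" "u \<le> b1" "u \<le> b2" using assms b by auto
      thus ?thesis using integrand_step[of u] by (simp add: indicator_def)
    qed simp
  qed
  also have "\<dots> = - t" using False by simp
  finally have "herbrand_phi K v N t = t"
    using False unfolding herbrand_phi_def interval_lebesgue_integral_def set_lebesgue_integral_def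
    by (simp add: zero_ereal_def)
  moreover have "t \<le> b1" "t \<le> b2" using False b by auto
  ultimately show ?thesis by (simp add: algebra_simps)
qed

lemma herbrand_psi_phi: assumes "-1 \<le> t" shows "herbrand_psi K v N (herbrand_phi K v N t) = t"
  unfolding herbrand_psi_def
proof (rule the_inv_into_f_f)
  have mono: "herbrand_phi K v N s < herbrand_phi K v N t" if "-1 \<le> s" "s < t" for s t
  proof -
    have "card_ratio A C * s < card_ratio A C * t" using that slopes by simp
    moreover have "(card_ratio A B - card_ratio A C) * min s b2 \<le> (card_ratio A B - card_ratio A C) * min t b2"
      "(1 - card_ratio A B) * min s b1 \<le> (1 - card_ratio A B) * min t b1"
      using that slopes by (intro mult_left_mono; auto)+
    ultimately show ?thesis using herbrand_phi_eq[of s] herbrand_phi_eq[of t] that by linarith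
  qed
  show "inj_on (herbrand_phi K v N) {-1..}"
  proof (rule inj_onI)
    fix s t assume "s \<in> {-1..}" "t \<in> {-1..}" "herbrand_phi K v N s = herbrand_phi K v N t"
    thus "s = t" using mono[of s t] mono[of t s] by (cases s t rule: linorder_cases) auto
  qed
qed (use assms in auto)

lemma upper_group_step:
  fixes u :: real assumes "0 \<le> u"
  shows "upper_group K v N u = (if u \<le> b1 then A else if u \<le> b1 + (b2 - b1) * card_ratio A B then B else C)"
proof -
  let ?c = "b1 + (b2 - b1) * card_ratio A B"
  have sl2: "0 < card_ratio A B" using slopes by linarith
  have *: "upper_group K v N (herbrand_phi K v N t) = lower_group_real K v N t" if "0 \<le> t" for t
    using herbrand_psi_phi[of t] that by (simp add: upper_group_def)
  consider "u \<le> b1" | "b1 < u" "u \<le> ?c" | "?c < u" by linarith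
  thus ?thesis
  proof cases
    case 1
    have "real_of_int b1 \<le> real_of_int b2" using b by simp
    hence "herbrand_phi K v N u = u" using 1 assms by (simp add: herbrand_phi_eq algebra_simps)
    thus ?thesis using *[OF assms] lower_group_step[of u] 1 assms by simp
  next
    case 2
    define t where "t = b1 + (u - b1) / card_ratio A B"
    have "(u - b1) / card_ratio A B \<le> b2 - b1" using 2(2) sl2 by (simp add: pos_divide_le_eq)
    moreover have "0 < (u - b1) / card_ratio A B" using 2(1) sl2 by simp
    ultimately have t: "b1 < t" "t \<le> b2" "0 \<le> t" using b unfolding t_def by linarith+
    have "herbrand_phi K v N t = card_ratio A B * (t - b1) + b1" using t by (simp add: herbrand_phi_eq algebra_simps)
    also have "\<dots> = u" using sl2 by (simp add: t_def)
    finally show ?thesis using *[OF t(3)] lower_group_step[of t] 2 t by simp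
  next
    case 3
    define t where "t = b2 + (u - ?c) / card_ratio A C"
    have "0 \<le> (b2 - b1) * card_ratio A B" using sl2 b by simp
    hence cb: "b1 \<le> ?c" by simp
    have t: "b2 < t" using 3 slopes by (simp add: t_def)
    hence t': "b1 < t" "0 \<le> t" using b by linarith+
    have "herbrand_phi K v N t = card_ratio A C * (t - b2) + ?c" using t t' by (simp add: herbrand_phi_eq algebra_simps)
    also have "\<dots> = u" using slopes by (simp add: t_def)
    finally show ?thesis using *[OF t'(2)] lower_group_step[of t] 3 t t' cb by simp
  qed
qed

end

lemma UN_positive_eq:
  fixes g :: "real \<Rightarrow> 'b set"
  assumes "\<And>\<epsilon>. \<epsilon> > 0 \<Longrightarrow> g \<epsilon> \<subseteq> R" "\<epsilon>0 > 0" "g \<epsilon>0 = R"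
  shows "(\<Union>\<epsilon>\<in>{0<..}. g \<epsilon>) = R"
proof (intro equalityI UN_least)
  show "R \<subseteq> (\<Union>\<epsilon>\<in>{0<..}. g \<epsilon>)" using assms(2,3) by (metis UN_upper greaterThan_iff)
qed (use assms(1) in simp)

lemma upper_jumps_two_steps:
  assumes c: "0 \<le> c1" "c1 < c2" and sub: "C \<subset> B" "B \<subset> A"
    and U: "\<And>u. 0 \<le> u \<Longrightarrow> upper_group K v N u = (if u \<le> c1 then A else if u \<le> c2 then B else C)"
  shows "upper_jumps K v N = {c1, c2}"
proof -
  have CA: "C \<subseteq> A" "B \<subseteq> A" "C \<subseteq> B" using sub by blast+
  have R: "(\<Union>\<epsilon>\<in>{0<..}. upper_group K v N (u + \<epsilon>)) = (if u < c1 then A else if u < c2 then B else C)" if u: "0 \<le> u" for u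
  proof -
    have Ue: "upper_group K v N (u + \<epsilon>) = (if u + \<epsilon> \<le> c1 then A else if u + \<epsilon> \<le> c2 then B else C)" if "\<epsilon> > 0" for \<epsilon>
      by (rule U) (use u that in simp)
    consider "u < c1" | "c1 \<le> u" "u < c2" | "c2 \<le> u" by linarith
    thus ?thesis
    proof cases
      case 1
      have "(\<Union>\<epsilon>\<in>{0<..}. upper_group K v N (u + \<epsilon>)) = A"
        by (rule UN_positive_eq[of _ _ "c1 - u"]) (use 1 CA Ue U[of c1] c in \<open>simp_all\<close>)
      thus ?thesis using 1 by simp
    next
      case 2
      have "(\<Union>\<epsilon>\<in>{0<..}. upper_group K v N (u + \<epsilon>)) = B"
        by (rule UN_positive_eq[of _ _ "c2 - u"]) (use 2 CA Ue U[of c2] c in \<open>simp_all\<close>)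
      thus ?thesis using 2 by simp
    next
      case 3
      have "(\<Union>\<epsilon>\<in>{0<..}. upper_group K v N (u + \<epsilon>)) = C"
        by (rule UN_positive_eq[of _ _ 1]) (use 3 c CA Ue in \<open>simp_all\<close>)
      thus ?thesis using 3 c by simp
    qed
  qed
  have ne: "C \<noteq> B" "B \<noteq> A" using sub by blast+
  have "u \<in> upper_jumps K v N \<longleftrightarrow> u = c1 \<or> u = c2" for u
  proof (cases "0 \<le> u")
    case True
    hence "u \<in> upper_jumps K v N \<longleftrightarrow> (if u \<le> c1 then A else if u \<le> c2 then B else C) \<noteq>
     (if u < c1 then A else if u < c2 then B else C)"
      unfolding upper_jumps_def mem_Collect_eq U[OF True] R[OF True] by blast
    also have "\<dots> \<longleftrightarrow> u = c1 \<or> u = c2"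
      using c ne by (cases u c1 rule: linorder_cases; cases u c2 rule: linorder_cases) simp_all
    finally show ?thesis .
  qed (use c in \<open>auto simp: upper_jumps_def\<close>)
  thus ?thesis by blast
qed

lemma upper_jumps_one_step:
  assumes c: "0 \<le> c1" and sub: "C \<subset> A"
    and U: "\<And>u. 0 \<le> u \<Longrightarrow> upper_group K v N u = (if u \<le> c1 then A else C)"
  shows "upper_jumps K v N = {c1}"
proof -
  have CA: "C \<subseteq> A" using sub by blast
  have R: "(\<Union>\<epsilon>\<in>{0<..}. upper_group K v N (u + \<epsilon>)) = (if u < c1 then A else C)" if u: "0 \<le> u" for u
  proof -
    have Ue: "upper_group K v N (u + \<epsilon>) = (if u + \<epsilon> \<le> c1 then A else C)" if "\<epsilon> > 0" for \<epsilon>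
      by (rule U) (use u that in simp)
    show ?thesis
    proof (cases "u < c1")
      case True
      have "(\<Union>\<epsilon>\<in>{0<..}. upper_group K v N (u + \<epsilon>)) = A"
        by (rule UN_positive_eq[of _ _ "c1 - u"]) (use True CA Ue U[of c1] c in \<open>simp_all\<close>)
      thus ?thesis using True by simp
    next
      case False
      have "(\<Union>\<epsilon>\<in>{0<..}. upper_group K v N (u + \<epsilon>)) = C"
        by (rule UN_positive_eq[of _ _ 1]) (use False CA Ue in \<open>simp_all\<close>)
      thus ?thesis using False by simp
    qed
  qed
  have ne: "C \<noteq> A" using sub by blast
  have "u \<in> upper_jumps K v N \<longleftrightarrow> u = c1" for u
  proof (cases "0 \<le> u")
    case True
    hence "u \<in> upper_jumps K v N \<longleftrightarrow> (if u \<le> c1 then A else C) \<noteq> (if u < c1 then A else C)"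
      unfolding upper_jumps_def mem_Collect_eq U[OF True] R[OF True] by blast
    also have "\<dots> \<longleftrightarrow> u = c1"
      using ne by (cases u c1 rule: linorder_cases) simp_all
    finally show ?thesis .
  qed (use c in \<open>auto simp: upper_jumps_def\<close>)
  thus ?thesis by blast
qed

lemma one_break:
  assumes b: "0 < (b1::int)"
    and GA: "\<And>m. 0 \<le> m \<Longrightarrow> m \<le> b1 \<Longrightarrow> lower_group K v N m = A"
    and GC: "\<And>m. b1 < m \<Longrightarrow> lower_group K v N m = C"
    and fin: "finite A" and sub: "C \<subset> A" and ne: "C \<noteq> {}"
  shows "upper_jumps K v N = {real_of_int b1}" "upper_group K v N b1 = A"
proof -
  have U: "upper_group K v N u = (if u \<le> b1 then A else C)" if "0 \<le> u" for u
  proof -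
    have CA: "C \<subseteq> A" using sub by blast
    have "upper_group K v N u = (if u \<le> b1 then A else if u \<le> b1 + (b1 - b1) * card_ratio A C then C else C)"
      by (rule upper_group_step[OF b order_refl GA _ GC fin subset_refl CA ne that]) simp_all
    thus ?thesis by simp
  qed
  show "upper_jumps K v N = {real_of_int b1}" by (rule upper_jumps_one_step[OF _ sub U]) (use b in auto)
  show "upper_group K v N b1 = A" using U[of b1] b by simp
qed

lemma two_breaks:
  assumes b: "0 < (b1::int)" "b1 < (b2::int)"
    and GA: "\<And>m. 0 \<le> m \<Longrightarrow> m \<le> b1 \<Longrightarrow> lower_group K v N m = A"
    and GB: "\<And>m. b1 < m \<Longrightarrow> m \<le> b2 \<Longrightarrow> lower_group K v N m = B"
    and GC: "\<And>m. b2 < m \<Longrightarrow> lower_group K v N m = C"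
    and fin: "finite A" and sub: "C \<subset> B" "B \<subset> A" and ne: "C \<noteq> {}"
    and c2: "c2 = b1 + (b2 - b1) * (card B / card A)"
  shows "upper_jumps K v N = {real_of_int b1, c2}" "upper_group K v N b1 = A" "upper_group K v N c2 = B"
proof -
  have U: "upper_group K v N u = (if u \<le> b1 then A else if u \<le> c2 then B else C)" if "0 \<le> u" for u
  proof -
    have CB: "C \<subseteq> B" "B \<subseteq> A" "b1 \<le> b2" using sub b by auto
    from upper_group_step[OF b(1) CB(3) GA GB GC fin CB(1,2) ne that] show ?thesis
      by (simp add: card_ratio_def c2)
  qed
  have "B \<noteq> {}" "finite B" using sub fin finite_subset by blast+
  hence "0 < card B" by (simp add: card_gt_0_iff)
  moreover have "card B < card A" using sub fin by (intro psubset_card_mono)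
  ultimately have "0 < real (card B) / real (card A)" by simp
  moreover have "0 < real_of_int b2 - real_of_int b1" using b by simp
  ultimately have "0 < (real_of_int b2 - real_of_int b1) * (real (card B) / real (card A))"
    by (intro mult_pos_pos)
  hence lt: "real_of_int b1 < c2" unfolding c2 by simp
  show "upper_jumps K v N = {real_of_int b1, c2}"
    by (rule upper_jumps_two_steps[OF _ lt sub U]) (use b in auto)
  show "upper_group K v N b1 = A" "upper_group K v N c2 = B" using U[of b1] U[of c2] b lt by auto
qed

section \<open>The valuation of an extension\<close>

lemma val_ext_cases:
  assumes K: "discrete_valuation K v" and N: "subfield N \<Omega>" "K \<subseteq> N" and dim: "amb.dimension n K N"
  obtains e where "e > 0" "discrete_valuation N (val_ext K v N)"
    "\<forall>x\<in>K - {0}. val_ext K v N x = int e * v x"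
    "ramification_index K v N = e" "extension_degree K N = n"
proof -
  have "\<exists>w. discrete_valuation N w \<and> (\<exists>e>0. \<forall>x\<in>K - {0}. w x = int e * v x)"
    by (rule exists_valuation_extension[OF K N dim]) blast
  hence "discrete_valuation N (val_ext K v N) \<and> (\<exists>e>0. \<forall>x\<in>K - {0}. val_ext K v N x = int e * v x)"
    unfolding val_ext_def by (rule someI_ex)
  then obtain e where e: "discrete_valuation N (val_ext K v N)" "e > 0" "\<forall>x\<in>K - {0}. val_ext K v N x = int e * v x"
    by blast
  obtain \<pi> where pi: "\<pi> \<in> K" "\<pi> \<noteq> 0" "v \<pi> = 1" using discrete_valuation_uniformizer[OF K] .
  have "ramification_index K v N = e" unfolding ramification_index_def
  proof (rule the_equality)
    fix e' :: nat assume e': "\<forall>x\<in>K - {0}. val_ext K v N x = int e' * v x"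
    have "val_ext K v N \<pi> = int e' * v \<pi>" "val_ext K v N \<pi> = int e * v \<pi>" using e' e(3) pi(1,2) by blast+
    hence "int e' * v \<pi> = int e * v \<pi>" by (rule trans[OF sym])
    thus "e' = e" using pi(3) by simp
  qed (use e in blast)
  moreover have "extension_degree K N = n"
    unfolding extension_degree_def using amb.dimI[OF _ dim] K by (simp add: over_def discrete_valuation_def)
  ultimately show thesis using that[of e] e by blast
qed

lemma lower_group_iff:
  "\<sigma> \<in> lower_group K v N m \<longleftrightarrow> \<sigma> \<in> carrier (Gal K N) \<and>
     (\<forall>z\<in>N. val_ge (val_ext K v N) z 0 \<longrightarrow> val_ge (val_ext K v N) (\<sigma> z - z) (m + 1))"
  unfolding lower_group_def valuation_ring_def by blast

section \<open>The jump of one Artin--Schrier extension\<close>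

text \<open>
  By \<open>val_hom_diff\<close> and \<open>uniformizer_hom_diff\<close> with \<open>d = 1\<close>, the lower ramification group is everything up to
  index \<open>n\<close> and trivial afterwards.
\<close>

lemma artin_schrier_jump:
  assumes K: "local_field K v" and AS: "artin_schrier K \<theta> p"
    and red: "\<theta> ^ p - \<theta> \<noteq> 0" "v (\<theta> ^ p - \<theta>) = - n" "n > 0" "\<not> int p dvd n"
  shows "upper_jumps K v (artin_schrier.E K \<theta>) = {real_of_int n}"
proof -
  interpret artin_schrier K \<theta> p by fact
  note disc = local_fieldD(2)[OF K]
  obtain e where e: "e > 0" "discrete_valuation E (val_ext K v E)"
    "\<forall>x\<in>K - {0}. val_ext K v E x = int e * v x"
    "ramification_index K v E = e" "extension_degree K E = p"
    by (rule val_ext_cases[OF disc E_subfield F_subset dimension_E])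
  define w where "w = val_ext K v E"
  interpret W: valued_field E w using e(2) by (simp add: discrete_valuation_iff w_def)
  have wK: "w x = int e * v x" if "x \<in> K" "x \<noteq> 0" for x using e(3) that by (simp add: w_def)
  have "0 < int e" using e(1) by simp
  from W.ramified_artin_schrierI[OF AS F_subset gen_in this wK red]
  obtain d where d0: "d > 0" and d: "int e = int p * d" and ram: "ramified_artin_schrier E w K \<theta> p d n"
    by blast
  interpret R: ramified_artin_schrier E w K \<theta> p d n by (rule ram)
  obtain y where y: "y \<in> E" "y \<noteq> 0" "w y = 1" using discrete_valuation_uniformizer[OF e(2)] by (auto simp: w_def)
  have "d = 1" using R.dvd_E[OF y(1,2)] y(3) d0 by simp
  then interpret R: ramified_artin_schrier E w K \<theta> p 1 n using R.ramified_artin_schrier_axioms by simp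
  obtain \<pi> where pi: "\<pi> \<in> K" "\<pi> \<noteq> 0" "v \<pi> = 1" using discrete_valuation_uniformizer[OF disc] .
  have wpi: "w \<pi> = int p * 1" using wK[OF pi(1,2)] pi d \<open>d = 1\<close> by simp
  have pf: "(0::'a) \<in> prime_field" "(1::'a) \<in> prime_field"
    by (auto intro: range_eqI[of _ _ 0] range_eqI[of _ _ 1])
  have aut0: "aut 0 z = z" if "z \<in> E" for z
    by (rule hom_unique[OF aut_hom[OF pf(1)] _ _ that]) (auto simp: fixing_hom_def aut_gen[OF pf(1)])
  let ?A = "carrier (Gal K E)"
  have GA: "lower_group K v E m = ?A" if "0 \<le> m" "m \<le> n" for m
  proof (intro equalityI subsetI)
    fix \<sigma> assume \<sigma>: "\<sigma> \<in> ?A"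
    then obtain b where b: "b \<in> prime_field" "\<sigma> = aut b" unfolding carrier_Gal by blast
    have "val_ge w (\<sigma> z - z) (m + 1)" if "z \<in> E" "val_ge w z 0" for z
      using R.val_hom_diff[OF b(1) aut_hom[OF b(1)] aut_gen[OF b(1)] that] \<open>m \<le> n\<close> val_ge_mono
      unfolding b(2) by (metis add_le_cancel_right mult_1)
    thus "\<sigma> \<in> lower_group K v E m" using \<sigma> by (simp add: lower_group_iff w_def)
  qed (simp add: lower_group_iff)
  have GC: "lower_group K v E m = {aut 0}" if "n < m" for m
  proof (intro equalityI subsetI)
    fix \<sigma> assume \<sigma>: "\<sigma> \<in> lower_group K v E m"
    then obtain b where b: "b \<in> prime_field" "\<sigma> = aut b" unfolding lower_group_iff carrier_Gal by blast
    have "b = 0"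
    proof (rule ccontr)
      assume "b \<noteq> 0"
      obtain z where z: "z \<in> E" "z \<noteq> 0" "w z = 1" "\<sigma> z - z \<noteq> 0" "w (\<sigma> z - z) = 1 * (n + 1)"
        unfolding b(2) by (rule R.uniformizer_hom_diff[OF b(1) aut_hom[OF b(1)] aut_gen[OF b(1)] \<open>b \<noteq> 0\<close> pi(1,2) wpi])
      have "val_ge w z 0" using z(3) by (simp add: val_ge_def)
      hence "val_ge w (\<sigma> z - z) (m + 1)" using \<sigma> z(1) unfolding lower_group_iff w_def by blast
      thus False using z that by (simp add: val_ge_def)
    qed
    thus "\<sigma> \<in> {aut 0}" using b by simp
  next
    fix \<sigma> assume "\<sigma> \<in> {aut 0}"
    thus "\<sigma> \<in> lower_group K v E m" using aut0 pf unfolding lower_group_iff carrier_Gal by auto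
  qed
  show ?thesis
  proof (rule one_break(1)[OF red(3) GA GC])
    show "finite ?A" unfolding carrier_Gal using prime_field_eq_of_nat(3)[OF CHAR prime] by simp
    have "aut 1 \<noteq> aut 0" using aut_gen[OF pf(1)] aut_gen[OF pf(2)] by auto
    thus "{aut 0} \<subset> ?A" unfolding carrier_Gal using pf by blast
  qed auto
qed

section \<open>Galois groups as abstract groups\<close>

lemma of_int_prime_field_bij:
  assumes "CHAR('a::field) = p" "Factorial_Ring.prime p"
  shows "bij_betw (of_int :: int \<Rightarrow> 'a) {0..<int p} prime_field"
  unfolding bij_betw_def
proof
  have p: "p > 0" using prime_gt_0_nat[OF assms(2)] .
  show "inj_on (of_int :: int \<Rightarrow> 'a) {0..<int p}"
    using assms(1) by (auto simp: inj_on_def of_int_eq_iff_cong_CHAR cong_def)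
  show "(of_int :: int \<Rightarrow> 'a) ` {0..<int p} = prime_field"
  proof (intro equalityI subsetI)
    fix y :: 'a assume "y \<in> prime_field"
    then obtain z where z: "y = of_int z" by blast
    have "y = of_int (z mod int p)" using assms(1) by (simp add: z of_int_eq_iff_cong_CHAR)
    thus "y \<in> of_int ` {0..<int p}" using p by (intro image_eqI[of _ _ "z mod int p"]) auto
  qed auto
qed

context as_pair
begin

lemma of_int_add_mod: "(of_int ((a + b) mod int p) :: 'a) = of_int a + of_int b"
proof -
  have "(of_int ((a + b) mod int p) :: 'a) = of_int (a + b)"
    unfolding of_int_eq_iff_cong_CHAR by (simp add: CHAR cong_def)
  thus ?thesis by simp
qed

lemma p_neq_0: "p \<noteq> 0" using prime_gt_0_nat[OF prime] by simp

lemma sig_compose: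
  assumes "s \<in> prime_field" "t \<in> prime_field" "s' \<in> prime_field" "t' \<in> prime_field"
  shows "sig s t \<otimes>\<^bsub>Gal K N\<^esub> sig s' t' = sig (s + s') (t + t')"
proof -
  have st: "s + s' \<in> prime_field" "t + t' \<in> prime_field"
    by (rule pf_closed(1)[OF assms(1,3)], rule pf_closed(1)[OF assms(2,4)])
  have "compose N (sig s t) (sig s' t') = sig (s + s') (t + t')"
    by (rule extensionalityI[of _ N]) (use sig_ext[OF st] sig_comp[OF assms] in \<open>auto simp: compose_def\<close>)
  thus ?thesis using mult_Gal[OF sig_Gal[OF assms(1,2)] sig_Gal[OF assms(3,4)]] by simp
qed

text \<open>
  The automorphisms fixing \<open>\<theta>\<^sub>1\<close>.
\<close>

definition line :: "('a \<Rightarrow> 'a) set" where "line = sig 0 ` prime_field"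

lemma Gal_iso: "Gal K N \<cong> integer_mod_group p \<times>\<times> integer_mod_group p"
proof -
  let ?Z = "integer_mod_group p \<times>\<times> integer_mod_group p"
  let ?h = "\<lambda>(a, b). sig (of_int a) (of_int b)"
  note bij = of_int_prime_field_bij[OF CHAR prime]
  have car: "carrier ?Z = {0..<int p} \<times> {0..<int p}"
    using p_neq_0 by (simp add: DirProd_def carrier_integer_mod_group)
  have "?h \<in> iso ?Z (Gal K N)" unfolding iso_def hom_def mem_Collect_eq
  proof (intro conjI)
    show "?h \<in> carrier ?Z \<rightarrow> carrier (Gal K N)" using sig_Gal by auto
    show "\<forall>x\<in>carrier ?Z. \<forall>y\<in>carrier ?Z. ?h (x \<otimes>\<^bsub>?Z\<^esub> y) = ?h x \<otimes>\<^bsub>Gal K N\<^esub> ?h y"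
      by (auto simp: DirProd_def of_int_add_mod sig_compose)
    show "bij_betw ?h (carrier ?Z) (carrier (Gal K N))" unfolding bij_betw_def
    proof
      show "inj_on ?h (carrier ?Z)" unfolding car
      proof (rule inj_onI, clarify)
        fix a b a' b' :: int
        assume r: "a \<in> {0..<int p}" "b \<in> {0..<int p}" "a' \<in> {0..<int p}" "b' \<in> {0..<int p}"
          and eq: "sig (of_int a) (of_int b) = sig (of_int a') (of_int b')"
        have "(of_int a :: 'a) = of_int a' \<and> (of_int b :: 'a) = of_int b'"
          by (rule sig_inj[OF _ _ _ _ eq]) auto
        thus "a = a' \<and> b = b'" using r bij unfolding bij_betw_def inj_on_def by blast
      qed
      have "prime_field \<times> prime_field = (\<lambda>(a, b). (of_int a :: 'a, of_int b :: 'a)) ` ({0..<int p} \<times> {0..<int p})"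
        unfolding bij_betw_imp_surj_on[OF bij, symmetric] by auto
      thus "?h ` carrier ?Z = carrier (Gal K N)" unfolding carrier_Gal car
        by (simp add: image_image case_prod_beta)
    qed
  qed
  hence "?Z \<cong> Gal K N" unfolding is_iso_def by blast
  thus ?thesis by (rule group.iso_sym[rotated]) (simp add: DirProd_group)
qed

lemma line_iso: "(Gal K N)\<lparr>carrier := line\<rparr> \<cong> integer_mod_group p"
proof -
  let ?Z = "integer_mod_group p" and ?G = "(Gal K N)\<lparr>carrier := line\<rparr>"
  let ?h = "\<lambda>b. sig 0 (of_int b)"
  note bij = of_int_prime_field_bij[OF CHAR prime]
  have car: "carrier ?Z = {0..<int p}" using p_neq_0 by (simp add: carrier_integer_mod_group)
  have "?h \<in> iso ?Z ?G" unfolding iso_def hom_def mem_Collect_eq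
  proof (intro conjI)
    show "?h \<in> carrier ?Z \<rightarrow> carrier ?G" by (auto simp: line_def)
    show "\<forall>x\<in>carrier ?Z. \<forall>y\<in>carrier ?Z. ?h (x \<otimes>\<^bsub>?Z\<^esub> y) = ?h x \<otimes>\<^bsub>?G\<^esub> ?h y"
      using pf01 by (auto simp: of_int_add_mod sig_compose)
    show "bij_betw ?h (carrier ?Z) (carrier ?G)" unfolding bij_betw_def
    proof
      show "inj_on ?h (carrier ?Z)" unfolding car
      proof (rule inj_onI)
        fix b b' :: int
        assume r: "b \<in> {0..<int p}" "b' \<in> {0..<int p}" and eq: "sig 0 (of_int b) = sig 0 (of_int b')"
        have "(0::'a) = 0 \<and> (of_int b :: 'a) = of_int b'" by (rule sig_inj[OF pf01(1) _ pf01(1) _ eq]) auto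
        thus "b = b'" using r bij unfolding bij_betw_def inj_on_def by blast
      qed
      show "?h ` carrier ?Z = carrier ?G" unfolding car line_def
        using bij_betw_imp_surj_on[OF bij] by (simp add: image_image[symmetric, of "sig 0" of_int])
    qed
  qed
  hence "?Z \<cong> ?G" unfolding is_iso_def by blast
  thus ?thesis by (rule group.iso_sym[rotated]) simp
qed

lemma carrier_GalE:
  assumes "\<sigma> \<in> carrier (Gal K N)"
  obtains s t where "s \<in> prime_field" "t \<in> prime_field" "\<sigma> = sig s t"
proof -
  obtain z where z: "z \<in> prime_field \<times> prime_field" "\<sigma> = (\<lambda>(s, t). sig s t) z"
    using assms unfolding carrier_Gal by (elim imageE)
  show thesis by (rule that[of "fst z" "snd z"]) (use z in \<open>simp_all only: mem_Times_iff case_prod_beta\<close>)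
qed

lemma finite_Gal: "finite (carrier (Gal K N))"
  unfolding carrier_Gal using prime_field_eq_of_nat(3)[OF CHAR prime] by simp

lemma card_Gal: "card (carrier (Gal K N)) = p * p"
proof -
  have "inj_on (\<lambda>(s, t). sig s t) (prime_field \<times> prime_field)"
  proof (rule inj_onI, elim SigmaE, simp only: case_prod_conv prod.inject)
    fix s t s' t' :: 'a
    assume st: "s \<in> prime_field" "t \<in> prime_field" "s' \<in> prime_field" "t' \<in> prime_field"
      and eq: "sig s t = sig s' t'"
    show "s = s' \<and> t = t'" by (rule sig_inj[OF st eq])
  qed
  thus ?thesis unfolding carrier_Gal
    using prime_field_eq_of_nat(4)[OF CHAR prime] by (simp add: card_image card_cartesian_product)
qed

lemma card_line: "card line = p"
proof -
  have "inj_on (sig 0) prime_field"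
  proof (rule inj_onI)
    fix t t' :: 'a assume t: "t \<in> prime_field" "t' \<in> prime_field" "sig 0 t = sig 0 t'"
    show "t = t'" using sig_inj[OF pf01(1) t(1) pf01(1) t(2,3)] by simp
  qed
  thus ?thesis unfolding line_def using prime_field_eq_of_nat(4)[OF CHAR prime] by (simp add: card_image)
qed

lemma line_chain: "{sig 0 0} \<subset> line" "line \<subset> carrier (Gal K N)"
proof -
  have "sig 0 1 \<noteq> sig 0 0" using sig_inj[OF pf01(1,2) pf01(1,1)] by auto
  moreover have "sig 1 0 \<notin> line"
  proof
    assume "sig 1 0 \<in> line"
    then obtain t where t: "t \<in> prime_field" "sig 1 0 = sig 0 t" unfolding line_def by blast
    show False using sig_inj[OF pf01(2,1) pf01(1) t] by simp
  qed
  moreover have "sig 1 0 \<in> carrier (Gal K N)" by (rule sig_Gal[OF pf01(2,1)])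
  moreover have "line \<subseteq> carrier (Gal K N)" unfolding line_def using sig_Gal[OF pf01(1)] by blast
  moreover have "sig 0 1 \<in> line" "sig 0 0 \<in> line" using pf01 unfolding line_def by blast+
  ultimately show "{sig 0 0} \<subset> line" "line \<subset> carrier (Gal K N)" by blast+
qed

lemma sig_zero_id: "z \<in> N \<Longrightarrow> sig 0 0 z = z"
  by (rule hom_unique[OF sig_hom[OF pf01(1,1)]]) (auto simp: fixing_hom_def sig_gen[OF pf01(1,1)])

end

section \<open>Filtrations of the compositum\<close>

context as_pair_solved
begin

lemma lower_group_sig:
  assumes "w = val_ext K v N" "s \<in> prime_field" "t \<in> prime_field" "\<not> (s = 0 \<and> t = 0)"
  shows "sig s t \<in> lower_group K v N m \<longleftrightarrow> m + 1 \<le> D s t"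
  using sig_diff_ge_iff[OF assms(2-4), of "m + 1"] sig_Gal[OF assms(2,3)] unfolding lower_group_iff assms(1) by blast

lemma lower_group_id: "sig 0 0 \<in> lower_group K v N m"
  using sig_Gal[OF pf01(1,1)] by (simp add: lower_group_iff sig_zero_id)

lemma lower_groups:
  assumes w: "w = val_ext K v N"
  shows "m \<le> l \<Longrightarrow> lower_group K v N m = carrier (Gal K N)"
    and "l < m \<Longrightarrow> m \<le> l + int p * (i - l) \<Longrightarrow> lower_group K v N m = line"
    and "l + int p * (i - l) < m \<Longrightarrow> lower_group K v N m = {sig 0 0}"
proof -
  have nn: "0 \<le> int p * (i - l)" using i(2) by simp
  have mem: "sig s t \<in> lower_group K v N m \<longleftrightarrow> s = 0 \<and> t = 0 \<or> s = 0 \<and> m \<le> l + int p * (i - l) \<or> m \<le> l"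
    if st: "s \<in> prime_field" "t \<in> prime_field" for s t
  proof (cases "s = 0 \<and> t = 0")
    case True thus ?thesis using lower_group_id by simp
  next
    case False
    show ?thesis
    proof (cases "s = 0")
      case True
      hence D: "D s t = l + 1 + int p * (i - l)" using D_fixing_theta1[OF st(2)] False by simp
      have "sig s t \<in> lower_group K v N m \<longleftrightarrow> m \<le> l + int p * (i - l)"
        unfolding lower_group_sig[OF w st False, of m] D by linarith
      moreover have "m \<le> l \<Longrightarrow> m \<le> l + int p * (i - l)" using nn by linarith
      ultimately show ?thesis using False True by blast
    next
      case s: False
      have "sig s t \<in> lower_group K v N m \<longleftrightarrow> m \<le> l"
        unfolding lower_group_sig[OF w st False, of m] D_moving_theta1[OF st(1) s st(2)] by linarith
      thus ?thesis using s by blast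
    qed
  qed
  have sub: "lower_group K v N m \<subseteq> carrier (Gal K N)" by (auto simp: lower_group_iff)
  show "lower_group K v N m = carrier (Gal K N)" if "m \<le> l"
  proof (intro equalityI sub subsetI)
    fix \<sigma> assume "\<sigma> \<in> carrier (Gal K N)"
    then obtain s t where st: "s \<in> prime_field" "t \<in> prime_field" "\<sigma> = sig s t" by (rule carrier_GalE)
    show "\<sigma> \<in> lower_group K v N m" unfolding st(3) using mem[OF st(1,2)] that by blast
  qed
  show "lower_group K v N m = line" if "l < m" "m \<le> l + int p * (i - l)"
  proof (intro equalityI subsetI)
    fix \<sigma> assume \<sigma>: "\<sigma> \<in> lower_group K v N m"
    then obtain s t where st: "s \<in> prime_field" "t \<in> prime_field" "\<sigma> = sig s t" using sub carrier_GalE by blast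
    have "s = 0" using mem[OF st(1,2)] \<sigma>[unfolded st(3)] that(1) by linarith
    thus "\<sigma> \<in> line" using st(2,3) unfolding line_def by blast
  next
    fix \<sigma> assume "\<sigma> \<in> line"
    then obtain t where t: "t \<in> prime_field" "\<sigma> = sig 0 t" unfolding line_def by blast
    show "\<sigma> \<in> lower_group K v N m" unfolding t(2) using mem[OF pf01(1) t(1)] that(2) by blast
  qed
  show "lower_group K v N m = {sig 0 0}" if "l + int p * (i - l) < m"
  proof (intro equalityI subsetI)
    fix \<sigma> assume \<sigma>: "\<sigma> \<in> lower_group K v N m"
    then obtain s t where st: "s \<in> prime_field" "t \<in> prime_field" "\<sigma> = sig s t" using sub carrier_GalE by blast
    have "s = 0 \<and> t = 0" using mem[OF st(1,2)] \<sigma>[unfolded st(3)] that nn by linarith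
    thus "\<sigma> \<in> {sig 0 0}" using st by simp
  qed (use lower_group_id in auto)
qed

text \<open>
  The lower breaks \<open>l\<close> and \<open>l + p(i - l)\<close> correspond to the upper jumps \<open>l\<close> and \<open>l + p(i - l)/p = i\<close>.
\<close>

theorem two_jumps:
  assumes w: "w = val_ext K v N" and lt: "l < i"
  shows "upper_jumps K v N = {real_of_int l, real_of_int i}" "upper_group K v N l = carrier (Gal K N)"
    "upper_group K v N i = line"
proof -
  note L = lower_groups[OF w]
  have pp: "0 < int p * (i - l)" using lt p2 by simp
  have c2: "real_of_int i = l + (real_of_int (l + int p * (i - l)) - l) * (real (card line) / real (card (carrier (Gal K N))))"
    using p2 by (simp add: card_line card_Gal)
  have ne: "{sig 0 0} \<noteq> {}" by simp
  have lt': "l < l + int p * (i - l)" using pp by simp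
  note T = two_breaks[OF red1(3) lt' L(1) L(2) L(3) finite_Gal line_chain ne c2]
  show "upper_jumps K v N = {real_of_int l, real_of_int i}" "upper_group K v N l = carrier (Gal K N)"
    "upper_group K v N i = line" using T by auto
qed

theorem one_jump:
  assumes w: "w = val_ext K v N" and eq: "l = i"
  shows "upper_jumps K v N = {real_of_int i}" "upper_group K v N i = carrier (Gal K N)"
proof -
  note L = lower_groups[OF w]
  have GC: "lower_group K v N m = {sig 0 0}" if "i < m" for m using L(3)[of m] that eq by simp
  have GA: "lower_group K v N m = carrier (Gal K N)" if "m \<le> i" for m using L(1)[of m] that eq by simp
  have i0: "0 < i" using red1(3) eq by simp
  note T = one_break[OF i0 GA GC finite_Gal psubset_trans[OF line_chain]]
  show "upper_jumps K v N = {real_of_int i}" "upper_group K v N i = carrier (Gal K N)" using T by auto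
qed

end

context as_pair_val
begin

text \<open>
  An automorphism that moves \<open>\<theta>\<^sub>1\<close> changes this integral element by an element of the prime field, a unit,
  and so is not in the inertia group.  Those fixing \<open>\<theta>\<^sub>1\<close> belong to the ramified step from \<open>K(\<theta>\<^sub>1)\<close> to
  \<open>N\<close>, where \<open>val_hom_diff\<close> and \<open>uniformizer_hom_diff\<close> apply.
\<close>

theorem residual_filtration:
  assumes w': "w = val_ext K v N" and c: "\<theta>1 ^ p - \<theta>1 \<in> k"
    and red: "\<theta>2 ^ p - \<theta>2 \<noteq> 0" "v (\<theta>2 ^ p - \<theta>2) = - n" "n > 0" "\<not> int p dvd n"
  shows "e = p" "lower_group K v N 0 = line" "upper_jumps K v N = {real_of_int n}"
proof -
  show ep: "e = p" by (rule ramified_second(1)[OF c red])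
  interpret S: ramified_artin_schrier N w A1.E \<theta>2 p 1 n by (rule ramified_second(2)[OF c red])
  obtain \<pi> where pi: "\<pi> \<in> K" "\<pi> \<noteq> 0" "v \<pi> = 1" using discrete_valuation_uniformizer local_fieldD[OF K] by metis
  have pi1: "\<pi> \<in> A1.E" "w \<pi> = int p * 1" using pi A1.F_subset val_K[OF pi(1,2)] ep by auto
  have "val_ge w (\<theta>1 ^ p - \<theta>1) 0"
    using val_K[of "\<theta>1 ^ p - \<theta>1"] kD(2) kD(3)[OF c] c by (cases "\<theta>1 ^ p - \<theta>1 = 0") (auto simp: val_ge_def)
  hence th1: "val_ge w \<theta>1 0" by (rule W.val_root_nonneg[OF p2 theta_N(1)])
  note z0 = pf01(1)
  have GA: "lower_group K v N m = line" if m: "0 \<le> m" "m \<le> n" for m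
  proof (intro equalityI subsetI)
    fix \<sigma> assume \<sigma>: "\<sigma> \<in> lower_group K v N m"
    then obtain s t where st: "s \<in> prime_field" "t \<in> prime_field" "\<sigma> = sig s t"
      unfolding lower_group_iff using carrier_GalE by blast
    have "val_ge w (\<sigma> \<theta>1 - \<theta>1) (m + 1)" using \<sigma> th1 theta_N unfolding lower_group_iff w' by blast
    hence "val_ge w s (m + 1)" using sig_gen(1)[OF st(1,2)] st(3) by simp
    hence "s = 0" using W.val_prime_field[OF CHAR prime st(1)] m unfolding val_ge_def by (cases "s = 0") simp_all
    thus "\<sigma> \<in> line" using st(2,3) unfolding line_def by blast
  next
    fix \<sigma> assume "\<sigma> \<in> line"
    then obtain t where t: "t \<in> prime_field" "\<sigma> = sig 0 t" unfolding line_def by blast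
    have hom: "fixing_hom A1.E N (sig 0 t)" by (rule sig_line_hom[OF t(1)])
    have "val_ge w (\<sigma> z - z) (m + 1)" if "z \<in> N" "val_ge w z 0" for z
    proof (rule val_ge_mono)
      show "val_ge w (\<sigma> z - z) (1 * (n + 1))" unfolding t(2)
        by (rule S.val_hom_diff[OF t(1) hom sig_gen(2)[OF z0 t(1)]]) (use that N_eq in auto)
    qed (use m in simp)
    thus "\<sigma> \<in> lower_group K v N m" using sig_Gal[OF z0 t(1)] t(2) unfolding lower_group_iff w' by blast
  qed
  have GC: "lower_group K v N m = {sig 0 0}" if m: "n < m" for m
  proof (intro equalityI subsetI)
    fix \<sigma> assume \<sigma>: "\<sigma> \<in> lower_group K v N m"
    have "lower_group K v N m \<subseteq> lower_group K v N 0"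
    proof
      fix \<tau> assume "\<tau> \<in> lower_group K v N m"
      thus "\<tau> \<in> lower_group K v N 0" unfolding lower_group_iff
        using m red(3) val_ge_mono[of "val_ext K v N" _ "m + 1" "0 + 1"] by auto
    qed
    hence "\<sigma> \<in> line" using \<sigma> GA[of 0] red(3) by auto
    then obtain t where t: "t \<in> prime_field" "\<sigma> = sig 0 t" unfolding line_def by blast
    have "t = 0"
    proof (rule ccontr)
      assume "t \<noteq> 0"
      obtain z where z: "z \<in> A2.E" "z \<noteq> 0" "w z = 1" "\<sigma> z - z \<noteq> 0" "w (\<sigma> z - z) = 1 * (n + 1)"
        unfolding t(2)
        by (rule S.uniformizer_hom_diff[OF t(1) sig_line_hom[OF t(1)] sig_gen(2)[OF z0 t(1)] \<open>t \<noteq> 0\<close> pi1(1) pi(2) pi1(2)])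
      have "z \<in> N" "val_ge w z 0" using z N_eq by (auto simp: val_ge_def)
      hence "val_ge w (\<sigma> z - z) (m + 1)" using \<sigma> unfolding lower_group_iff w' by blast
      thus False using z m by (simp add: val_ge_def)
    qed
    thus "\<sigma> \<in> {sig 0 0}" using t by simp
  qed (use sig_Gal[OF z0 z0] in \<open>auto simp: lower_group_iff sig_zero_id\<close>)
  show "lower_group K v N 0 = line" using GA[of 0] red(3) by simp
  have finl: "finite line" using finite_Gal line_chain(2) finite_subset by blast
  show "upper_jumps K v N = {real_of_int n}"
    by (rule one_break(1)[OF red(3) GA GC finl line_chain(1)]) auto
qed

end

section \<open>The compositum of two Artin--Schrier extensions\<close>

lemma exists_pth_root:
  assumes "algebraic_closure (ring_of_type_algebra :: 'a::field ring) K" and p: "p > 0"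
  shows "\<exists>d::'a. d ^ p = c"
proof -
  interpret A: algebraic_closure "\<Omega> :: 'a ring" K by fact
  let ?P = "1 # replicate (p - 1) 0 @ [- c]"
  have P: "?P \<in> carrier (poly_ring \<Omega>)"
    by (simp add: univ_poly_def polynomial_def)
  have "amb.splitted ?P" by (rule A.roots_over_carrier[OF P])
  moreover have "Polynomials.degree ?P = p" using p by simp
  ultimately have "amb.roots ?P \<noteq> {#}" using p unfolding amb.splitted_def by auto
  then obtain d where "d \<in># amb.roots ?P" by blast
  hence "amb.is_root ?P d" using A.roots_mem_iff_is_root[OF P] by simp
  hence ev: "amb.eval ?P d = 0" by (simp add: amb.is_root_def)
  have pw: "d [^]\<^bsub>\<Omega>\<^esub> n = d ^ n" for n :: nat
    by (induction n) (simp_all add: mult.commute)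
  have z: "amb.eval (replicate n 0 @ [- c]) d = - c" for n by (induction n) simp_all
  have "amb.eval ?P d = d ^ p - c" using p z[of "p - 1"] by (simp add: pw)
  hence "d ^ p = c" using ev by simp
  thus ?thesis ..
qed

text \<open>
  A reduced element of positive value would be \<open>y\<^sup>p - y\<close> with \<open>y \<in> K\<close> by \<open>hensel_artin_schrier\<close>, and then all
  roots \<open>\<alpha>\<close> would lie in \<open>K\<close>.
\<close>

lemma artin_schrier_extension_generator:
  fixes K L :: "'a::field set"
  assumes L: "artin_schrier_extension p K f L" and K: "local_field K v" and f: "f \<in> K" "reduced_element p v f"
    and ch: "CHAR('a) = p" "Factorial_Ring.prime p"
  obtains \<alpha> n where "artin_schrier K \<alpha> p" "\<alpha> ^ p - \<alpha> = f" "L = artin_schrier.E K \<alpha>"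
    "v f = - n" "n > 0" "\<not> int p dvd n"
proof -
  have p2: "p \<ge> 2" using ch(2) by (rule prime_ge_2_nat)
  obtain \<alpha> where \<alpha>: "\<alpha> ^ p - \<alpha> = f" "\<alpha> \<notin> K" "L = generate_field \<Omega> (insert \<alpha> K)"
    using L by (auto simp: artin_schrier_extension_def)
  have K_sf: "subfield K \<Omega>" by (rule local_fieldD[OF K])
  have AS: "artin_schrier K \<alpha> p" by (rule artin_schrier.intro) (use K_sf ch \<alpha> f in auto)
  have ndvd: "\<not> int p dvd v f"
  proof
    assume "int p dvd v f"
    hence "int p dvd 1" using f(2) unfolding reduced_element_def by (meson coprime_common_divisor dvd_refl)
    thus False using p2 by simp
  qed
  have "v f < 0"
  proof (rule ccontr)
    assume "\<not> v f < 0"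
    moreover have "v f \<noteq> 0" using ndvd by auto
    ultimately have "val_ge v f 1" by (simp add: val_ge_def)
    then obtain y where y: "y \<in> K" "y ^ p - y = f" by (rule hensel_artin_schrier[OF K ch f(1)])
    have "(\<alpha> - y) ^ p - (\<alpha> - y) = 0" using artin_schrier_diff[OF ch, of \<alpha> y] \<alpha>(1) y(2) by simp
    hence "\<alpha> - y \<in> prime_field" using prime_field_iff[OF ch, of "\<alpha> - y"] by simp
    hence "(\<alpha> - y) + y \<in> K" using prime_field_subset[OF K_sf] y(1) K_sf by (intro subfield_add) auto
    thus False using \<alpha>(2) by simp
  qed
  thus thesis using AS \<alpha>(1,3) ndvd by (intro that[of \<alpha> "- v f"]) (auto simp: artin_schrier.E_def[OF AS])
qed

text \<open>
  If the sum were integral, \<open>x\<^sup>p - x\<close> would have the value of \<open>f\<close>, which is negative and prime to \<open>p\<close>; but its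
  negative values are multiples of \<open>p\<close>.
\<close>

lemma (in valued_field) no_residual_class:
  assumes ch: "CHAR('a) = p" "Factorial_Ring.prime p" and f: "f \<in> N" "f \<noteq> 0" "w f < 0" "\<not> int p dvd w f" and x: "x \<in> N"
  shows "\<not> val_ge w (f + x ^ p - x) 0"
proof
  assume ge: "val_ge w (f + x ^ p - x) 0"
  have p2: "p \<ge> 2" using ch(2) by (rule prime_ge_2_nat)
  define r where "r = f + x ^ p - x"
  have rN: "r \<in> N" using f x N by (simp add: r_def)
  have "val_ge w r (w f + 1)" by (rule val_ge_mono[OF ge[folded r_def]]) (use f in simp)
  hence v: "- f + r \<noteq> 0" "w (- f + r) = w (- f)" using val_add_eq[of "- f" r] f rN N by auto
  have eq: "- f + r = x ^ p - x" by (simp add: r_def)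
  have "int p * w x = w (x ^ p - x)"
    by (rule val_root_neg[OF p2 x]) (use v f eq in auto)
  hence "int p * w x = w f" using v eq f by simp
  thus False using f(4) by (metis dvd_triv_left)
qed

theorem proposition3p3:
  fixes K k L M :: "'a::field set" and v :: "'a \<Rightarrow> int" and p :: nat and f g :: 'a
    and i j :: real
  defines "N \<equiv> compositum L M"
  defines "G \<equiv> Gal K N"
  defines "h \<equiv> \<lambda>a x. f + a * g + x ^ p - x"
  assumes closure: "algebraic_closure (ring_of_type_algebra :: 'a ring) K"
    and char: "CHAR('a) = p" "p > 0"
    and K: "local_field K v"
    and k: "coefficient_field K v k"
    and f: "f \<in> K" "reduced_element p v f"
    and g: "g \<in> K" "reduced_element p v g"
    and L: "artin_schrier_extension p K f L" "totally_ramified K v L"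
    and M: "artin_schrier_extension p K g M" "totally_ramified K v M"
    and "L \<noteq> M"
    and separable: "residue_separable K v k N"
    and i: "i = upper_jump K v L"
    and j: "j = upper_jump K v M"
  shows
    "(i < j \<longrightarrow>
        upper_jumps K v N = {i, j} \<and>
        upper_group K v N i = carrier G \<and>
        G \<cong> integer_mod_group p \<times>\<times> integer_mod_group p \<and>
        G\<lparr>carrier := upper_group K v N j\<rparr> \<cong> integer_mod_group p) \<and>
     (\<not> totally_ramified K v N \<longleftrightarrow> (\<exists>a\<in>prime_field. \<exists>x\<in>K. h a x \<in> k)) \<and>
     (\<not> totally_ramified K v N \<longrightarrow>
        i = j \<and>
        G\<lparr>carrier := lower_group K v N 0\<rparr> \<cong> integer_mod_group p \<and>
        upper_jumps K v N = {i}) \<and>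
     (i = j \<and> totally_ramified K v N \<longrightarrow>
        (\<forall>a\<in>prime_field. \<forall>x\<in>K. h a x = 0 \<or> - v (h a x) < i \<longrightarrow>
           h a x \<noteq> 0 \<and> 1 \<le> - v (h a x) \<and>
           (reduced_element p v (h a x) \<longrightarrow>
              upper_jumps K v N = {real_of_int (- v (h a x)), i} \<and>
              upper_group K v N (- v (h a x)) = carrier G \<and>
              G \<cong> integer_mod_group p \<times>\<times> integer_mod_group p \<and>
              G\<lparr>carrier := upper_group K v N i\<rparr> \<cong> integer_mod_group p)) \<and>
        ((\<exists>a\<in>prime_field. \<exists>x\<in>K. h a x = 0 \<or> - v (h a x) < i) \<longrightarrow>
           (\<exists>a\<in>prime_field. \<exists>x\<in>K. reduced_element p v (h a x) \<and> - v (h a x) < i)) \<and>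
        (\<not> (\<exists>a\<in>prime_field. \<exists>x\<in>K. h a x = 0 \<or> - v (h a x) < i) \<longrightarrow>
           upper_jumps K v N = {i} \<and>
           upper_group K v N i = carrier G \<and>
           G \<cong> integer_mod_group p \<times>\<times> integer_mod_group p))"
proof -
  have pr: "Factorial_Ring.prime p" using prime_CHAR_semidom[where 'a = 'a] char by simp
  have p2: "p \<ge> 2" using pr by (rule prime_ge_2_nat)
  interpret V: valued_field K v by (rule local_fieldD[OF K])
  note K_sf = V.N
  note kD = coefficient_fieldD[OF k V.valued_field_axioms]
  note root = exists_pth_root[OF closure char(2)]
  note sf_pf = subfield_prime_field[OF char(1) pr]
  obtain \<alpha> i0 where \<alpha>: "artin_schrier K \<alpha> p" "\<alpha> ^ p - \<alpha> = f" "L = artin_schrier.E K \<alpha>"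
    "v f = - i0" "i0 > 0" "\<not> int p dvd i0"
    by (rule artin_schrier_extension_generator[OF L(1) K f char(1) pr])
  obtain \<gamma> j0 where \<gamma>: "artin_schrier K \<gamma> p" "\<gamma> ^ p - \<gamma> = g" "M = artin_schrier.E K \<gamma>"
    "v g = - j0" "j0 > 0" "\<not> int p dvd j0"
    by (rule artin_schrier_extension_generator[OF M(1) K g char(1) pr])
  interpret A: artin_schrier K \<alpha> p by (rule \<alpha>)
  interpret B: artin_schrier K \<gamma> p by (rule \<gamma>)
  have fnz: "f \<noteq> 0" "g \<noteq> 0" using f g by (auto simp: reduced_element_def)
  have i_eq: "i = real_of_int i0"
    unfolding i upper_jump_def \<alpha>(3) using artin_schrier_jump[OF K \<alpha>(1), of i0] \<alpha> fnz by simp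
  have j_eq: "j = real_of_int j0"
    unfolding j upper_jump_def \<gamma>(3) using artin_schrier_jump[OF K \<gamma>(1), of j0] \<gamma> fnz by simp
  have pfK: "b \<in> K" if "b \<in> prime_field" for b using prime_field_subset[OF K_sf] that by blast
  have pfk: "b \<in> k" if "b \<in> prime_field" for b using prime_field_subset[OF kD(1)] that by blast
  have pf1: "(1::'a) \<in> prime_field" "(0::'a) \<in> prime_field" by (auto intro: range_eqI[of _ _ 1] range_eqI[of _ _ 0])

  \<comment> \<open>A relation with nonzero \<open>b\<close> puts \<open>\<gamma>\<close> into \<open>L\<close> and \<open>\<alpha>\<close> into \<open>M\<close>, so that \<open>L = M\<close>.\<close>
  have pair: "as_pair K \<alpha> \<gamma> p"
  proof (rule as_pair.intro)
    fix a b :: 'a assume ab: "a \<in> prime_field" "b \<in> prime_field" "a * \<alpha> + b * \<gamma> \<in> K"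
    have b0: "b = 0"
    proof (rule ccontr)
      assume b: "b \<noteq> 0"
      have "a \<noteq> 0"
      proof
        assume "a = 0"
        hence "b * \<gamma> \<in> K" using ab by simp
        hence "\<gamma> \<in> K" by (rule subfield_mult_cancel[OF K_sf]) (use b pfK ab in auto)
        thus False using B.notin by simp
      qed
      have "b * \<gamma> \<in> L"
      proof -
        have "(a * \<alpha> + b * \<gamma>) - a * \<alpha> \<in> A.E"
          by (rule subfield_diff[OF A.E_subfield]) (use ab pfK A.F_subset A.gen_in A.E_subfield in auto)
        thus ?thesis using \<alpha>(3) by simp
      qed
      hence "\<gamma> \<in> A.E" unfolding \<alpha>(3)
        by (rule subfield_mult_cancel[OF A.E_subfield]) (use b pfK[OF ab(2)] A.F_subset in auto)
      hence "M \<subseteq> L" unfolding \<alpha>(3) \<gamma>(3) using A.E_subfield A.F_subset by (intro B.E_least)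
      moreover have "a * \<alpha> \<in> M"
      proof -
        have "(a * \<alpha> + b * \<gamma>) - b * \<gamma> \<in> B.E"
          by (rule subfield_diff[OF B.E_subfield]) (use ab pfK B.F_subset B.gen_in B.E_subfield in auto)
        thus ?thesis using \<gamma>(3) by simp
      qed
      hence "\<alpha> \<in> B.E" unfolding \<gamma>(3)
        by (rule subfield_mult_cancel[OF B.E_subfield]) (use \<open>a \<noteq> 0\<close> pfK[OF ab(1)] B.F_subset in auto)
      hence "L \<subseteq> M" unfolding \<alpha>(3) \<gamma>(3) using B.E_subfield B.F_subset by (intro A.E_least)
      ultimately show False using \<open>L \<noteq> M\<close> by blast
    qed
    have "a = 0"
    proof (rule ccontr)
      assume "a \<noteq> 0"
      hence "\<alpha> \<in> K" using subfield_mult_cancel[OF K_sf _ pfK[OF ab(1)], of \<alpha>] ab b0 by simp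
      thus False using A.notin by simp
    qed
    thus "a = 0 \<and> b = 0" using b0 by simp
  qed (use K_sf char pr \<alpha> \<gamma> f g in auto)
  interpret P: as_pair K \<alpha> \<gamma> p by (rule pair)
  have PN: "P.N = N"
  proof
    have sfN: "subfield N \<Omega>" "L \<union> M \<subseteq> N" unfolding N_def compositum_def by (rule generate_field_ambient)+
    show "P.N \<subseteq> N"
      by (rule P.N_least) (use sfN \<alpha>(3) \<gamma>(3) A.F_subset A.gen_in B.gen_in in auto)
    have "L \<subseteq> P.N" unfolding \<alpha>(3) by (rule A.E_least) (use P.N_sf P.K_N P.theta_N in auto)
    moreover have "M \<subseteq> P.N" unfolding \<gamma>(3) by (rule B.E_least) (use P.N_sf P.K_N P.theta_N in auto)
    ultimately show "N \<subseteq> P.N" unfolding N_def compositum_def by (intro generate_field_ambient) (use P.N_sf in auto)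
  qed
  note N_sf = P.N_sf[unfolded PN] and K_N = P.K_N[unfolded PN] and th_N = P.theta_N[unfolded PN]

  obtain e where e: "e > 0" "discrete_valuation N (val_ext K v N)"
    "\<forall>x\<in>K - {0}. val_ext K v N x = int e * v x"
    "ramification_index K v N = e" "extension_degree K N = p * p"
    by (rule val_ext_cases[OF local_fieldD(2)[OF K] N_sf K_N P.dimension_N[unfolded PN]])
  define w where "w = val_ext K v N"
  interpret W: valued_field N w using e(2) by (simp add: discrete_valuation_iff w_def)
  have tot: "totally_ramified K v N \<longleftrightarrow> e = p * p" using e(4,5) by (simp add: totally_ramified_def)
  have sep: "\<exists>P. poly_over k P \<and> rsquarefree P \<and> val_ge w (poly P y) 1" if "y \<in> N" "val_ge w y 0" for y
    using separable that unfolding residue_separable_def valuation_ring_def w_def poly_over_def by fast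
  have pv: "as_pair_val K \<theta>1 \<theta>2 p v w k e" if "as_pair K \<theta>1 \<theta>2 p" "as_pair.N K \<theta>1 \<theta>2 = N" for \<theta>1 \<theta>2
    by (intro as_pair_val.intro as_pair_val_axioms.intro that) (use K k e that in \<open>auto simp: w_def\<close>)

  \<comment> \<open>The generator \<open>\<alpha> + a\<gamma> + x\<close> has class \<open>h a x\<close> and, together with \<open>\<gamma>\<close>, generates the same field.\<close>
  have wp_h: "(\<alpha> + a * \<gamma> + x) ^ p - (\<alpha> + a * \<gamma> + x) = h a x" if "a \<in> prime_field" for a x
    unfolding h_def artin_schrier_add[OF char(1) pr] artin_schrier_scale[OF char(1) pr that] \<alpha>(2) \<gamma>(2) by simp
  have hK: "h a x \<in> K" if "a \<in> prime_field" "x \<in> K" for a x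
    unfolding h_def using that f g K_sf pfK by simp
  have pair_h: "as_pair K (\<alpha> + a * \<gamma> + x) \<gamma> p" and N_h: "as_pair.N K (\<alpha> + a * \<gamma> + x) \<gamma> = N"
    if a: "a \<in> prime_field" and x: "x \<in> K" for a x
  proof -
    show q: "as_pair K (\<alpha> + a * \<gamma> + x) \<gamma> p"
    proof (rule as_pair.intro)
      show "(\<alpha> + a * \<gamma> + x) ^ p - (\<alpha> + a * \<gamma> + x) \<in> K" unfolding wp_h[OF a] by (rule hK[OF a x])
      fix b c :: 'a assume bc: "b \<in> prime_field" "c \<in> prime_field" "b * (\<alpha> + a * \<gamma> + x) + c * \<gamma> \<in> K"
      have "b * x \<in> K" using pfK[OF bc(1)] x K_sf by simp
      hence "(b * (\<alpha> + a * \<gamma> + x) + c * \<gamma>) - b * x \<in> K" using bc(3) K_sf by (intro subfield_diff)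
      moreover have "(b * (\<alpha> + a * \<gamma> + x) + c * \<gamma>) - b * x = b * \<alpha> + (b * a + c) * \<gamma>" by (simp add: algebra_simps)
      moreover have "b * a + c \<in> prime_field" by (rule P.pf_closed(1)[OF P.pf_closed(3)[OF bc(1) a] bc(2)])
      ultimately have "b = 0 \<and> b * a + c = 0" using P.indep[OF bc(1)] by metis
      thus "b = 0 \<and> c = 0" by auto
    qed (use K_sf char pr \<gamma> g in auto)
    interpret Q: as_pair K "\<alpha> + a * \<gamma> + x" \<gamma> p by (rule q)
    show "Q.N = N"
    proof
      have "a \<in> N" "x \<in> N" "a \<in> Q.N" "x \<in> Q.N" using pfK[OF a] x K_N Q.K_N by auto
      note aN = this
      show "Q.N \<subseteq> N" by (rule Q.N_least) (use N_sf K_N th_N aN in auto)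
      have "(\<alpha> + a * \<gamma> + x) - (a * \<gamma> + x) \<in> Q.N"
        by (rule subfield_diff[OF Q.N_sf Q.theta_N(1)]) (use Q.N_sf Q.theta_N aN in simp)
      thus "N \<subseteq> Q.N" unfolding PN[symmetric] by (intro P.N_least) (use Q.N_sf Q.K_N Q.theta_N in auto)
    qed
  qed

  have val_comb: "s + a * t \<noteq> 0 \<and> v (s + a * t) = v s"
    if "s \<in> K" "t \<in> K" "a \<in> prime_field" "s \<noteq> 0" "t \<noteq> 0" "v s < v t" for s t a
  proof -
    have "val_ge v (a * t) (0 + v t)"
      by (rule V.val_ge_mult) (use that pfK V.val_ge_prime_field[OF char(1) pr] in \<open>auto simp: val_ge_def\<close>)
    hence "val_ge v (a * t) (v s + 1)" by (rule val_ge_mono) (use that in simp)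
    thus ?thesis using V.val_add_eq[of s "a * t"] that pfK K_sf by simp
  qed
  have k0: "val_ge v c 0" if "c \<in> k" for c using kD(3)[OF that] by (cases "c = 0") (auto simp: val_ge_def)

  \<comment> \<open>For \<open>i \<noteq> j\<close> the value of \<open>f + a g\<close> would be negative and prime to \<open>p\<close>, against \<open>no_residual_class\<close>.\<close>
  have residual: "i0 = j0 \<and> e = p \<and> G\<lparr>carrier := lower_group K v N 0\<rparr> \<cong> integer_mod_group p \<and>
      upper_jumps K v N = {real_of_int i0}" if a: "a \<in> prime_field" and x: "x \<in> K" and hk: "h a x \<in> k" for a x
  proof -
    have "i0 = j0"
    proof (rule ccontr)
      assume "i0 \<noteq> j0"
      define s where "s = f + a * g"
      have s: "s \<in> K" using f g pfK[OF a] K_sf by (simp add: s_def)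
      have ge: "val_ge v (s + x ^ p - x) 0" using k0[OF hk] by (simp add: h_def s_def)
      have "s \<noteq> 0 \<and> v s < 0 \<and> \<not> int p dvd v s"
      proof (cases "a = 0 \<or> j0 < i0")
        case True
        have "s \<noteq> 0 \<and> v s = v f"
        proof (cases "a = 0")
          case False
          thus ?thesis unfolding s_def using val_comb[OF f(1) g(1) a fnz] True \<alpha> \<gamma> by simp
        qed (simp add: s_def fnz)
        thus ?thesis using \<alpha> by simp
      next
        case False
        have inv: "inverse a \<in> prime_field" by (rule subfield_inverse[OF sf_pf a])
        have c: "g + inverse a * f \<noteq> 0 \<and> v (g + inverse a * f) = v g"
          by (rule val_comb[OF g(1) f(1) inv fnz(2,1)]) (use False \<open>i0 \<noteq> j0\<close> \<alpha> \<gamma> in simp)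
        have sa: "s = a * (g + inverse a * f)" using False by (simp add: s_def field_simps)
        have "v s = v a + v (g + inverse a * f)" unfolding sa
          by (rule V.val_mult) (use False c f g pfK[OF a] pfK[OF inv] K_sf in auto)
        hence "s \<noteq> 0 \<and> v s = v g" using c V.val_prime_field[OF char(1) pr a] False sa by simp
        thus ?thesis using \<gamma> by simp
      qed
      thus False using V.no_residual_class[OF char(1) pr s _ _ _ x] ge by blast
    qed
    interpret Q: as_pair_val K "\<alpha> + a * \<gamma> + x" \<gamma> p v w k e by (rule pv[OF pair_h[OF a x] N_h[OF a x]])
    have QN: "Q.N = N" by (rule N_h[OF a x])
    have hk': "(\<alpha> + a * \<gamma> + x) ^ p - (\<alpha> + a * \<gamma> + x) \<in> k" unfolding wp_h[OF a] by (rule hk)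
    have wQ: "w = val_ext K v Q.N" by (simp add: w_def QN)
    note R = Q.residual_filtration[OF wQ hk', of j0]
    have "e = p" "lower_group K v N 0 = Q.line" "upper_jumps K v N = {real_of_int j0}"
      using R \<gamma> fnz unfolding QN by auto
    moreover have "G\<lparr>carrier := Q.line\<rparr> \<cong> integer_mod_group p" using Q.line_iso unfolding QN G_def .
    ultimately show ?thesis using \<open>i0 = j0\<close> by simp
  qed

  \<comment> \<open>The criterion yields \<open>g + b f + x\<^sup>p - x \<in> k\<close>; here \<open>b \<noteq> 0\<close>, and division by \<open>b\<close> gives a value of \<open>h\<close>.\<close>
  have not_total: "\<exists>a\<in>prime_field. \<exists>x\<in>K. h a x \<in> k" if ne: "e \<noteq> p * p"
  proof -
    interpret Q: as_pair_val K \<alpha> \<gamma> p v w k e by (rule pv[OF pair PN])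
    have "e = p * p \<or> (\<exists>b\<in>prime_field. \<exists>x\<in>K. (\<gamma> ^ p - \<gamma>) + b * (\<alpha> ^ p - \<alpha>) + x ^ p - x \<in> k)"
      by (rule Q.ramified_or_residual[of i0]) (use \<alpha> fnz root sep PN in auto)
    then obtain b x where b: "b \<in> prime_field" "x \<in> K" "g + b * f + x ^ p - x \<in> k"
      using ne \<alpha>(2) \<gamma>(2) by auto
    have b0: "b \<noteq> 0"
    proof
      assume "b = 0"
      hence "val_ge v (g + x ^ p - x) 0" using k0[OF b(3)] by simp
      thus False using V.no_residual_class[OF char(1) pr g(1) fnz(2) _ _ b(2)] \<gamma> by simp
    qed
    have inv: "inverse b \<in> prime_field" by (rule subfield_inverse[OF sf_pf b(1)])
    have "h (inverse b) (inverse b * x) = inverse b * (g + b * f + x ^ p - x)"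
    proof -
      have "h (inverse b) (inverse b * x) = f + inverse b * g + ((inverse b * x) ^ p - inverse b * x)" by (simp add: h_def)
      also have "\<dots> = f + inverse b * g + inverse b * (x ^ p - x)"
        by (simp only: artin_schrier_scale[OF char(1) pr inv])
      also have "\<dots> = inverse b * (g + b * f + x ^ p - x)" using b0 by (simp add: field_simps)
      finally show ?thesis .
    qed
    also have "\<dots> \<in> k" using b(3) pfk[OF inv] kD(1) by simp
    finally have "h (inverse b) (inverse b * x) \<in> k" .
    moreover have "inverse b * x \<in> K" using pfK[OF inv] b(2) K_sf by simp
    ultimately show ?thesis using inv by blast
  qed
  have tot_iff: "\<not> totally_ramified K v N \<longleftrightarrow> (\<exists>a\<in>prime_field. \<exists>x\<in>K. h a x \<in> k)"
  proof
    assume "\<exists>a\<in>prime_field. \<exists>x\<in>K. h a x \<in> k"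
    hence "e = p" using residual by blast
    thus "\<not> totally_ramified K v N" using tot p2 by simp
  qed (use tot not_total in blast)

  obtain u where u: "u \<in> N" "u \<noteq> 0" "w u = 1" using discrete_valuation_uniformizer[OF e(2)] by (auto simp: w_def)
  have solved: "as_pair_solved K \<theta>1 \<theta>2 p v w k e u l n"
    if t: "totally_ramified K v N" and q: "as_pair K \<theta>1 \<theta>2 p" "as_pair.N K \<theta>1 \<theta>2 = N"
      and r1: "\<theta>1 ^ p - \<theta>1 = f1" "f1 \<noteq> 0" "v f1 = - l" "l > 0" "\<not> int p dvd l"
      and r2: "\<theta>2 ^ p - \<theta>2 = f2" "\<And>b. b \<in> prime_field \<Longrightarrow> f2 + b * f1 \<noteq> 0 \<and> v (f2 + b * f1) = - n"
      and n: "\<not> int p dvd n" "l \<le> n" for \<theta>1 \<theta>2 f1 f2 l n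
    by (intro as_pair_solved.intro as_pair_total.intro pv[OF q] as_pair_total_axioms.intro as_pair_solved_axioms.intro)
      (use t tot u q(2) r1 r2 n in simp_all)

  have part1: "upper_jumps K v N = {i, j} \<and> upper_group K v N i = carrier G \<and>
        G \<cong> integer_mod_group p \<times>\<times> integer_mod_group p \<and>
        G\<lparr>carrier := upper_group K v N j\<rparr> \<cong> integer_mod_group p" if lt: "i < j"
  proof -
    have ij: "i0 < j0" using lt by (simp add: i_eq j_eq)
    have t: "totally_ramified K v N"
    proof (rule ccontr)
      assume "\<not> ?thesis"
      then obtain a x where "a \<in> prime_field" "x \<in> K" "h a x \<in> k" using tot_iff by blast
      thus False using residual ij by blast
    qed
    have comb: "g + b * f \<noteq> 0 \<and> v (g + b * f) = - j0" if "b \<in> prime_field" for b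
      using val_comb[OF g(1) f(1) that fnz(2,1)] \<alpha> \<gamma> ij by simp
    interpret S: as_pair_solved K \<alpha> \<gamma> p v w k e u i0 j0
      by (rule solved[OF t pair PN \<alpha>(2) fnz(1) \<alpha>(4,5,6) \<gamma>(2) comb \<gamma>(6)]) (use ij in auto)
    have wS: "w = val_ext K v P.N" by (simp add: w_def PN)
    note T = S.two_jumps[OF wS ij, unfolded PN] P.Gal_iso[unfolded PN] P.line_iso[unfolded PN]
    show ?thesis unfolding i_eq j_eq G_def T(1,2,3) using T(4,5) by blast
  qed

  \<comment> \<open>An integral \<open>h a x\<close> would be congruent to an element of \<open>k\<close> modulo some \<open>y\<^sup>p - y\<close>.\<close>
  have neg_h: "h a x \<noteq> 0 \<and> v (h a x) < 0" if t: "totally_ramified K v N" and a: "a \<in> prime_field" and x: "x \<in> K" for a x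
  proof (rule ccontr)
    assume "\<not> ?thesis"
    hence "val_ge v (h a x) 0" by (auto simp: val_ge_def)
    then obtain c where c: "c \<in> k" "val_ge v (h a x - c) 1" using kD(4)[OF hK[OF a x]] by blast
    have "h a x - c \<in> K" using hK[OF a x] c(1) kD(2) K_sf by (intro subfield_diff) auto
    then obtain y where y: "y \<in> K" "y ^ p - y = h a x - c" using hensel_artin_schrier[OF K char(1) pr _ c(2)] by blast
    have "h a (x - y) = h a x - (y ^ p - y)"
    proof -
      have "h a (x - y) = f + a * g + ((x - y) ^ p - (x - y))" by (simp add: h_def)
      also have "\<dots> = f + a * g + ((x ^ p - x) - (y ^ p - y))" by (simp only: artin_schrier_diff[OF char(1) pr])
      finally show ?thesis by (simp add: h_def)
    qed
    hence "h a (x - y) \<in> k" using c y(2) by simp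
    moreover have "x - y \<in> K" using x y K_sf by simp
    ultimately show False using tot_iff t a by blast
  qed

  \<comment> \<open>Here \<open>\<theta>\<^sub>1 = \<alpha> + a\<gamma> + x\<close> has the smaller jump, and adding multiples of its class leaves the value of \<open>g\<close> unchanged.\<close>
  have small: "upper_jumps K v N = {real_of_int (- v (h a x)), i} \<and>
              upper_group K v N (- v (h a x)) = carrier G \<and>
              G \<cong> integer_mod_group p \<times>\<times> integer_mod_group p \<and>
              G\<lparr>carrier := upper_group K v N i\<rparr> \<cong> integer_mod_group p"
    if eq: "i = j" and t: "totally_ramified K v N" and a: "a \<in> prime_field" and x: "x \<in> K"
      and lt: "- v (h a x) < i" and red: "reduced_element p v (h a x)" for a x
  proof -
    have ij: "i0 = j0" using eq by (simp add: i_eq j_eq)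
    have lt': "- v (h a x) < i0" using lt by (simp add: i_eq)
    note neg = neg_h[OF t a x]
    have nd: "\<not> int p dvd - v (h a x)"
    proof
      assume "int p dvd - v (h a x)"
      hence "int p dvd v (h a x)" by simp
      hence "int p dvd 1" using red unfolding reduced_element_def by (meson coprime_common_divisor dvd_refl)
      thus False using p2 by simp
    qed
    have comb: "g + b * h a x \<noteq> 0 \<and> v (g + b * h a x) = - i0" if "b \<in> prime_field" for b
      using val_comb[OF g(1) hK[OF a x] that fnz(2)] neg \<gamma> ij lt' by simp
    interpret S: as_pair_solved K "\<alpha> + a * \<gamma> + x" \<gamma> p v w k e u "- v (h a x)" i0
      by (rule solved[OF t pair_h[OF a x] N_h[OF a x] wp_h[OF a] _ _ _ nd \<gamma>(2) comb \<alpha>(6)])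
        (use neg lt' in auto)
    have SN: "S.N = N" by (rule N_h[OF a x])
    have wS: "w = val_ext K v S.N" by (simp add: w_def SN)
    note T = S.two_jumps[OF wS lt', unfolded SN] S.Gal_iso[unfolded SN] S.line_iso[unfolded SN]
    show ?thesis unfolding i_eq G_def T(1,2,3) using T(4,5) by blast
  qed

  \<comment> \<open>Reduction does not lower the value of \<open>h a x\<close>; separability and total ramification exclude the other outcomes.\<close>
  have exists_reduced: "\<exists>a\<in>prime_field. \<exists>x\<in>K. reduced_element p v (h a x) \<and> - v (h a x) < i"
    if t: "totally_ramified K v N" and a: "a \<in> prime_field" and x: "x \<in> K" and lt: "- v (h a x) < i" for a x
  proof -
    note neg = neg_h[OF t a x]
    obtain y where y: "y \<in> K" "\<forall>b\<le>0. val_ge v (h a x) b \<longrightarrow> val_ge v (h a x + y ^ p - y) b"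
      "h a x + y ^ p - y \<in> k \<or> (reduced_element p v (h a x + y ^ p - y) \<and> v (h a x + y ^ p - y) < 0) \<or>
       fierce p K v k (h a x + y ^ p - y)"
      using artin_schrier_reduction[OF K k char(1) pr hK[OF a x]] by blast
    have heq: "h a x + y ^ p - y = h a (x + y)"
    proof -
      have "h a (x + y) = f + a * g + ((x + y) ^ p - (x + y))" by (simp add: h_def)
      also have "\<dots> = f + a * g + ((x ^ p - x) + (y ^ p - y))" by (simp only: artin_schrier_add[OF char(1) pr])
      finally show ?thesis by (simp add: h_def)
    qed
    have xy: "x + y \<in> K" using x y K_sf by simp
    have aN: "\<alpha> + a * \<gamma> + (x + y) \<in> N" using th_N subsetD[OF K_N pfK[OF a]] subsetD[OF K_N xy] N_sf by simp
    have "\<not> fierce p K v k ((\<alpha> + a * \<gamma> + (x + y)) ^ p - (\<alpha> + a * \<gamma> + (x + y)))"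
    proof (rule not_fierce[OF W.valued_field_axioms V.valued_field_axioms K_N _ _ k char(1) pr root sep aN])
      show "w z = int e * v z" if "z \<in> K" "z \<noteq> 0" for z using e(3) that unfolding w_def by blast
      show "(\<alpha> + a * \<gamma> + (x + y)) ^ p - (\<alpha> + a * \<gamma> + (x + y)) \<in> K" unfolding wp_h[OF a] by (rule hK[OF a xy])
    qed (use e in auto)
    hence "\<not> fierce p K v k (h a (x + y))" unfolding wp_h[OF a] .
    moreover have "h a (x + y) \<notin> k" using tot_iff t a xy by blast
    ultimately have red: "reduced_element p v (h a (x + y))" using y(3) unfolding heq by blast
    have "val_ge v (h a (x + y)) (v (h a x))"
      using y(2) neg unfolding heq by (auto simp: val_ge_def)
    hence "v (h a x) \<le> v (h a (x + y))" using red by (auto simp: val_ge_def reduced_element_def)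
    hence "- v (h a (x + y)) < i" using lt by linarith
    thus ?thesis using a xy red by blast
  qed

  \<comment> \<open>The assumption on \<open>h\<close> with \<open>x = 0\<close> shows that no \<open>f + b g\<close> has a value above \<open>-i\<close>.\<close>
  have generic: "upper_jumps K v N = {i} \<and> upper_group K v N i = carrier G \<and>
           G \<cong> integer_mod_group p \<times>\<times> integer_mod_group p"
    if eq: "i = j" and t: "totally_ramified K v N"
      and no: "\<not> (\<exists>a\<in>prime_field. \<exists>x\<in>K. h a x = 0 \<or> - v (h a x) < i)"
  proof -
    have ij: "i0 = j0" using eq by (simp add: i_eq j_eq)
    have comb: "f + b * g \<noteq> 0 \<and> v (f + b * g) = - i0" if b: "b \<in> prime_field" for b
    proof -
      have h0: "h b 0 = f + b * g" using p2 by (simp add: h_def)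
      have "f + b * g \<noteq> 0 \<and> \<not> (- v (f + b * g) < i)" using no b subfield_zero[OF K_sf] h0 by metis
      moreover have "val_ge v (f + b * g) (- i0)"
      proof (rule V.val_ge_add)
        have "val_ge v (b * g) (0 + - i0)"
          by (rule V.val_ge_mult) (use pfK[OF b] g V.val_ge_prime_field[OF char(1) pr b] \<gamma> ij in \<open>auto simp: val_ge_def\<close>)
        thus "val_ge v (b * g) (- i0)" by simp
      qed (use f g \<alpha> pfK[OF b] K_sf in \<open>auto simp: val_ge_def\<close>)
      ultimately show ?thesis by (auto simp: val_ge_def i_eq)
    qed
    have N': "as_pair.N K \<gamma> \<alpha> = N" using P.N_swap PN by simp
    interpret S: as_pair_solved K \<gamma> \<alpha> p v w k e u i0 i0
      by (rule solved[OF t P.swap N' \<gamma>(2) fnz(2) _ _ _ \<alpha>(2) comb \<alpha>(6)]) (use \<gamma> \<alpha> ij in auto)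
    have wS: "w = val_ext K v S.N" by (simp add: w_def N')
    note T = S.one_jump[OF wS refl, unfolded N'] S.Gal_iso[unfolded N']
    show ?thesis unfolding i_eq G_def using T by blast
  qed

  show ?thesis
  proof (intro conjI impI ballI)
    show "i = j" "G\<lparr>carrier := lower_group K v N 0\<rparr> \<cong> integer_mod_group p" "upper_jumps K v N = {i}"
      if nt: "\<not> totally_ramified K v N"
    proof -
      obtain a x where "a \<in> prime_field" "x \<in> K" "h a x \<in> k" using tot_iff nt by blast
      note R = residual[OF this]
      show "i = j" "G\<lparr>carrier := lower_group K v N 0\<rparr> \<cong> integer_mod_group p" "upper_jumps K v N = {i}"
        using R by (auto simp: i_eq j_eq)
    qed
  next
    fix a x assume t: "i = j \<and> totally_ramified K v N" and a: "a \<in> prime_field" and x: "x \<in> K"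
      and s: "h a x = 0 \<or> real_of_int (- v (h a x)) < i"
    note neg = neg_h[OF conjunct2[OF t] a x]
    show "h a x \<noteq> 0" "1 \<le> - v (h a x)" using neg by auto
    assume red: "reduced_element p v (h a x)"
    have lt: "- v (h a x) < i" using s neg by blast
    note S = small[OF conjunct1[OF t] conjunct2[OF t] a x lt red]
    show "upper_jumps K v N = {real_of_int (- v (h a x)), i}" "upper_group K v N (- v (h a x)) = carrier G"
      "G \<cong> integer_mod_group p \<times>\<times> integer_mod_group p"
      "G\<lparr>carrier := upper_group K v N i\<rparr> \<cong> integer_mod_group p" using S by blast+
  next
    assume t: "i = j \<and> totally_ramified K v N"
      and "\<exists>a\<in>prime_field. \<exists>x\<in>K. h a x = 0 \<or> real_of_int (- v (h a x)) < i"
    then obtain a x where ax: "a \<in> prime_field" "x \<in> K" "h a x = 0 \<or> real_of_int (- v (h a x)) < i" by blast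
    have "- v (h a x) < i" using ax(3) neg_h[OF conjunct2[OF t] ax(1,2)] by blast
    thus "\<exists>a\<in>prime_field. \<exists>x\<in>K. reduced_element p v (h a x) \<and> real_of_int (- v (h a x)) < i"
      by (rule exists_reduced[OF conjunct2[OF t] ax(1,2)])
  qed (use part1 tot_iff generic in blast)+
qed

end
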